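(* Let $\tau=\mathbb N$, let $\sigma$ be an arbitrary finite type, and let $t\colon\mathbb N$ be a term of system $\mathsf T$ whose only free variable is $\alpha\colon\mathbb N\to\tau$. Let $t^\circ=\langle \mathrm{Val}_{t^\circ};\mathsf B_{t^\circ}\rangle$ be the translation of $t$ and let $\Phi^{\lambda\alpha.t}$ be the term, both defined in the context, and put $\xi:=\Phi^{\lambda\alpha.t}(\mathsf B_{t^\circ})$. Then $\mathbf{HA}^\omega$ proves that $\xi$ is Spector's bar recursor for $Y=\lambda\alpha.t$: for all $G\colon\tau^*\to\sigma$, $H\colon\tau^*\to(\tau\to\sigma)\to\sigma$ and $s\colon\tau^*$, $$(\lambda\alpha.t)(\hat s)<|s|\ \to\ \xi(G,H)(s)=G(s),$$ $$(\lambda\alpha.t)(\hat s)\ge|s|\ \to\ \xi(G,H)(s)=H(s)(\lambda x^\tau.\,\xi(G,H)(s*x)).$$ Moreover, if $t\in\mathsf T_i$ then $\Phi^{\lambda\alpha.t}(\mathsf B_{t^\circ})\in\mathsf T_j$, where $j=2+\max\{1,\mathrm{level}(\sigma)\}+i$.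
   Context: Finite types: $\mathbb N$ is a finite type, and if $\tau_0,\tau_1$ are finite types then so are $\tau_0\to\tau_1$ (also written $\tau_1^{\tau_0}$) and $\tau_0^*$ (finite sequences); finite products $\tau\times\sigma$, with pairs $\langle s;t\rangle$, are used as a definitional extension. Type levels: $\mathrm{level}(\mathbb N)=0$, $\mathrm{level}(\rho\to\eta)=\max\{\mathrm{level}(\rho)+1,\mathrm{level}(\eta)\}$, $\mathrm{level}(\tau\times\sigma)=\max\{\mathrm{level}(\tau),\mathrm{level}(\sigma)\}$, $\mathrm{level}(\tau^* )=\mathrm{level}(\tau)$. System $\mathsf T$ is the simply typed $\lambda$-calculus with $0$, $\mathsf{Succ}$ and recursors $\mathsf{Rec}^\rho$ for every finite type $\rho$, with $\mathsf{Rec}^\rho(a,f)(0)=a$, $\mathsf{Rec}^\rho(a,f)(\mathsf{Succ}(m))=f(m,\mathsf{Rec}^\rho(a,f)(m))$. $\mathsf T_i$ is the fragment in which $\mathsf{Rec}^\rho$ is restricted to $\mathrm{level}(\rho)\le i$. $\mathbf{HA}^\omega$ is intuitionistic Heyting arithmetic in all finite types. Notation: $|s|$ is the length of $s\colon\tau^*$; $s*x$ is $s$ with $x\colon\tau$ appended; $\hat s\colon\mathbb N\to\tau$ extends $s$ by infinitely many zero objects $0^\tau$. The term $\Psi$. Define by primitive recursion $\varphi(G,H)(0)=G$ and, for $n>0$, $\varphi(G,H)(n)=\lambda s^{\tau^*}.H(s)(\lambda x^\tau.\varphi(G,H)(n-1)(s*x))$. For $k\colon\mathbb N$ put $\Psi(k)(G,H)(s)=G(s)$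 if $|s|>k$, and $\Psi(k)(G,H)(s)=\varphi(G,H)(k+1-|s|)(s)$ if $|s|\le k$. The term $\Phi^Y$. For a closed term $Y\colon\tau^{\mathbb N}\to\mathbb N$ let $\mathcal H^Y(G,H)(s)(f^{\tau\to\sigma})=G(s)$ if $Y(\hat s)<|s|$, and $=H(s)(f)$ otherwise. For $\Delta\colon(\tau^*\to\sigma)\to(\tau^*\to(\tau\to\sigma)\to\sigma)\to\tau^*\to\sigma$ put $$\Phi^Y(\Delta)(G,H)(s)=\Delta\big(\lambda s'.\Psi(Y(\widehat{s'}))(G,H)(s'),\ \mathcal H^Y(G,H)\big)(s).$$ Translation of types (built from $\mathbb N$ and $\to$): $\mathbb N^\circ=(\tau^{\mathbb N}\to\mathbb N)\times\big((\tau^*\to\sigma)\to(\tau^*\to(\tau\to\sigma)\to\sigma)\to\tau^*\to\sigma\big)$ and $(\rho_0\to\rho_1)^\circ=\rho_0^\circ\to\rho_1^\circ$. For $u\colon\mathbb N^\circ$ write $u=\langle\mathrm{Val}_u;\mathsf B_u\rangle$. Translation of terms ($\tau=\mathbb N$). The term $t$ and its subterms have types built from $\mathbb N$ and $\to$. $\alpha$ is a special variable of type $\mathbb N\to\mathbb N$ (not treated as an ordinary variable); each ordinary variable $x\colon\eta$ is mapped to a variable $x^\circ\colon\eta^\circ$. A term $t\colon\rho$ is translated to $t^\circ\colon\rho^\circ$ by: - $0^\circ=\langle\lambda\alpha.0;\ \lambda G,H.G\rangle$; - $\mathsf{Succ}^\circ=\lambda x^{\mathbb N^\circ}.\langle\lambda\alpha.\mathsf{Succ}(\mathrm{Val}_x(\alpha));\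 \mathsf B_x\rangle$; - $\alpha^\circ=\lambda x^{\mathbb N^\circ}.\langle\lambda\alpha.\alpha(\mathrm{Val}_x(\alpha));\ \lambda G,H.\,\mathsf B_x(\lambda s'.\Psi(\mathrm{Val}_x(\widehat{s'}))(G,H)(s'),H)\rangle$; - $(x^\eta)^\circ=x^\circ$; $(\lambda x^\eta.t)^\circ=\lambda x^\circ.t^\circ$; $(uv)^\circ=u^\circ v^\circ$; - for $\eta=\rho\to\mathbb N$ (with $\rho$ standing for a tuple of argument types when there are several, $v$ then being the corresponding tuple of variables, and with $\rho$ and $v$ omitted if $\eta=\mathbb N$): $(\mathsf{Rec}^\eta)^\circ=\lambda a^{\eta^\circ},F^{\mathbb N^\circ\to\eta^\circ\to\eta^\circ},x^{\mathbb N^\circ},v^{\rho^\circ}.\langle\lambda\alpha.\mathrm{Val}_{r[\mathrm{Val}_x(\alpha)]}(\alpha);\ \mathsf B\rangle$, where $r[n]=\mathsf{Rec}^{\eta^\circ}(a,\lambda k^{\mathbb N}.F(k^\circ))(n)(v)$, $k^\circ=\langle\lambda\alpha.k;\lambda G,H.G\rangle$ and $\mathsf B(G,H)(s)=\mathsf B_x(\lambda s'.\mathsf B_{r[\mathrm{Val}_x(\widehat{s'})]}(G,H)(s'),H)(s)$.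
   Formalization: Provability is shown in Heyting arithmetic in all finite types with extensional equality (E-HA^ω) rather than plain HA^ω; without extensionality the second equation fails (e.g. t=0, σ=N, s empty, H(s) returning the code of its argument). *)

theory Defs
  imports Main
begin

section \<open>Finite types and the terms of system T\<close>

datatype ty =
    Nat
  | Fun ty ty (infixr \<open>\<rightarrow>\<close> 70)
  | Star ty
  | Prod ty ty

primrec level :: "ty \<Rightarrow> nat" where
  "level Nat = 0"
| "level (T \<rightarrow> U) = max (level T + 1) (level U)"
| "level (Star T) = level T"
| "level (Prod T U) = max (level T) (level U)"

text \<open>
  Besides zero, successor and the recursors, the constants are those of the definitional
  extension by pairs and finite sequences: \<open>EmpC\<close> is the empty sequence, \<open>SnocC\<close> appends one
  element, \<open>LenC\<close> is the length, and \<open>HatC\<close> sends a sequence to its extension by infinitely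
  many zero objects.
\<close>

datatype con =
    ZeroC
  | SuccC
  | RecC ty
  | PairC ty ty
  | FstC ty ty
  | SndC ty ty
  | EmpC ty
  | SnocC ty
  | LenC ty
  | HatC ty

primrec con_ty :: "con \<Rightarrow> ty" where
  "con_ty ZeroC = Nat"
| "con_ty SuccC = Nat \<rightarrow> Nat"
| "con_ty (RecC T) = T \<rightarrow> (Nat \<rightarrow> T \<rightarrow> T) \<rightarrow> Nat \<rightarrow> T"
| "con_ty (PairC T U) = T \<rightarrow> U \<rightarrow> Prod T U"
| "con_ty (FstC T U) = Prod T U \<rightarrow> T"
| "con_ty (SndC T U) = Prod T U \<rightarrow> U"
| "con_ty (EmpC T) = Star T"
| "con_ty (SnocC T) = Star T \<rightarrow> T \<rightarrow> Star T"
| "con_ty (LenC T) = Star T \<rightarrow> Nat"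
| "con_ty (HatC T) = Star T \<rightarrow> Nat \<rightarrow> T"

text \<open>Variables are de Bruijn indices; abstractions carry the type of the bound variable.\<close>

datatype tm =
    Var nat
  | Con con
  | App tm tm (infixl \<open>\<cdot>\<close> 200)
  | Lam ty tm

abbreviation "Zero \<equiv> Con ZeroC"
abbreviation "Succ \<equiv> Con SuccC"
abbreviation "Rec T \<equiv> Con (RecC T)"
abbreviation "Emp T \<equiv> Con (EmpC T)"
abbreviation "Snoc T \<equiv> Con (SnocC T)"
abbreviation "Len T \<equiv> Con (LenC T)"
abbreviation "Hat T \<equiv> Con (HatC T)"
abbreviation pair :: "ty \<Rightarrow> ty \<Rightarrow> tm \<Rightarrow> tm \<Rightarrow> tm" where
  "pair T U a b \<equiv> Con (PairC T U) \<cdot> a \<cdot> b"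
abbreviation fst_tm :: "ty \<Rightarrow> ty \<Rightarrow> tm \<Rightarrow> tm" where
  "fst_tm T U p \<equiv> Con (FstC T U) \<cdot> p"
abbreviation snd_tm :: "ty \<Rightarrow> ty \<Rightarrow> tm \<Rightarrow> tm" where
  "snd_tm T U p \<equiv> Con (SndC T U) \<cdot> p"

inductive typing :: "ty list \<Rightarrow> tm \<Rightarrow> ty \<Rightarrow> bool" (\<open>_ \<turnstile> _ \<triangleright> _\<close> [50, 50, 50] 50) where
  Var: "i < length E \<Longrightarrow> E \<turnstile> Var i \<triangleright> E ! i"
| Con: "E \<turnstile> Con c \<triangleright> con_ty c"
| App: "E \<turnstile> t \<triangleright> T \<rightarrow> U \<Longrightarrow> E \<turnstile> u \<triangleright> T \<Longrightarrow> E \<turnstile> t \<cdot> u \<triangleright> U"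
| Lam: "T # E \<turnstile> t \<triangleright> U \<Longrightarrow> E \<turnstile> Lam T t \<triangleright> T \<rightarrow> U"

primrec rec_level_le :: "nat \<Rightarrow> tm \<Rightarrow> bool" where
  "rec_level_le i (Var n) \<longleftrightarrow> True"
| "rec_level_le i (Con c) \<longleftrightarrow> (case c of RecC T \<Rightarrow> level T \<le> i | _ \<Rightarrow> True)"
| "rec_level_le i (t \<cdot> u) \<longleftrightarrow> rec_level_le i t \<and> rec_level_le i u"
| "rec_level_le i (Lam T t) \<longleftrightarrow> rec_level_le i t"

text \<open>\<open>in_T i E t T\<close>: in the context \<open>E\<close>, \<open>t\<close> is a term of type \<open>T\<close> of the fragment \<open>T\<^sub>i\<close>.\<close>

definition in_T :: "nat \<Rightarrow> ty list \<Rightarrow> tm \<Rightarrow> ty \<Rightarrow> bool" where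
  "in_T i E t T \<longleftrightarrow> E \<turnstile> t \<triangleright> T \<and> rec_level_le i t"

primrec lift :: "tm \<Rightarrow> nat \<Rightarrow> tm" where
  "lift (Var i) k = (if i < k then Var i else Var (i + 1))"
| "lift (Con c) k = Con c"
| "lift (t \<cdot> u) k = lift t k \<cdot> lift u k"
| "lift (Lam T t) k = Lam T (lift t (k + 1))"

primrec subst :: "tm \<Rightarrow> tm \<Rightarrow> nat \<Rightarrow> tm" where
  "subst (Var i) s k = (if k < i then Var (i - 1) else if i = k then s else Var i)"
| "subst (Con c) s k = Con c"
| "subst (t \<cdot> u) s k = subst t s k \<cdot> subst u s k"
| "subst (Lam T t) s k = Lam T (subst t (lift s 0) (k + 1))"

primrec zero_obj :: "ty \<Rightarrow> tm" where
  "zero_obj Nat = Zero"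
| "zero_obj (T \<rightarrow> U) = Lam T (zero_obj U)"
| "zero_obj (Star T) = Emp T"
| "zero_obj (Prod T U) = pair T U (zero_obj T) (zero_obj U)"


section \<open>Heyting arithmetic in all finite types\<close>

datatype fm =
    Eq ty tm tm
  | Bot
  | And fm fm
  | Or fm fm
  | Imp fm fm
  | All ty fm
  | Ex ty fm

primrec wf_fm :: "ty list \<Rightarrow> fm \<Rightarrow> bool" where
  "wf_fm E (Eq T t u) \<longleftrightarrow> E \<turnstile> t \<triangleright> T \<and> E \<turnstile> u \<triangleright> T"
| "wf_fm E Bot \<longleftrightarrow> True"
| "wf_fm E (And A B) \<longleftrightarrow> wf_fm E A \<and> wf_fm E B"
| "wf_fm E (Or A B) \<longleftrightarrow> wf_fm E A \<and> wf_fm E B"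
| "wf_fm E (Imp A B) \<longleftrightarrow> wf_fm E A \<and> wf_fm E B"
| "wf_fm E (All T A) \<longleftrightarrow> wf_fm (T # E) A"
| "wf_fm E (Ex T A) \<longleftrightarrow> wf_fm (T # E) A"

primrec lift_fm :: "fm \<Rightarrow> nat \<Rightarrow> fm" where
  "lift_fm (Eq T t u) k = Eq T (lift t k) (lift u k)"
| "lift_fm Bot k = Bot"
| "lift_fm (And A B) k = And (lift_fm A k) (lift_fm B k)"
| "lift_fm (Or A B) k = Or (lift_fm A k) (lift_fm B k)"
| "lift_fm (Imp A B) k = Imp (lift_fm A k) (lift_fm B k)"
| "lift_fm (All T A) k = All T (lift_fm A (k + 1))"
| "lift_fm (Ex T A) k = Ex T (lift_fm A (k + 1))"

primrec subst_fm :: "fm \<Rightarrow> tm \<Rightarrow> nat \<Rightarrow> fm" where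
  "subst_fm (Eq T t u) s k = Eq T (subst t s k) (subst u s k)"
| "subst_fm Bot s k = Bot"
| "subst_fm (And A B) s k = And (subst_fm A s k) (subst_fm B s k)"
| "subst_fm (Or A B) s k = Or (subst_fm A s k) (subst_fm B s k)"
| "subst_fm (Imp A B) s k = Imp (subst_fm A s k) (subst_fm B s k)"
| "subst_fm (All T A) s k = All T (subst_fm A (lift s 0) (k + 1))"
| "subst_fm (Ex T A) s k = Ex T (subst_fm A (lift s 0) (k + 1))"

text \<open>
  \<open>HA E \<Gamma> A\<close>: the formula \<open>A\<close>, with free variables typed by \<open>E\<close>, is derivable from the
  hypotheses \<open>\<Gamma>\<close>. Equality is available at every type and is extensional (rule \<open>Ext\<close>), so
  an equation of higher type has the same force as its pointwise form. This is the
  system often written E-HA\<open>\<^sup>\<omega>\<close>. Extensionality is needed: the equations of a bar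
  recursor contain the abstraction \<open>\<lambda>x. \<xi>(G,H)(s*x)\<close> as an argument of \<open>H\<close>, and the
  functional that \<open>\<xi>(G,H)(s)\<close> really passes to \<open>H(s)\<close> agrees with it only pointwise.
  In \<open>NatInd\<close> and \<open>SeqInd\<close> the \<open>lift_fm\<close> at position 1 makes room for the new variables
  beside variable 0 of \<open>A\<close>, which is then replaced.
\<close>

inductive HA :: "ty list \<Rightarrow> fm list \<Rightarrow> fm \<Rightarrow> bool" where
  Hyp: "A \<in> set \<Gamma> \<Longrightarrow> wf_fm E A \<Longrightarrow> HA E \<Gamma> A"
| BotE: "HA E \<Gamma> Bot \<Longrightarrow> wf_fm E A \<Longrightarrow> HA E \<Gamma> A"
| AndI: "HA E \<Gamma> A \<Longrightarrow> HA E \<Gamma> B \<Longrightarrow> HA E \<Gamma> (And A B)"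
| AndE1: "HA E \<Gamma> (And A B) \<Longrightarrow> HA E \<Gamma> A"
| AndE2: "HA E \<Gamma> (And A B) \<Longrightarrow> HA E \<Gamma> B"
| OrI1: "HA E \<Gamma> A \<Longrightarrow> wf_fm E B \<Longrightarrow> HA E \<Gamma> (Or A B)"
| OrI2: "HA E \<Gamma> B \<Longrightarrow> wf_fm E A \<Longrightarrow> HA E \<Gamma> (Or A B)"
| OrE: "HA E \<Gamma> (Or A B) \<Longrightarrow> HA E (A # \<Gamma>) C \<Longrightarrow> HA E (B # \<Gamma>) C \<Longrightarrow> HA E \<Gamma> C"
| ImpI: "HA E (A # \<Gamma>) B \<Longrightarrow> wf_fm E A \<Longrightarrow> HA E \<Gamma> (Imp A B)"
| ImpE: "HA E \<Gamma> (Imp A B) \<Longrightarrow> HA E \<Gamma> A \<Longrightarrow> HA E \<Gamma> B"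
| AllI: "HA (T # E) (map (\<lambda>B. lift_fm B 0) \<Gamma>) A \<Longrightarrow> HA E \<Gamma> (All T A)"
| AllE: "HA E \<Gamma> (All T A) \<Longrightarrow> E \<turnstile> t \<triangleright> T \<Longrightarrow> HA E \<Gamma> (subst_fm A t 0)"
| ExI: "HA E \<Gamma> (subst_fm A t 0) \<Longrightarrow> E \<turnstile> t \<triangleright> T \<Longrightarrow> wf_fm (T # E) A \<Longrightarrow> HA E \<Gamma> (Ex T A)"
| ExE: "HA E \<Gamma> (Ex T A) \<Longrightarrow> HA (T # E) (A # map (\<lambda>B. lift_fm B 0) \<Gamma>) (lift_fm C 0) \<Longrightarrow>
    wf_fm E C \<Longrightarrow> HA E \<Gamma> C"

| Refl: "E \<turnstile> t \<triangleright> T \<Longrightarrow> HA E \<Gamma> (Eq T t t)"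
| Subst: "HA E \<Gamma> (Eq T t u) \<Longrightarrow> HA E \<Gamma> (subst_fm A t 0) \<Longrightarrow> wf_fm (T # E) A \<Longrightarrow>
    HA E \<Gamma> (subst_fm A u 0)"
| Ext: "HA E \<Gamma> (All T (Eq U (lift t 0 \<cdot> Var 0) (lift u 0 \<cdot> Var 0))) \<Longrightarrow>
    E \<turnstile> t \<triangleright> T \<rightarrow> U \<Longrightarrow> E \<turnstile> u \<triangleright> T \<rightarrow> U \<Longrightarrow> HA E \<Gamma> (Eq (T \<rightarrow> U) t u)"

| Beta: "T # E \<turnstile> t \<triangleright> U \<Longrightarrow> E \<turnstile> u \<triangleright> T \<Longrightarrow> HA E \<Gamma> (Eq U (Lam T t \<cdot> u) (subst t u 0))"
| RecZero: "E \<turnstile> a \<triangleright> T \<Longrightarrow> E \<turnstile> f \<triangleright> Nat \<rightarrow> T \<rightarrow> T \<Longrightarrow>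
    HA E \<Gamma> (Eq T (Rec T \<cdot> a \<cdot> f \<cdot> Zero) a)"
| RecSucc: "E \<turnstile> a \<triangleright> T \<Longrightarrow> E \<turnstile> f \<triangleright> Nat \<rightarrow> T \<rightarrow> T \<Longrightarrow> E \<turnstile> m \<triangleright> Nat \<Longrightarrow>
    HA E \<Gamma> (Eq T (Rec T \<cdot> a \<cdot> f \<cdot> (Succ \<cdot> m)) (f \<cdot> m \<cdot> (Rec T \<cdot> a \<cdot> f \<cdot> m)))"

| SuccInj: "HA E \<Gamma> (Eq Nat (Succ \<cdot> m) (Succ \<cdot> n)) \<Longrightarrow> HA E \<Gamma> (Eq Nat m n)"
| SuccZero: "HA E \<Gamma> (Eq Nat (Succ \<cdot> m) Zero) \<Longrightarrow> HA E \<Gamma> Bot"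
| NatInd: "HA E \<Gamma> (subst_fm A Zero 0) \<Longrightarrow>
    HA (Nat # E) (A # map (\<lambda>B. lift_fm B 0) \<Gamma>) (subst_fm (lift_fm A 1) (Succ \<cdot> Var 0) 0) \<Longrightarrow>
    wf_fm (Nat # E) A \<Longrightarrow> HA E \<Gamma> (All Nat A)"

| FstPair: "E \<turnstile> a \<triangleright> T \<Longrightarrow> E \<turnstile> b \<triangleright> U \<Longrightarrow> HA E \<Gamma> (Eq T (fst_tm T U (pair T U a b)) a)"
| SndPair: "E \<turnstile> a \<triangleright> T \<Longrightarrow> E \<turnstile> b \<triangleright> U \<Longrightarrow> HA E \<Gamma> (Eq U (snd_tm T U (pair T U a b)) b)"
| PairSurj: "E \<turnstile> p \<triangleright> Prod T U \<Longrightarrow>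
    HA E \<Gamma> (Eq (Prod T U) (pair T U (fst_tm T U p) (snd_tm T U p)) p)"

| LenEmp: "HA E \<Gamma> (Eq Nat (Len T \<cdot> Emp T) Zero)"
| LenSnoc: "E \<turnstile> s \<triangleright> Star T \<Longrightarrow> E \<turnstile> x \<triangleright> T \<Longrightarrow>
    HA E \<Gamma> (Eq Nat (Len T \<cdot> (Snoc T \<cdot> s \<cdot> x)) (Succ \<cdot> (Len T \<cdot> s)))"
| HatEmp: "E \<turnstile> n \<triangleright> Nat \<Longrightarrow> HA E \<Gamma> (Eq T (Hat T \<cdot> Emp T \<cdot> n) (zero_obj T))"
| HatSnocLast: "E \<turnstile> s \<triangleright> Star T \<Longrightarrow> E \<turnstile> x \<triangleright> T \<Longrightarrow>
    HA E \<Gamma> (Eq T (Hat T \<cdot> (Snoc T \<cdot> s \<cdot> x) \<cdot> (Len T \<cdot> s)) x)"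
| HatSnocOther: "HA E \<Gamma> (Imp (Eq Nat n (Len T \<cdot> s)) Bot) \<Longrightarrow>
    E \<turnstile> s \<triangleright> Star T \<Longrightarrow> E \<turnstile> x \<triangleright> T \<Longrightarrow> E \<turnstile> n \<triangleright> Nat \<Longrightarrow>
    HA E \<Gamma> (Eq T (Hat T \<cdot> (Snoc T \<cdot> s \<cdot> x) \<cdot> n) (Hat T \<cdot> s \<cdot> n))"
| SeqInd: "HA E \<Gamma> (subst_fm A (Emp T) 0) \<Longrightarrow>
    HA (T # Star T # E) (lift_fm A 0 # map (\<lambda>B. lift_fm (lift_fm B 0) 0) \<Gamma>)
      (subst_fm (lift_fm (lift_fm A 1) 1) (Snoc T \<cdot> Var 1 \<cdot> Var 0) 0) \<Longrightarrow>
    wf_fm (Star T # E) A \<Longrightarrow> HA E \<Gamma> (All (Star T) A)"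


section \<open>Primitive recursive auxiliaries\<close>

text \<open>
  The terms of this section and the next are closed (for closed \<open>Y\<close>), so they are used under
  binders without lifting. The comments give them with named variables.
\<close>

definition Add :: tm where
  "Add = Lam Nat (Lam Nat (Rec Nat \<cdot> Var 1 \<cdot> Lam Nat (Lam Nat (Succ \<cdot> Var 0)) \<cdot> Var 0))"

definition Pred :: tm where
  "Pred = Lam Nat (Rec Nat \<cdot> Zero \<cdot> Lam Nat (Lam Nat (Var 1)) \<cdot> Var 0)"

text \<open>Truncated subtraction: \<open>\<lambda>m n. m - n\<close>.\<close>

definition Monus :: tm where
  "Monus = Lam Nat (Lam Nat (Rec Nat \<cdot> Var 1 \<cdot> Lam Nat (Lam Nat (Pred \<cdot> Var 0)) \<cdot> Var 0))"

text \<open>\<open>\<lambda>m n a b. if m < n then a else b\<close>, by recursion on \<open>n - m\<close>.\<close>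

definition IfLess :: "ty \<Rightarrow> tm" where
  "IfLess T = Lam Nat (Lam Nat (Lam T (Lam T
    (Rec T \<cdot> Var 0 \<cdot> Lam Nat (Lam T (Var 3)) \<cdot> (Monus \<cdot> Var 2 \<cdot> Var 3)))))"

definition Less :: "tm \<Rightarrow> tm \<Rightarrow> fm" where
  "Less m n = Ex Nat (Eq Nat (Add \<cdot> lift m 0 \<cdot> (Succ \<cdot> Var 0)) (lift n 0))"

definition GreaterEq :: "tm \<Rightarrow> tm \<Rightarrow> fm" where
  "GreaterEq m n = Ex Nat (Eq Nat (Add \<cdot> lift n 0 \<cdot> Var 0) (lift m 0))"


section \<open>Bar recursion\<close>

abbreviation G_ty :: "ty \<Rightarrow> ty \<Rightarrow> ty" where
  "G_ty \<tau> \<sigma> \<equiv> Star \<tau> \<rightarrow> \<sigma>"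
abbreviation H_ty :: "ty \<Rightarrow> ty \<Rightarrow> ty" where
  "H_ty \<tau> \<sigma> \<equiv> Star \<tau> \<rightarrow> (\<tau> \<rightarrow> \<sigma>) \<rightarrow> \<sigma>"
abbreviation BR_ty :: "ty \<Rightarrow> ty \<Rightarrow> ty" where
  "BR_ty \<tau> \<sigma> \<equiv> G_ty \<tau> \<sigma> \<rightarrow> H_ty \<tau> \<sigma> \<rightarrow> Star \<tau> \<rightarrow> \<sigma>"

text \<open>\<open>\<lambda>G H. Rec(G, \<lambda>m f s. H s (\<lambda>x. f (s * x)))\<close>\<close>

definition phi :: "ty \<Rightarrow> ty \<Rightarrow> tm" where
  "phi \<tau> \<sigma> = Lam (G_ty \<tau> \<sigma>) (Lam (H_ty \<tau> \<sigma>)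
    (Rec (Star \<tau> \<rightarrow> \<sigma>) \<cdot> Var 1 \<cdot>
      Lam Nat (Lam (Star \<tau> \<rightarrow> \<sigma>) (Lam (Star \<tau>)
        (Var 3 \<cdot> Var 0 \<cdot> Lam \<tau> (Var 2 \<cdot> (Snoc \<tau> \<cdot> Var 1 \<cdot> Var 0)))))))"

text \<open>\<open>\<lambda>k G H s. if k < |s| then G s else \<phi> G H (k + 1 - |s|) s\<close>\<close>

definition Psi :: "ty \<Rightarrow> ty \<Rightarrow> tm" where
  "Psi \<tau> \<sigma> = Lam Nat (Lam (G_ty \<tau> \<sigma>) (Lam (H_ty \<tau> \<sigma>) (Lam (Star \<tau>)
    (IfLess \<sigma> \<cdot> Var 3 \<cdot> (Len \<tau> \<cdot> Var 0) \<cdot>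
      (Var 2 \<cdot> Var 0) \<cdot>
      (phi \<tau> \<sigma> \<cdot> Var 2 \<cdot> Var 1 \<cdot> (Monus \<cdot> (Succ \<cdot> Var 3) \<cdot> (Len \<tau> \<cdot> Var 0)) \<cdot> Var 0)))))"

text \<open>\<open>\<lambda>G H s f. if Y(hat s) < |s| then G s else H s f\<close>\<close>

definition HY :: "ty \<Rightarrow> ty \<Rightarrow> tm \<Rightarrow> tm" where
  "HY \<tau> \<sigma> Y = Lam (G_ty \<tau> \<sigma>) (Lam (H_ty \<tau> \<sigma>) (Lam (Star \<tau>) (Lam (\<tau> \<rightarrow> \<sigma>)
    (IfLess \<sigma> \<cdot> (Y \<cdot> (Hat \<tau> \<cdot> Var 1)) \<cdot> (Len \<tau> \<cdot> Var 1) \<cdot>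
      (Var 3 \<cdot> Var 1) \<cdot>
      (Var 2 \<cdot> Var 1 \<cdot> Var 0)))))"

text \<open>\<open>\<lambda>\<Delta> G H s. \<Delta> (\<lambda>s'. \<Psi> (Y(hat s')) G H s') (HY G H) s\<close>\<close>

definition Phi :: "ty \<Rightarrow> ty \<Rightarrow> tm \<Rightarrow> tm" where
  "Phi \<tau> \<sigma> Y = Lam (BR_ty \<tau> \<sigma>) (Lam (G_ty \<tau> \<sigma>) (Lam (H_ty \<tau> \<sigma>) (Lam (Star \<tau>)
    (Var 3 \<cdot>
      Lam (Star \<tau>) (Psi \<tau> \<sigma> \<cdot> (Y \<cdot> (Hat \<tau> \<cdot> Var 0)) \<cdot> Var 3 \<cdot> Var 2 \<cdot> Var 0) \<cdot>
      (HY \<tau> \<sigma> Y \<cdot> Var 2 \<cdot> Var 1) \<cdot>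
      Var 0))))"

text \<open>
  For closed \<open>Y\<close> and \<open>\<xi>\<close>: the formula saying that \<open>\<xi>\<close> is Spector's bar recursor for \<open>Y\<close>. Below the
  quantifiers, \<open>G\<close>, \<open>H\<close>, \<open>s\<close> are variables 2, 1, 0.
\<close>

definition Spector_bar_recursor :: "ty \<Rightarrow> ty \<Rightarrow> tm \<Rightarrow> tm \<Rightarrow> fm" where
  "Spector_bar_recursor \<tau> \<sigma> Y \<xi> =
    All (G_ty \<tau> \<sigma>) (All (H_ty \<tau> \<sigma>) (All (Star \<tau>) (And
      (Imp (Less (Y \<cdot> (Hat \<tau> \<cdot> Var 0)) (Len \<tau> \<cdot> Var 0))
        (Eq \<sigma> (\<xi> \<cdot> Var 2 \<cdot> Var 1 \<cdot> Var 0) (Var 2 \<cdot> Var 0)))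
      (Imp (GreaterEq (Y \<cdot> (Hat \<tau> \<cdot> Var 0)) (Len \<tau> \<cdot> Var 0))
        (Eq \<sigma> (\<xi> \<cdot> Var 2 \<cdot> Var 1 \<cdot> Var 0)
          (Var 1 \<cdot> Var 0 \<cdot> Lam \<tau> (\<xi> \<cdot> Var 3 \<cdot> Var 2 \<cdot> (Snoc \<tau> \<cdot> Var 1 \<cdot> Var 0))))))))"


section \<open>The translation\<close>

primrec arith_ty :: "ty \<Rightarrow> bool" where
  "arith_ty Nat \<longleftrightarrow> True"
| "arith_ty (T \<rightarrow> U) \<longleftrightarrow> arith_ty T \<and> arith_ty U"
| "arith_ty (Star T) \<longleftrightarrow> False"
| "arith_ty (Prod T U) \<longleftrightarrow> False"

text \<open>
  The subterms have types built from \<open>Nat\<close> and \<open>\<rightarrow>\<close> only (given that the free variables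
  have).
\<close>

primrec arith_tm :: "tm \<Rightarrow> bool" where
  "arith_tm (Var n) \<longleftrightarrow> True"
| "arith_tm (Con c) \<longleftrightarrow> arith_ty (con_ty c)"
| "arith_tm (t \<cdot> u) \<longleftrightarrow> arith_tm t \<and> arith_tm u"
| "arith_tm (Lam T t) \<longleftrightarrow> arith_ty T \<and> arith_tm t"

abbreviation Val_ty :: "ty \<Rightarrow> ty" where
  "Val_ty \<tau> \<equiv> (Nat \<rightarrow> \<tau>) \<rightarrow> Nat"

abbreviation trN :: "ty \<Rightarrow> ty \<Rightarrow> ty" where
  "trN \<tau> \<sigma> \<equiv> Prod (Val_ty \<tau>) (BR_ty \<tau> \<sigma>)"

text \<open>The translation is unspecified for types, constants and terms that are not \<open>arith\<close>.\<close>

fun tr_ty :: "ty \<Rightarrow> ty \<Rightarrow> ty \<Rightarrow> ty" where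
  "tr_ty \<tau> \<sigma> Nat = trN \<tau> \<sigma>"
| "tr_ty \<tau> \<sigma> (T \<rightarrow> U) = tr_ty \<tau> \<sigma> T \<rightarrow> tr_ty \<tau> \<sigma> U"

abbreviation Val :: "ty \<Rightarrow> ty \<Rightarrow> tm \<Rightarrow> tm" where
  "Val \<tau> \<sigma> u \<equiv> fst_tm (Val_ty \<tau>) (BR_ty \<tau> \<sigma>) u"
abbreviation BR :: "ty \<Rightarrow> ty \<Rightarrow> tm \<Rightarrow> tm" where
  "BR \<tau> \<sigma> u \<equiv> snd_tm (Val_ty \<tau>) (BR_ty \<tau> \<sigma>) u"
abbreviation mkN :: "ty \<Rightarrow> ty \<Rightarrow> tm \<Rightarrow> tm \<Rightarrow> tm" where
  "mkN \<tau> \<sigma> a b \<equiv> pair (Val_ty \<tau>) (BR_ty \<tau> \<sigma>) a b"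

text \<open>\<open>\<langle>\<lambda>\<alpha>. k; \<lambda>G H. G\<rangle>\<close> for an arbitrary term \<open>k\<close> of type \<open>Nat\<close>.\<close>

definition tr_num :: "ty \<Rightarrow> ty \<Rightarrow> tm \<Rightarrow> tm" where
  "tr_num \<tau> \<sigma> k =
    mkN \<tau> \<sigma> (Lam (Nat \<rightarrow> \<tau>) (lift k 0)) (Lam (G_ty \<tau> \<sigma>) (Lam (H_ty \<tau> \<sigma>) (Var 1)))"

definition tr_Succ :: "ty \<Rightarrow> ty \<Rightarrow> tm" where
  "tr_Succ \<tau> \<sigma> = Lam (trN \<tau> \<sigma>)
    (mkN \<tau> \<sigma> (Lam (Nat \<rightarrow> \<tau>) (Succ \<cdot> (Val \<tau> \<sigma> (Var 1) \<cdot> Var 0))) (BR \<tau> \<sigma> (Var 0)))"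

text \<open>
  \<open>\<lambda>x. \<langle>\<lambda>\<alpha>. \<alpha> (Val\<^sub>x \<alpha>); \<lambda>G H. B\<^sub>x (\<lambda>s'. \<Psi> (Val\<^sub>x (hat s')) G H s') H\<rangle>\<close>, where \<open>\<tau>\<close> is \<open>Nat\<close>.
\<close>

definition tr_alpha :: "ty \<Rightarrow> tm" where
  "tr_alpha \<sigma> = Lam (trN Nat \<sigma>)
    (mkN Nat \<sigma>
      (Lam (Nat \<rightarrow> Nat) (Var 0 \<cdot> (Val Nat \<sigma> (Var 1) \<cdot> Var 0)))
      (Lam (G_ty Nat \<sigma>) (Lam (H_ty Nat \<sigma>)
        (BR Nat \<sigma> (Var 2) \<cdot>
          Lam (Star Nat)
            (Psi Nat \<sigma> \<cdot> (Val Nat \<sigma> (Var 3) \<cdot> (Hat Nat \<cdot> Var 0)) \<cdot> Var 2 \<cdot> Var 1 \<cdot> Var 0) \<cdot>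
          Var 0))))"

fun arg_tys :: "ty \<Rightarrow> ty list" where
  "arg_tys (T \<rightarrow> U) = T # arg_tys U"
| "arg_tys _ = []"

definition Lams :: "ty list \<Rightarrow> tm \<Rightarrow> tm" where
  "Lams Ts t = foldr Lam Ts t"

definition Apps :: "tm \<Rightarrow> tm list \<Rightarrow> tm" where
  "Apps t us = foldl App t us"

text \<open>
  The term \<open>\<lambda>a F x v\<^sub>1 \<dots> v\<^sub>n. \<langle>\<lambda>\<alpha>. Val\<^bsub>r[Val\<^sub>x \<alpha>]\<^esub> \<alpha>; \<lambda>G H s. B\<^sub>x (\<lambda>s'. B\<^bsub>r[Val\<^sub>x (hat s')]\<^esub> G H s') H s\<rangle>\<close>
  for \<open>\<eta> = \<rho>\<^sub>1 \<rightarrow> \<dots> \<rightarrow> \<rho>\<^sub>n \<rightarrow> Nat\<close>. Directly below the outer binders, \<open>v\<^sub>1, \<dots>, v\<^sub>n, x, F, a\<close> are the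
  variables \<open>n - 1, \<dots>, 0, n, n + 1, n + 2\<close>; \<open>r d m\<close> is \<open>r[m] = Rec (a, \<lambda>k. F k\<degree>) m v\<^sub>1 \<dots> v\<^sub>n\<close>
  below \<open>d\<close> further binders.
\<close>

definition tr_Rec :: "ty \<Rightarrow> ty \<Rightarrow> ty \<Rightarrow> tm" where
  "tr_Rec \<tau> \<sigma> \<eta> =
    (let
      ctr = tr_ty \<tau> \<sigma>;
      n = length (arg_tys \<eta>);
      r = (\<lambda>d m. Apps
        (Rec (ctr \<eta>) \<cdot> Var (n + 2 + d) \<cdot> Lam Nat (Var (n + 1 + d + 1) \<cdot> tr_num \<tau> \<sigma> (Var 0)) \<cdot> m)
        (map Var (rev [d..<n + d])))
    in
      Lam (ctr \<eta>) (Lam (trN \<tau> \<sigma> \<rightarrow> ctr \<eta> \<rightarrow> ctr \<eta>) (Lam (trN \<tau> \<sigma>) (Lams (map ctr (arg_tys \<eta>))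
        (mkN \<tau> \<sigma>
          (Lam (Nat \<rightarrow> \<tau>) (Val \<tau> \<sigma> (r 1 (Val \<tau> \<sigma> (Var (n + 1)) \<cdot> Var 0)) \<cdot> Var 0))
          (Lam (G_ty \<tau> \<sigma>) (Lam (H_ty \<tau> \<sigma>) (Lam (Star \<tau>)
            (BR \<tau> \<sigma> (Var (n + 3)) \<cdot>
              Lam (Star \<tau>)
                (BR \<tau> \<sigma> (r 4 (Val \<tau> \<sigma> (Var (n + 4)) \<cdot> (Hat \<tau> \<cdot> Var 0))) \<cdot>
                  Var 3 \<cdot> Var 2 \<cdot> Var 0) \<cdot>
              Var 1 \<cdot> Var 0)))))))))"

fun tr_con :: "ty \<Rightarrow> con \<Rightarrow> tm" where
  "tr_con \<sigma> ZeroC = tr_num Nat \<sigma> Zero"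
| "tr_con \<sigma> SuccC = tr_Succ Nat \<sigma>"
| "tr_con \<sigma> (RecC \<eta>) = tr_Rec Nat \<sigma> \<eta>"

text \<open>
  The translation of terms for \<open>\<tau> = Nat\<close>. In \<open>tr \<sigma> d t\<close>, the variable \<open>d\<close> of \<open>t\<close> is the special
  variable \<open>\<alpha>\<close> and the variables below \<open>d\<close> are the ordinary ones, bound by the \<open>d\<close> abstractions
  already passed. So a term whose only free variable is \<open>\<alpha>\<close> is translated by \<open>tr \<sigma> 0\<close>, and its
  abstraction \<open>\<lambda>\<alpha>. t\<close> is \<open>Lam (Nat \<rightarrow> Nat) t\<close>.
\<close>

primrec tr :: "ty \<Rightarrow> nat \<Rightarrow> tm \<Rightarrow> tm" where
  "tr \<sigma> d (Var i) = (if i = d then tr_alpha \<sigma> else Var i)"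
| "tr \<sigma> d (Con c) = tr_con \<sigma> c"
| "tr \<sigma> d (t \<cdot> u) = tr \<sigma> d t \<cdot> tr \<sigma> d u"
| "tr \<sigma> d (Lam T t) = Lam (tr_ty Nat \<sigma> T) (tr \<sigma> (d + 1) t)"

end

theory Submission
  imports Defs
begin

text \<open>
  Call a pair of \<open>V\<close> and \<open>B\<close> regular if every sequence \<open>s\<close> is either secured, i.e. \<open>V\<close> is constant on
  the functions extending \<open>s\<close> and \<open>B(G,H)(s') = G(s')\<close> for all extensions \<open>s'\<close> of \<open>s\<close>, or satisfies
  \<open>B(G,H)(s) = H(s)(\<lambda>x. B(G,H)(s*x))\<close>. For a regular pair with \<open>V = Y\<close>, the function \<open>\<Psi>\<close> bridges the gap
  between the bar of \<open>B\<close> and Spector's bar \<open>Y(hat s) < |s|\<close>, so \<open>\<Phi>\<^sup>Y(B)\<close> is Spector's bar recursor.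
  Regularity is closed under a bind operation on pairs, of which the clauses of the translation
  for \<open>Succ\<close>, \<open>\<alpha>\<close> and the recursors are instances. A logical relation, expressed by formulas
  of Heyting arithmetic, therefore shows that the translation of \<open>t\<close> is a regular pair whose
  first component is \<open>\<lambda>\<alpha>. t\<close>.
\<close>

section \<open>Lifting, substitution and typing\<close>

text \<open>No bar induction is involved. Regularity does not claim that every function meets a
  secured sequence; it is a disjunction at each \<open>s\<close> separately, and the equations of
  Spector's recursor at \<open>s\<close> need only that.

  The obstacle is that Spector's condition \<open>Y(hat s) < |s|\<close> is not preserved by
  extensions of \<open>s\<close>, while being secured is. If \<open>Y\<close> has the constant value
  \<open>k\<close> above \<open>s\<close>, the condition becomes \<open>k < |s'|\<close> there,
  which is monotone and is handled by the finite recursion \<open>Psi(k)\<close>. If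
  \<open>B\<close> makes a step at \<open>s\<close>, the condition may already hold; then the
  \<open>H\<close> that \<open>Phi\<close> hands to \<open>B\<close> tests it and returns
  \<open>G(s)\<close>.

  In the bind operation, successor uses constant pairs and a recursor uses the family
  \<open>r[n]\<close>. Only the special variable brings in new pairs, namely those that read
  \<open>\<alpha>(n)\<close> and stop by \<open>Psi(n)\<close>.

  The number \<open>2 + max 1 (level \<sigma>)\<close> is the level of the translated type of
  numbers, where the argument \<open>H\<close> of the bar recursor dominates. A recursor at type
  \<open>\<rho>\<close> becomes one at the translation of \<open>\<rho>\<close>, whose level is
  larger by at most this number.\<close>

lemma lift_lift: "i \<le> k \<Longrightarrow> lift (lift t i) (Suc k) = lift (lift t k) i"
  by (induction t arbitrary: i k) auto

lemma lift_lift_0 [simp]: "lift (lift t 0) (Suc k) = lift (lift t k) 0"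
  by (rule lift_lift) simp

lemma subst_lift [simp]: "subst (lift t k) s k = t"
  by (induction t arbitrary: s k) auto

lemma subst_lift_Var [simp]: "subst (lift t (Suc k)) (Var k) k = t"
  by (induction t arbitrary: k) auto

lemma lift_subst: "i \<le> k \<Longrightarrow> lift (subst t s i) k = subst (lift t (Suc k)) (lift s k) i"
  by (induction t arbitrary: i k s) (auto simp: lift_lift)

lemma subst_lift_le: "i \<le> k \<Longrightarrow> subst (lift t i) (lift s i) (Suc k) = lift (subst t s k) i"
proof (induction t arbitrary: i k s)
  case (Lam T t)
  show ?case using Lam.IH[of "Suc i" "Suc k" "lift s 0"] Lam.prems by (simp add: lift_lift)
qed auto

lemma subst_lift_0: "subst (lift t 0) (lift s 0) (Suc k) = lift (subst t s k) 0"
  by (rule subst_lift_le) simp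

text \<open>Since \<open>lift_lift_0\<close> moves lifts at 0 outwards, \<open>subst_lift\<close> no
  longer matches beneath binders. These instances restore it for substitution at the indices 1 to
  4.\<close>

lemma subst_lift_1 [simp]: "subst (lift (lift t 0) 0) s (Suc 0) = lift t 0"
  using subst_lift[of "lift t 0" "Suc 0" s] by simp

lemma subst_lift_2 [simp]: "subst (lift (lift (lift t 0) 0) 0) s (Suc (Suc 0)) = lift (lift t 0) 0"
  using subst_lift[of "lift (lift t 0) 0" "Suc (Suc 0)" s] by simp

lemma subst_lift_3 [simp]:
  "subst (lift (lift (lift (lift t 0) 0) 0) 0) s (Suc (Suc (Suc 0))) = lift (lift (lift t 0) 0) 0"
  using subst_lift[of "lift (lift (lift t 0) 0) 0" "Suc (Suc (Suc 0))" s] by simp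

lemma subst_lift_4 [simp]:
  "subst (lift (lift (lift (lift (lift t 0) 0) 0) 0) 0) s (Suc (Suc (Suc (Suc 0)))) = lift (lift (lift (lift t 0) 0) 0) 0"
  using subst_lift[of "lift (lift (lift (lift t 0) 0) 0) 0" "Suc (Suc (Suc (Suc 0)))" s] by simp

lemma lift_fm_lift_fm: "i \<le> k \<Longrightarrow> lift_fm (lift_fm A i) (Suc k) = lift_fm (lift_fm A k) i"
  by (induction A arbitrary: i k) (auto simp: lift_lift)

lemma lift_fm_subst_fm:
  "i \<le> k \<Longrightarrow> lift_fm (subst_fm A s i) k = subst_fm (lift_fm A (Suc k)) (lift s k) i"
  by (induction A arbitrary: i k s) (auto simp: lift_lift lift_subst)

lemma lift_fm_0 [simp]: "lift_fm (lift_fm A 0) (Suc k) = lift_fm (lift_fm A k) 0"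
  by (rule lift_fm_lift_fm) simp

text \<open>Typing is syntax directed and types are unique, so a partial function computes them.
  Through \<open>typing_iff_infer\<close> the typing premises of the calculus, present in almost
  every step, become goals for the simplifier.\<close>

primrec infer :: "ty list \<Rightarrow> tm \<Rightarrow> ty option" where
  "infer E (Var i) = (if i < length E then Some (E ! i) else None)"
| "infer E (Con c) = Some (con_ty c)"
| "infer E (t \<cdot> u) = (case infer E t of Some (T \<rightarrow> U) \<Rightarrow> if infer E u = Some T then Some U else None | _ \<Rightarrow> None)"
| "infer E (Lam T t) = (case infer (T # E) t of Some U \<Rightarrow> Some (T \<rightarrow> U) | None \<Rightarrow> None)"

lemma infer_App: "infer E (t \<cdot> u) = Some U \<longleftrightarrow> (\<exists>T. infer E t = Some (T \<rightarrow> U) \<and> infer E u = Some T)"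
  by (auto split: option.splits ty.splits if_splits)

lemma infer_Lam: "infer E (Lam T t) = Some V \<longleftrightarrow> (\<exists>U. V = T \<rightarrow> U \<and> infer (T # E) t = Some U)"
  by (auto split: option.splits)

lemma typing_iff_infer [simp]: "E \<turnstile> t \<triangleright> T \<longleftrightarrow> infer E t = Some T"
proof
  show "E \<turnstile> t \<triangleright> T \<Longrightarrow> infer E t = Some T"
    by (induction rule: typing.induct) auto
  show "infer E t = Some T \<Longrightarrow> E \<turnstile> t \<triangleright> T"
  proof (induction t arbitrary: E T)
    case (App t u)
    then show ?case unfolding infer_App by (metis typing.App)
  next
    case (Lam S t)
    then show ?case unfolding infer_Lam by (metis typing.Lam)
  qed (auto intro: typing.intros split: if_splits)
qed

lemma infer_lift: "infer (E1 @ T # E2) (lift t (length E1)) = infer (E1 @ E2) t"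
proof (induction t arbitrary: E1)
  case (Var i)
  then show ?case by (auto simp: nth_append Suc_diff_le)
next
  case (App t u)
  show ?case by (simp only: lift.simps infer.simps App.IH)
next
  case (Lam S t)
  show ?case using Lam.IH[of "S # E1"] by simp
qed simp

lemma infer_lift_0 [simp]: "infer (T # E) (lift t 0) = infer E t"
  using infer_lift[of "[]"] by simp

lemma infer_subst:
  "infer (E1 @ T # E2) t = Some U \<Longrightarrow> infer (E1 @ E2) s = Some T \<Longrightarrow>
    infer (E1 @ E2) (subst t s (length E1)) = Some U"
proof (induction t arbitrary: E1 U s)
  case (Var i)
  then show ?case by (auto simp: nth_append nth_Cons' split: if_splits)
next
  case (App t u)
  then show ?case unfolding infer_App subst.simps by blast
next
  case (Lam S t)
  then show ?case unfolding infer_Lam subst.simps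
    using Lam.IH[of "S # E1"] by (auto)
qed auto

lemma infer_subst_0: "infer (T # E) t = Some U \<Longrightarrow> infer E s = Some T \<Longrightarrow> infer E (subst t s 0) = Some U"
  using infer_subst[of "[]"] by simp

lemma infer_append: "infer E t = Some T \<Longrightarrow> infer (E @ F) t = Some T"
proof (induction t arbitrary: E T)
  case (App t u) then show ?case unfolding infer_App by blast
next
  case (Lam S t) then show ?case unfolding infer_Lam by fastforce
qed (auto simp: nth_append split: if_splits)

lemma lift_closed': "infer E t = Some T \<Longrightarrow> length E \<le> k \<Longrightarrow> lift t k = t"
proof (induction t arbitrary: E T k)
  case (App t u)
  then obtain S where "infer E t = Some (S \<rightarrow> T)" "infer E u = Some S"
    unfolding infer_App by blast
  then show ?case using App.IH App.prems(2) by simp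
next
  case (Lam S t)
  then obtain U where "infer (S # E) t = Some U" unfolding infer_Lam by blast
  then show ?case using Lam.IH[of "S # E"] Lam.prems(2) by simp
qed (auto split: if_splits)

lemma subst_closed': "infer E t = Some T \<Longrightarrow> length E \<le> k \<Longrightarrow> subst t s k = t"
proof (induction t arbitrary: E T k s)
  case (App t u)
  then obtain S where "infer E t = Some (S \<rightarrow> T)" "infer E u = Some S"
    unfolding infer_App by blast
  then show ?case using App.IH App.prems(2) by simp
next
  case (Lam S t)
  then obtain U where "infer (S # E) t = Some U" unfolding infer_Lam by blast
  then show ?case using Lam.IH[of "S # E"] Lam.prems(2) by simp
qed (auto split: if_splits)

text \<open>Instantiated for each closed combinator, this removes lifts and substitutions from it
  and types it in every context, so it can be used freely under binders.\<close>

lemma closed_term: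
  assumes "infer [] c = Some T"
  shows "lift c k = c" "subst c s k = c" "infer E c = Some T"
  using lift_closed'[OF assms] subst_closed'[OF assms] infer_append[OF assms, of E] by auto

lemma infer_zero_obj [simp]: "infer E (zero_obj T) = Some T"
  by (induction T arbitrary: E) auto

lemmas closed_zero_obj [simp] = closed_term(1,2)[OF infer_zero_obj]

lemma wf_lift_fm: "wf_fm (E1 @ T # E2) (lift_fm A (length E1)) \<longleftrightarrow> wf_fm (E1 @ E2) A"
proof (induction A arbitrary: E1)
  case (All S A) show ?case using All.IH[of "S # E1"] by simp
next
  case (Ex S A) show ?case using Ex.IH[of "S # E1"] by simp
qed (auto simp: infer_lift)

lemma wf_lift_fm_0 [simp]: "wf_fm (T # E) (lift_fm A 0) \<longleftrightarrow> wf_fm E A"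
  using wf_lift_fm[of "[]"] by simp

lemma wf_subst_fm:
  "wf_fm (E1 @ T # E2) A \<Longrightarrow> infer (E1 @ E2) s = Some T \<Longrightarrow>
    wf_fm (E1 @ E2) (subst_fm A s (length E1))"
proof (induction A arbitrary: E1 s)
  case (All S A) then show ?case using All.IH[of "S # E1"] by simp
next
  case (Ex S A) then show ?case using Ex.IH[of "S # E1"] by simp
qed (auto simp: infer_subst)

lemma wf_subst_fm_0: "wf_fm (T # E) A \<Longrightarrow> infer E s = Some T \<Longrightarrow> wf_fm E (subst_fm A s 0)"
  using wf_subst_fm[of "[]"] by simp


section \<open>Derived rules of Heyting arithmetic\<close>

abbreviation lift_fms :: "fm list \<Rightarrow> fm list" where
  "lift_fms \<Gamma> \<equiv> map (\<lambda>B. lift_fm B 0) \<Gamma>"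

text \<open>A derived equation thus carries the types of its two sides (\<open>HA_typed\<close>),
  which keeps typing hypotheses out of the rules for equality.\<close>

lemma HA_wf: "HA E \<Gamma> A \<Longrightarrow> wf_fm E A"
proof (induction rule: HA.induct)
  case (SuccInj E \<Gamma> m n)
  then show ?case by (auto split: option.splits ty.splits if_splits)
next
  case (AllE E \<Gamma> T A t)
  then show ?case using wf_subst_fm_0 by simp
next
  case (Subst E \<Gamma> T t u A)
  then show ?case using wf_subst_fm_0 by simp
next
  case (Beta T E t U u \<Gamma>)
  then show ?case using infer_subst_0 by simp
qed simp_all

lemma HA_typed:
  assumes "HA E \<Gamma> (Eq T t u)"
  shows "infer E t = Some T" "infer E u = Some T"
  using HA_wf[OF assms] by auto

lemmas HA_axioms =
  HA.Refl HA.Beta HA.RecZero HA.RecSucc HA.FstPair HA.SndPair HA.PairSurj HA.LenEmp HA.LenSnoc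
  HA.HatEmp HA.HatSnocLast

lemma HA_weaken: "HA E \<Gamma> A \<Longrightarrow> set \<Gamma> \<subseteq> set \<Delta> \<Longrightarrow> HA E \<Delta> A"
proof (induction arbitrary: \<Delta> rule: HA.induct)
  case (Hyp A \<Gamma> E)
  then show ?case by (intro HA.Hyp) auto
next
  case (BotE E \<Gamma> A)
  show ?case by (rule HA.BotE[OF BotE.IH[OF BotE.prems] BotE.hyps(2)])
next
  case AndI
  show ?case by (rule HA.AndI) (rule AndI.IH, rule AndI.prems)+
next
  case AndE1
  show ?case by (rule HA.AndE1) (rule AndE1.IH, rule AndE1.prems)
next
  case AndE2
  show ?case by (rule HA.AndE2) (rule AndE2.IH, rule AndE2.prems)
next
  case (OrI1 E \<Gamma> A B)
  show ?case by (rule HA.OrI1[OF OrI1.IH[OF OrI1.prems] OrI1.hyps(2)])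
next
  case (OrI2 E \<Gamma> B A)
  show ?case by (rule HA.OrI2[OF OrI2.IH[OF OrI2.prems] OrI2.hyps(2)])
next
  case (OrE E \<Gamma> A B C)
  have "set (A # \<Gamma>) \<subseteq> set (A # \<Delta>)" "set (B # \<Gamma>) \<subseteq> set (B # \<Delta>)"
    using OrE.prems by auto
  then show ?case by (rule HA.OrE[OF OrE.IH(1)[OF OrE.prems] OrE.IH(2) OrE.IH(3)])
next
  case (ImpI E A \<Gamma> B)
  have "set (A # \<Gamma>) \<subseteq> set (A # \<Delta>)" using ImpI.prems by auto
  then show ?case by (rule HA.ImpI[OF ImpI.IH ImpI.hyps(2)])
next
  case ImpE
  show ?case by (rule HA.ImpE) (rule ImpE.IH, rule ImpE.prems)+
next
  case (AllI T E \<Gamma> A)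
  have "set (lift_fms \<Gamma>) \<subseteq> set (lift_fms \<Delta>)" using AllI.prems by auto
  then show ?case by (rule HA.AllI[OF AllI.IH])
next
  case (AllE E \<Gamma> T A t)
  show ?case by (rule HA.AllE[OF AllE.IH[OF AllE.prems] AllE.hyps(2)])
next
  case (ExI E \<Gamma> A t T)
  show ?case by (rule HA.ExI[OF ExI.IH[OF ExI.prems] ExI.hyps(2,3)])
next
  case (ExE E \<Gamma> T A C)
  have "set (A # lift_fms \<Gamma>) \<subseteq> set (A # lift_fms \<Delta>)" using ExE.prems by auto
  then show ?case by (rule HA.ExE[OF ExE.IH(1)[OF ExE.prems] ExE.IH(2) ExE.hyps(3)])
next
  case (Subst E \<Gamma> T t u A)
  show ?case by (rule HA.Subst[OF Subst.IH(1)[OF Subst.prems] Subst.IH(2)[OF Subst.prems] Subst.hyps(3)])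
next
  case (Ext E \<Gamma> T U t u)
  show ?case by (rule HA.Ext[OF Ext.IH[OF Ext.prems] Ext.hyps(2,3)])
next
  case SuccInj
  show ?case by (rule HA.SuccInj) (rule SuccInj.IH, rule SuccInj.prems)
next
  case SuccZero
  show ?case by (rule HA.SuccZero) (rule SuccZero.IH, rule SuccZero.prems)
next
  case (NatInd E \<Gamma> A)
  have "set (A # lift_fms \<Gamma>) \<subseteq> set (A # lift_fms \<Delta>)" using NatInd.prems by auto
  then show ?case by (rule HA.NatInd[OF NatInd.IH(1)[OF NatInd.prems] NatInd.IH(2) NatInd.hyps(3)])
next
  case (SeqInd E \<Gamma> A T)
  have "set (lift_fm A 0 # map (\<lambda>B. lift_fm (lift_fm B 0) 0) \<Gamma>)
    \<subseteq> set (lift_fm A 0 # map (\<lambda>B. lift_fm (lift_fm B 0) 0) \<Delta>)" using SeqInd.prems by auto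
  then show ?case by (rule HA.SeqInd[OF SeqInd.IH(1)[OF SeqInd.prems] SeqInd.IH(2) SeqInd.hyps(3)])
next
  case (HatSnocOther E \<Gamma> n T s x)
  show ?case by (rule HA.HatSnocOther[OF HatSnocOther.IH[OF HatSnocOther.prems] HatSnocOther.hyps(2-4)])
qed (simp_all add: HA_axioms)

lemma HA_weaken_Cons: "HA E \<Gamma> A \<Longrightarrow> HA E (B # \<Gamma>) A"
  by (erule HA_weaken) auto

lemma HA_weaken_Nil: "HA E [] A \<Longrightarrow> HA E \<Gamma> A"
  by (erule HA_weaken) auto

text \<open>The quantifier and induction rules put variables in front of the context, so the
  induction needs a new variable inserted at an arbitrary position.\<close>

lemma HA_lift_gen:
  "HA E \<Gamma> A \<Longrightarrow> E = E1 @ E2 \<Longrightarrow>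
    HA (E1 @ T # E2) (map (\<lambda>B. lift_fm B (length E1)) \<Gamma>) (lift_fm A (length E1))"
proof (induction arbitrary: E1 rule: HA.induct)
  case (Hyp A \<Gamma> E)
  then show ?case by (auto intro!: HA.Hyp simp: wf_lift_fm)
next
  case (AndI E \<Gamma> A B)
  then show ?case using HA.AndI by simp
next
  case (BotE E \<Gamma> A)
  show ?case using HA.BotE[OF BotE.IH[OF BotE.prems, simplified]] BotE.hyps BotE.prems
    by (simp add: wf_lift_fm)
next
  case (AndE1 E \<Gamma> A B)
  then show ?case using HA.AndE1 by auto
next
  case (AndE2 E \<Gamma> A B)
  then show ?case using HA.AndE2 by auto
next
  case (OrI1 E \<Gamma> A B)
  then show ?case by (auto intro!: HA.OrI1 simp: wf_lift_fm)
next
  case (OrI2 E \<Gamma> A B)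
  then show ?case by (auto intro!: HA.OrI2 simp: wf_lift_fm)
next
  case (OrE E \<Gamma> A B C)
  show ?case using HA.OrE[OF OrE.IH(1)[OF OrE.prems, simplified]] OrE.IH(2,3)[OF OrE.prems]
    by simp
next
  case (ImpI E A \<Gamma> B)
  then show ?case by (auto intro!: HA.ImpI simp: wf_lift_fm)
next
  case (ImpE E \<Gamma> A B)
  show ?case using HA.ImpE[OF ImpE.IH(1)[OF ImpE.prems, simplified] ImpE.IH(2)[OF ImpE.prems]] .
next
  case (AllI S E \<Gamma> A)
  have "HA ((S # E1) @ T # E2)
    (map (\<lambda>B. lift_fm B (length (S # E1))) (lift_fms \<Gamma>)) (lift_fm A (length (S # E1)))"
    by (rule AllI.IH) (simp add: AllI.prems)
  then show ?case by (auto intro!: HA.AllI simp: comp_def)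
next
  case (AllE E \<Gamma> S A t)
  show ?case
    using AllE.IH[OF AllE.prems] AllE.hyps AllE.prems
    by (auto dest!: HA.AllE[where t = "lift t (length E1)"] simp: infer_lift lift_fm_subst_fm)
next
  case (ExI E \<Gamma> A t S)
  have "HA (E1 @ T # E2) (map (\<lambda>B. lift_fm B (length E1)) \<Gamma>)
      (subst_fm (lift_fm A (Suc (length E1))) (lift t (length E1)) 0)"
    using ExI.IH[OF ExI.prems] by (simp add: lift_fm_subst_fm)
  then show ?case using ExI.hyps ExI.prems wf_lift_fm[of "S # E1"]
    by (auto intro!: HA.ExI simp: infer_lift)
next
  case (ExE E \<Gamma> S A C)
  have "HA ((S # E1) @ T # E2)
    (map (\<lambda>B. lift_fm B (length (S # E1))) (A # lift_fms \<Gamma>)) (lift_fm (lift_fm C 0) (length (S # E1)))"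
    by (rule ExE.IH) (simp add: ExE.prems)
  then show ?case using HA.ExE[OF ExE.IH(1)[OF ExE.prems, simplified]] ExE.hyps ExE.prems
    by (simp add: wf_lift_fm comp_def)
next
  case (Subst E \<Gamma> S t u A)
  have "HA (E1 @ T # E2) (map (\<lambda>B. lift_fm B (length E1)) \<Gamma>)
      (subst_fm (lift_fm A (Suc (length E1))) (lift u (length E1)) 0)"
    by (rule HA.Subst[where t = "lift t (length E1)" and T = S])
      (use Subst.IH[OF Subst.prems] Subst.hyps Subst.prems wf_lift_fm[of "S # E1"] in
        \<open>auto simp: lift_fm_subst_fm\<close>)
  then show ?case by (simp add: lift_fm_subst_fm)
next
  case (Ext E \<Gamma> S U t u)
  then show ?case using Ext.IH[OF Ext.prems] by (auto intro!: HA.Ext simp: infer_lift)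
next
  case (Beta S E t U u \<Gamma>)
  have "infer (S # E1 @ T # E2) (lift t (Suc (length E1))) = Some U"
    using infer_lift[of "S # E1" T E2 t] Beta by simp
  then show ?case using Beta HA.Beta[of S "E1 @ T # E2" "lift t (Suc (length E1))" U]
    by (auto simp: infer_lift lift_subst)
next
  case (SuccInj E \<Gamma> m n)
  then show ?case using HA.SuccInj by auto
next
  case (SuccZero E \<Gamma> m)
  then show ?case using HA.SuccZero by auto
next
  case (NatInd E \<Gamma> A)
  let ?A = "lift_fm A (Suc (length E1))"
  let ?\<Gamma> = "map (\<lambda>B. lift_fm B (length E1)) \<Gamma>"
  have 1: "HA (E1 @ T # E2) ?\<Gamma> (subst_fm ?A Zero 0)"
    using NatInd.IH(1)[OF NatInd.prems] by (simp add: lift_fm_subst_fm)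
  have "HA ((Nat # E1) @ T # E2) (map (\<lambda>B. lift_fm B (length (Nat # E1))) (A # lift_fms \<Gamma>))
     (lift_fm (subst_fm (lift_fm A 1) (Succ \<cdot> Var 0) 0) (length (Nat # E1)))"
    by (rule NatInd.IH) (simp add: NatInd.prems)
  then have 2: "HA (Nat # E1 @ T # E2) (?A # lift_fms ?\<Gamma>)
     (subst_fm (lift_fm ?A 1) (Succ \<cdot> Var 0) 0)"
    by (simp add: comp_def lift_fm_subst_fm lift_fm_lift_fm)
  have 3: "wf_fm (Nat # E1 @ T # E2) ?A"
    using NatInd.hyps NatInd.prems wf_lift_fm[of "Nat # E1" T E2 A] by simp
  show ?case using HA.NatInd[OF 1 2 3] by simp
next
  case (SeqInd E \<Gamma> A S)
  let ?A = "lift_fm A (Suc (length E1))"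
  let ?\<Gamma> = "map (\<lambda>B. lift_fm B (length E1)) \<Gamma>"
  have 1: "HA (E1 @ T # E2) ?\<Gamma> (subst_fm ?A (Emp S) 0)"
    using SeqInd.IH(1)[OF SeqInd.prems] by (simp add: lift_fm_subst_fm)
  have "HA ((S # Star S # E1) @ T # E2) (map (\<lambda>B. lift_fm B (length (S # Star S # E1)))
       (lift_fm A 0 # map (\<lambda>B. lift_fm (lift_fm B 0) 0) \<Gamma>))
     (lift_fm (subst_fm (lift_fm (lift_fm A 1) 1) (Snoc S \<cdot> Var 1 \<cdot> Var 0) 0) (length (S # Star S # E1)))"
    by (rule SeqInd.IH) (simp add: SeqInd.prems)
  then have 2: "HA (S # Star S # E1 @ T # E2) (lift_fm ?A 0 # map (\<lambda>B. lift_fm (lift_fm B 0) 0) ?\<Gamma>)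
     (subst_fm (lift_fm (lift_fm ?A 1) 1) (Snoc S \<cdot> Var 1 \<cdot> Var 0) 0)"
    by (simp add: comp_def lift_fm_subst_fm lift_fm_lift_fm)
  have 3: "wf_fm (Star S # E1 @ T # E2) ?A"
    using SeqInd.hyps SeqInd.prems wf_lift_fm[of "Star S # E1" T E2 A] by simp
  show ?case using HA.SeqInd[OF 1 2 3] by simp
next
  case (HatSnocOther E \<Gamma> n S s x)
  then show ?case using HatSnocOther.IH[OF HatSnocOther.prems]
    by (auto intro!: HA.HatSnocOther simp: infer_lift)
qed (simp_all add: HA_axioms infer_lift)

lemma HA_lift: "HA E \<Gamma> A \<Longrightarrow> HA (T # E) (lift_fms \<Gamma>) (lift_fm A 0)"
  using HA_lift_gen[of E \<Gamma> A "[]"] by simp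

lemma HA_lift_Cons: "HA E \<Gamma> A \<Longrightarrow> HA (T # E) (B # lift_fms \<Gamma>) (lift_fm A 0)"
  by (intro HA_weaken_Cons HA_lift)

lemma Hyp0: "wf_fm E A \<Longrightarrow> HA E (A # \<Gamma>) A"
  by (rule HA.Hyp) auto

section \<open>Equational reasoning and head reduction\<close>

lemma Eq_refl: "infer E t = Some T \<Longrightarrow> HA E \<Gamma> (Eq T t t)"
  by (rule HA.Refl) simp

lemma Eq_sym: assumes "HA E \<Gamma> (Eq T t u)" shows "HA E \<Gamma> (Eq T u t)"
  using HA.Subst[of E \<Gamma> T t u "Eq T (Var 0) (lift t 0)"] assms HA_typed[OF assms]
  by (auto intro: Eq_refl)

lemma Eq_trans [trans]:
  assumes "HA E \<Gamma> (Eq T t u)" "HA E \<Gamma> (Eq T u v)" shows "HA E \<Gamma> (Eq T t v)"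
  using HA.Subst[of E \<Gamma> T u v "Eq T (lift t 0) (Var 0)"] assms HA_typed[OF assms(1)]
  by auto

lemma Eq_arg:
  assumes "HA E \<Gamma> (Eq T a b)" "infer E f = Some (T \<rightarrow> U)" shows "HA E \<Gamma> (Eq U (f \<cdot> a) (f \<cdot> b))"
  using HA.Subst[of E \<Gamma> T a b "Eq U (lift (f \<cdot> a) 0) (lift f 0 \<cdot> Var 0)"] assms HA_typed[OF assms(1)]
    Eq_refl[of E "f \<cdot> a" U \<Gamma>]
  by simp

lemma Eq_fun:
  assumes "HA E \<Gamma> (Eq (T \<rightarrow> U) f g)" "infer E a = Some T" shows "HA E \<Gamma> (Eq U (f \<cdot> a) (g \<cdot> a))"
  using HA.Subst[of E \<Gamma> "T \<rightarrow> U" f g "Eq U (lift (f \<cdot> a) 0) (Var 0 \<cdot> lift a 0)"] assms HA_typed[OF assms(1)]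
    Eq_refl[of E "f \<cdot> a" U \<Gamma>]
  by simp

lemma Eq_ext:
  assumes "HA (T # E) (lift_fms \<Gamma>) (Eq U (lift t 0 \<cdot> Var 0) (lift u 0 \<cdot> Var 0))"
    "infer E t = Some (T \<rightarrow> U)" "infer E u = Some (T \<rightarrow> U)"
  shows "HA E \<Gamma> (Eq (T \<rightarrow> U) t u)"
  by (rule HA.Ext[OF HA.AllI]) (use assms in auto)

lemma Eq_beta:
  "infer (T # E) t = Some U \<Longrightarrow> infer E u = Some T \<Longrightarrow> HA E \<Gamma> (Eq U (Lam T t \<cdot> u) (subst t u 0))"
  by (rule HA.Beta) auto

lemma infer_lift_1 [simp]: "infer (S # T # E) (lift t (Suc 0)) = infer (S # E) t"
  using infer_lift[of "[S]"] by simp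

text \<open>The rule that allows rewriting under an abstraction. It comes from extensionality:
  applied to a fresh variable, both abstractions beta-reduce to their bodies.\<close>

lemma Eq_Lam:
  assumes "HA (T # E) (lift_fms \<Gamma>) (Eq U t u)"
  shows "HA E \<Gamma> (Eq (T \<rightarrow> U) (Lam T t) (Lam T u))"
proof (rule Eq_ext)
  have b: "HA (T # E) (lift_fms \<Gamma>) (Eq U (lift (Lam T v) 0 \<cdot> Var 0) v)" if "infer (T # E) v = Some U" for v
    using Eq_beta[of T "T # E" "lift v (Suc 0)" U "Var 0" "lift_fms \<Gamma>"] that by simp
  show "HA (T # E) (lift_fms \<Gamma>) (Eq U (lift (Lam T t) 0 \<cdot> Var 0) (lift (Lam T u) 0 \<cdot> Var 0))"
    using Eq_trans[OF Eq_trans[OF b assms] Eq_sym[OF b]] HA_typed[OF assms] by simp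
qed (use HA_typed[OF assms] in auto)

text \<open>One head reduction step, if there is one. A closed combinator is computed by
  \<open>Eq_reds\<close> with as many steps as abstractions to contract; the count is written with
  \<open>Suc\<close> so that the simplifier unfolds the iteration.\<close>

primrec red :: "tm \<Rightarrow> tm" where
  "red (Var i) = Var i"
| "red (Con c) = Con c"
| "red (t \<cdot> u) = (case t of Lam T b \<Rightarrow> subst b u 0 | _ \<Rightarrow> red t \<cdot> u)"
| "red (Lam T t) = Lam T t"

lemma Eq_red: "infer E t = Some T \<Longrightarrow> HA E \<Gamma> (Eq T t (red t))"
proof (induction t arbitrary: T)
  case (App t u)
  then obtain S where S: "infer E t = Some (S \<rightarrow> T)" "infer E u = Some S"
    unfolding infer_App by blast
  show ?case
  proof (cases "\<exists>S' b. t = Lam S' b")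
    case True
    then obtain S' b where t: "t = Lam S' b" by blast
    with S(1) have "S' = S" "infer (S # E) b = Some T" by (simp_all only: infer_Lam) auto
    then show ?thesis using S(2) t by (simp add: Eq_beta)
  next
    case False
    then have "red (t \<cdot> u) = red t \<cdot> u" by (auto split: tm.splits)
    then show ?thesis using Eq_fun[OF App.IH(1)[OF S(1)] S(2)] by simp
  qed
qed (auto intro: Eq_refl)

lemma Eq_reds: "infer E t = Some T \<Longrightarrow> HA E \<Gamma> (Eq T t ((red ^^ n) t))"
proof (induction n)
  case (Suc n)
  have "HA E \<Gamma> (Eq T t ((red ^^ n) t))" using Suc by simp
  also have "HA E \<Gamma> (Eq T ((red ^^ n) t) (red ((red ^^ n) t)))"
    by (rule Eq_red) (rule HA_typed(2)[OF calculation])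
  finally show ?case by simp
qed (simp add: Eq_refl)

section \<open>Induction, case distinction and primitive recursive arithmetic\<close>

lemma Nat_induct:
  assumes "wf_fm (Nat # E) A" "infer E n = Some Nat" "HA E \<Gamma> (subst_fm A Zero 0)"
    "HA (Nat # E) (A # lift_fms \<Gamma>) (subst_fm (lift_fm A (Suc 0)) (Succ \<cdot> Var 0) 0)"
  shows "HA E \<Gamma> (subst_fm A n 0)"
  using HA.AllE[OF HA.NatInd[of E \<Gamma> A], of n] assms by simp

lemma Nat_cases:
  assumes "wf_fm (Nat # E) A" "infer E n = Some Nat" "HA E \<Gamma> (subst_fm A Zero 0)"
    "HA (Nat # E) (lift_fms \<Gamma>) (subst_fm (lift_fm A (Suc 0)) (Succ \<cdot> Var 0) 0)"
  shows "HA E \<Gamma> (subst_fm A n 0)"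
  by (rule Nat_induct) (use assms in \<open>auto intro: HA_weaken_Cons\<close>)

abbreviation Neg :: "fm \<Rightarrow> fm" where "Neg A \<equiv> Imp A Bot"

lemma Neg_elim: "HA E \<Gamma> (Neg A) \<Longrightarrow> HA E \<Gamma> A \<Longrightarrow> wf_fm E C \<Longrightarrow> HA E \<Gamma> C"
  by (rule HA.BotE[OF HA.ImpE])

lemma Neg_Succ_Zero: "infer E m = Some Nat \<Longrightarrow> HA E \<Gamma> (Neg (Eq Nat (Succ \<cdot> m) Zero))"
  by (intro HA.ImpI HA.SuccZero[OF Hyp0]) auto

lemma Eq_Neg:
  assumes "HA E \<Gamma> (Eq T a b)" "HA E \<Gamma> (Neg (Eq T a c))" shows "HA E \<Gamma> (Neg (Eq T b c))"
  using HA.Subst[of E \<Gamma> T a b "Neg (Eq T (Var 0) (lift c 0))"] assms HA_wf[OF assms(1)] HA_wf[OF assms(2)]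
  by simp

text \<open>The calculus is intuitionistic, so the comparisons of a length with a number rest on
  this decision, which needs only the distinction between zero and successor.\<close>

lemma Eq_Zero_dec:
  assumes "infer E d = Some Nat"
  shows "HA E \<Gamma> (Or (Eq Nat d Zero) (Neg (Eq Nat d Zero)))"
proof -
  have "HA E \<Gamma> (Or (Eq Nat Zero Zero) (Neg (Eq Nat Zero Zero)))"
    by (rule HA.OrI1[OF Eq_refl]) auto
  moreover have "HA (Nat # E) (lift_fms \<Gamma>)
      (Or (Eq Nat (Succ \<cdot> Var 0) Zero) (Neg (Eq Nat (Succ \<cdot> Var 0) Zero)))"
    by (rule HA.OrI2[OF Neg_Succ_Zero]) auto
  ultimately show ?thesis
    using Nat_cases[of E "Or (Eq Nat (Var 0) Zero) (Neg (Eq Nat (Var 0) Zero))" d \<Gamma>] assms by simp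
qed

lemma infer_Add: "infer [] Add = Some (Nat \<rightarrow> Nat \<rightarrow> Nat)" by (simp add: Add_def)
lemma infer_Pred: "infer [] Pred = Some (Nat \<rightarrow> Nat)" by (simp add: Pred_def)
lemmas closed_Add [simp] = closed_term[OF infer_Add]
lemmas closed_Pred [simp] = closed_term[OF infer_Pred]
lemma infer_Monus: "infer [] Monus = Some (Nat \<rightarrow> Nat \<rightarrow> Nat)" by (simp add: Monus_def)
lemmas closed_Monus [simp] = closed_term[OF infer_Monus]
lemma infer_IfLess: "infer [] (IfLess T) = Some (Nat \<rightarrow> Nat \<rightarrow> T \<rightarrow> T \<rightarrow> T)" by (simp add: IfLess_def)
lemmas closed_IfLess [simp] = closed_term[OF infer_IfLess]
lemma infer_phi: "infer [] (phi \<tau> \<sigma>) = Some (G_ty \<tau> \<sigma> \<rightarrow> H_ty \<tau> \<sigma> \<rightarrow> Nat \<rightarrow> Star \<tau> \<rightarrow> \<sigma>)"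
  by (simp add: phi_def)
lemmas closed_phi [simp] = closed_term[OF infer_phi]
lemma infer_Psi: "infer [] (Psi \<tau> \<sigma>) = Some (Nat \<rightarrow> BR_ty \<tau> \<sigma>)"
  by (simp add: Psi_def)
lemmas closed_Psi [simp] = closed_term[OF infer_Psi]

lemma Rec_Zero:
  "infer E a = Some T \<Longrightarrow> infer E f = Some (Nat \<rightarrow> T \<rightarrow> T) \<Longrightarrow> HA E \<Gamma> (Eq T (Rec T \<cdot> a \<cdot> f \<cdot> Zero) a)"
  by (rule HA.RecZero) auto

lemma Rec_Succ:
  "infer E a = Some T \<Longrightarrow> infer E f = Some (Nat \<rightarrow> T \<rightarrow> T) \<Longrightarrow> infer E m = Some Nat \<Longrightarrow>
    HA E \<Gamma> (Eq T (Rec T \<cdot> a \<cdot> f \<cdot> (Succ \<cdot> m)) (f \<cdot> m \<cdot> (Rec T \<cdot> a \<cdot> f \<cdot> m)))"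
  by (rule HA.RecSucc) auto

lemma Add_unfold:
  assumes "infer E m = Some Nat" "infer E n = Some Nat"
  shows "HA E \<Gamma> (Eq Nat (Add \<cdot> m \<cdot> n) (Rec Nat \<cdot> m \<cdot> Lam Nat (Lam Nat (Succ \<cdot> Var 0)) \<cdot> n))"
  using Eq_reds[of E "Add \<cdot> m \<cdot> n" Nat \<Gamma> "Suc (Suc 0)"] assms by (simp add: Add_def)

lemma Add_Zero:
  assumes "infer E m = Some Nat" shows "HA E \<Gamma> (Eq Nat (Add \<cdot> m \<cdot> Zero) m)"
  using Eq_trans[OF Add_unfold[of E m Zero \<Gamma>] Rec_Zero] assms by simp

lemma Add_Succ:
  assumes "infer E m = Some Nat" "infer E n = Some Nat"
  shows "HA E \<Gamma> (Eq Nat (Add \<cdot> m \<cdot> (Succ \<cdot> n)) (Succ \<cdot> (Add \<cdot> m \<cdot> n)))"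
proof -
  let ?f = "Lam Nat (Lam Nat (Succ \<cdot> Var 0))"
  let ?R = "Rec Nat \<cdot> m \<cdot> ?f \<cdot> n"
  have "HA E \<Gamma> (Eq Nat (Add \<cdot> m \<cdot> (Succ \<cdot> n)) (Rec Nat \<cdot> m \<cdot> ?f \<cdot> (Succ \<cdot> n)))"
    using assms by (intro Add_unfold) auto
  also have "HA E \<Gamma> (Eq Nat (Rec Nat \<cdot> m \<cdot> ?f \<cdot> (Succ \<cdot> n)) (?f \<cdot> n \<cdot> ?R))"
    using assms by (intro Rec_Succ) auto
  also have "HA E \<Gamma> (Eq Nat (?f \<cdot> n \<cdot> ?R) (Succ \<cdot> ?R))"
    using Eq_reds[of E "?f \<cdot> n \<cdot> ?R" Nat \<Gamma> "Suc (Suc 0)"] assms by simp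
  also have "HA E \<Gamma> (Eq Nat (Succ \<cdot> ?R) (Succ \<cdot> (Add \<cdot> m \<cdot> n)))"
    using assms by (intro Eq_arg[where T=Nat] Eq_sym[OF Add_unfold]) auto
  finally show ?thesis .
qed

lemma Pred_unfold:
  assumes "infer E m = Some Nat"
  shows "HA E \<Gamma> (Eq Nat (Pred \<cdot> m) (Rec Nat \<cdot> Zero \<cdot> Lam Nat (Lam Nat (Var 1)) \<cdot> m))"
  using Eq_reds[of E "Pred \<cdot> m" Nat \<Gamma> "Suc 0"] assms by (simp add: Pred_def)

lemma Pred_Zero: "HA E \<Gamma> (Eq Nat (Pred \<cdot> Zero) Zero)"
  using Eq_trans[OF Pred_unfold[of E Zero \<Gamma>] Rec_Zero] by simp

lemma Pred_Succ:
  assumes "infer E m = Some Nat" shows "HA E \<Gamma> (Eq Nat (Pred \<cdot> (Succ \<cdot> m)) m)"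
proof -
  let ?f = "Lam Nat (Lam Nat (Var 1))"
  let ?R = "Rec Nat \<cdot> Zero \<cdot> ?f \<cdot> m"
  have "HA E \<Gamma> (Eq Nat (Pred \<cdot> (Succ \<cdot> m)) (Rec Nat \<cdot> Zero \<cdot> ?f \<cdot> (Succ \<cdot> m)))"
    using assms by (intro Pred_unfold) auto
  also have "HA E \<Gamma> (Eq Nat (Rec Nat \<cdot> Zero \<cdot> ?f \<cdot> (Succ \<cdot> m)) (?f \<cdot> m \<cdot> ?R))"
    using assms by (intro Rec_Succ) auto
  also have "HA E \<Gamma> (Eq Nat (?f \<cdot> m \<cdot> ?R) m)"
    using Eq_reds[of E "?f \<cdot> m \<cdot> ?R" Nat \<Gamma> "Suc (Suc 0)"] assms by simp
  finally show ?thesis .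
qed

lemma Monus_unfold:
  assumes "infer E m = Some Nat" "infer E n = Some Nat"
  shows "HA E \<Gamma> (Eq Nat (Monus \<cdot> m \<cdot> n) (Rec Nat \<cdot> m \<cdot> Lam Nat (Lam Nat (Pred \<cdot> Var 0)) \<cdot> n))"
  using Eq_reds[of E "Monus \<cdot> m \<cdot> n" Nat \<Gamma> "Suc (Suc 0)"] assms by (simp add: Monus_def)

lemma Monus_Zero:
  assumes "infer E m = Some Nat" shows "HA E \<Gamma> (Eq Nat (Monus \<cdot> m \<cdot> Zero) m)"
  using Eq_trans[OF Monus_unfold[of E m Zero \<Gamma>] Rec_Zero] assms by simp

lemma Monus_Succ:
  assumes "infer E m = Some Nat" "infer E n = Some Nat"
  shows "HA E \<Gamma> (Eq Nat (Monus \<cdot> m \<cdot> (Succ \<cdot> n)) (Pred \<cdot> (Monus \<cdot> m \<cdot> n)))"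
proof -
  let ?f = "Lam Nat (Lam Nat (Pred \<cdot> Var 0))"
  let ?R = "Rec Nat \<cdot> m \<cdot> ?f \<cdot> n"
  have "HA E \<Gamma> (Eq Nat (Monus \<cdot> m \<cdot> (Succ \<cdot> n)) (Rec Nat \<cdot> m \<cdot> ?f \<cdot> (Succ \<cdot> n)))"
    using assms by (intro Monus_unfold) auto
  also have "HA E \<Gamma> (Eq Nat (Rec Nat \<cdot> m \<cdot> ?f \<cdot> (Succ \<cdot> n)) (?f \<cdot> n \<cdot> ?R))"
    using assms by (intro Rec_Succ) auto
  also have "HA E \<Gamma> (Eq Nat (?f \<cdot> n \<cdot> ?R) (Pred \<cdot> ?R))"
    using Eq_reds[of E "?f \<cdot> n \<cdot> ?R" Nat \<Gamma> "Suc (Suc 0)"] assms by simp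
  also have "HA E \<Gamma> (Eq Nat (Pred \<cdot> ?R) (Pred \<cdot> (Monus \<cdot> m \<cdot> n)))"
    using assms by (intro Eq_arg[where T=Nat] Eq_sym[OF Monus_unfold]) auto
  finally show ?thesis .
qed

text \<open>\<open>Monus\<close> recurses on its second argument and applies \<open>Pred\<close> to
  the result, so cancelling two successors takes an induction on \<open>n\<close>.\<close>

lemma Monus_Succ_Succ:
  assumes "infer E m = Some Nat" "infer E n = Some Nat"
  shows "HA E \<Gamma> (Eq Nat (Monus \<cdot> (Succ \<cdot> m) \<cdot> (Succ \<cdot> n)) (Monus \<cdot> m \<cdot> n))"
proof -
  let ?A = "Eq Nat (Monus \<cdot> (Succ \<cdot> lift m 0) \<cdot> (Succ \<cdot> Var 0)) (Monus \<cdot> lift m 0 \<cdot> Var 0)"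
  have S: "HA F \<Delta> (Eq Nat (Monus \<cdot> (Succ \<cdot> k) \<cdot> (Succ \<cdot> n)) (Pred \<cdot> (Monus \<cdot> (Succ \<cdot> k) \<cdot> n)))"
    if "infer F k = Some Nat" "infer F n = Some Nat" for F \<Delta> k n
    using that by (intro Monus_Succ) auto
  have 0: "HA E \<Gamma> (Eq Nat (Monus \<cdot> (Succ \<cdot> m) \<cdot> (Succ \<cdot> Zero)) (Monus \<cdot> m \<cdot> Zero))"
  proof -
    have "HA E \<Gamma> (Eq Nat (Monus \<cdot> (Succ \<cdot> m) \<cdot> (Succ \<cdot> Zero)) (Pred \<cdot> (Monus \<cdot> (Succ \<cdot> m) \<cdot> Zero)))"
      using assms by (intro S) auto
    also have "HA E \<Gamma> (Eq Nat (Pred \<cdot> (Monus \<cdot> (Succ \<cdot> m) \<cdot> Zero)) (Pred \<cdot> (Succ \<cdot> m)))"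
      using assms by (intro Eq_arg[where T=Nat] Monus_Zero) auto
    also have "HA E \<Gamma> (Eq Nat (Pred \<cdot> (Succ \<cdot> m)) m)" using assms by (intro Pred_Succ) auto
    also have "HA E \<Gamma> (Eq Nat m (Monus \<cdot> m \<cdot> Zero))" using assms by (intro Eq_sym[OF Monus_Zero]) auto
    finally show ?thesis .
  qed
  have 1: "HA (Nat # E) (?A # lift_fms \<Gamma>)
     (Eq Nat (Monus \<cdot> (Succ \<cdot> lift m 0) \<cdot> (Succ \<cdot> (Succ \<cdot> Var 0))) (Monus \<cdot> lift m 0 \<cdot> (Succ \<cdot> Var 0)))"
    (is "HA ?E ?\<Gamma> _")
  proof -
    have "HA ?E ?\<Gamma> (Eq Nat (Monus \<cdot> (Succ \<cdot> lift m 0) \<cdot> (Succ \<cdot> (Succ \<cdot> Var 0)))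
        (Pred \<cdot> (Monus \<cdot> (Succ \<cdot> lift m 0) \<cdot> (Succ \<cdot> Var 0))))"
      using assms by (intro S) auto
    also have "HA ?E ?\<Gamma> (Eq Nat (Pred \<cdot> (Monus \<cdot> (Succ \<cdot> lift m 0) \<cdot> (Succ \<cdot> Var 0)))
        (Pred \<cdot> (Monus \<cdot> lift m 0 \<cdot> Var 0)))"
      using assms by (intro Eq_arg[where T=Nat] Hyp0) auto
    also have "HA ?E ?\<Gamma> (Eq Nat (Pred \<cdot> (Monus \<cdot> lift m 0 \<cdot> Var 0)) (Monus \<cdot> lift m 0 \<cdot> (Succ \<cdot> Var 0)))"
      using assms by (intro Eq_sym[OF Monus_Succ]) auto
    finally show ?thesis .
  qed
  show ?thesis using Nat_induct[of E ?A n \<Gamma>] 0 1 assms by simp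
qed

lemma Monus_Zero_left:
  assumes "infer E n = Some Nat"
  shows "HA E \<Gamma> (Eq Nat (Monus \<cdot> Zero \<cdot> n) Zero)"
proof -
  let ?A = "Eq Nat (Monus \<cdot> Zero \<cdot> Var 0) Zero"
  have 1: "HA (Nat # E) (?A # lift_fms \<Gamma>) (Eq Nat (Monus \<cdot> Zero \<cdot> (Succ \<cdot> Var 0)) Zero)" (is "HA ?E ?\<Gamma> _")
  proof -
    have "HA ?E ?\<Gamma> (Eq Nat (Monus \<cdot> Zero \<cdot> (Succ \<cdot> Var 0)) (Pred \<cdot> (Monus \<cdot> Zero \<cdot> Var 0)))"
      by (intro Monus_Succ) auto
    also have "HA ?E ?\<Gamma> (Eq Nat (Pred \<cdot> (Monus \<cdot> Zero \<cdot> Var 0)) (Pred \<cdot> Zero))"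
      by (intro Eq_arg[where T=Nat] Hyp0) auto
    also note Pred_Zero
    finally show ?thesis .
  qed
  show ?thesis using Nat_induct[of E ?A n \<Gamma>] Monus_Zero[of E Zero \<Gamma>] 1 assms by simp
qed

lemma Monus_self:
  assumes "infer E n = Some Nat"
  shows "HA E \<Gamma> (Eq Nat (Monus \<cdot> n \<cdot> n) Zero)"
proof -
  let ?A = "Eq Nat (Monus \<cdot> Var 0 \<cdot> Var 0) Zero"
  have 1: "HA (Nat # E) (?A # lift_fms \<Gamma>) (Eq Nat (Monus \<cdot> (Succ \<cdot> Var 0) \<cdot> (Succ \<cdot> Var 0)) Zero)"
    by (rule Eq_trans[OF Monus_Succ_Succ Hyp0]) auto
  show ?thesis using Nat_induct[of E ?A n \<Gamma>] Monus_Zero[of E Zero \<Gamma>] 1 assms by simp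
qed

text \<open>Replacement in an arbitrary term context \<open>c\<close>, whose variable 0 marks the
  places. It reaches places, such as the head of a multiple application, that a fixed number of
  congruence steps does not.\<close>

lemma Eq_subst:
  assumes "HA E \<Gamma> (Eq T a b)" "infer (T # E) c = Some U"
  shows "HA E \<Gamma> (Eq U (subst c a 0) (subst c b 0))"
  using HA.Subst[of E \<Gamma> T a b "Eq U (lift (subst c a 0) 0) c"] assms HA_typed[OF assms(1)]
    Eq_refl[of E "subst c a 0" U \<Gamma>]
  by (simp add: infer_subst_0)

lemma Monus_Add:
  assumes "infer E n = Some Nat" "infer E p = Some Nat"
  shows "HA E \<Gamma> (Eq Nat (Monus \<cdot> n \<cdot> (Add \<cdot> n \<cdot> p)) Zero)"
proof -
  let ?A = "Eq Nat (Monus \<cdot> lift n 0 \<cdot> (Add \<cdot> lift n 0 \<cdot> Var 0)) Zero"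
  have 0: "HA E \<Gamma> (Eq Nat (Monus \<cdot> n \<cdot> (Add \<cdot> n \<cdot> Zero)) Zero)"
  proof -
    have "HA E \<Gamma> (Eq Nat (Monus \<cdot> n \<cdot> (Add \<cdot> n \<cdot> Zero)) (Monus \<cdot> n \<cdot> n))"
      using assms by (intro Eq_arg[where T=Nat] Add_Zero) auto
    also note Monus_self[OF assms(1)]
    finally show ?thesis .
  qed
  have 1: "HA (Nat # E) (?A # lift_fms \<Gamma>)
     (Eq Nat (Monus \<cdot> lift n 0 \<cdot> (Add \<cdot> lift n 0 \<cdot> (Succ \<cdot> Var 0))) Zero)" (is "HA ?E ?\<Gamma> _")
  proof -
    have "HA ?E ?\<Gamma> (Eq Nat (Monus \<cdot> lift n 0 \<cdot> (Add \<cdot> lift n 0 \<cdot> (Succ \<cdot> Var 0)))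
       (Monus \<cdot> lift n 0 \<cdot> (Succ \<cdot> (Add \<cdot> lift n 0 \<cdot> Var 0))))"
      using assms by (intro Eq_arg[where T=Nat] Add_Succ) auto
    also have "HA ?E ?\<Gamma> (Eq Nat (Monus \<cdot> lift n 0 \<cdot> (Succ \<cdot> (Add \<cdot> lift n 0 \<cdot> Var 0)))
      (Pred \<cdot> (Monus \<cdot> lift n 0 \<cdot> (Add \<cdot> lift n 0 \<cdot> Var 0))))"
      using assms by (intro Monus_Succ) auto
    also have "HA ?E ?\<Gamma> (Eq Nat (Pred \<cdot> (Monus \<cdot> lift n 0 \<cdot> (Add \<cdot> lift n 0 \<cdot> Var 0))) (Pred \<cdot> Zero))"
      using assms by (intro Eq_arg[where T=Nat] Hyp0) auto
    also note Pred_Zero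
    finally show ?thesis .
  qed
  show ?thesis using Nat_induct[of E ?A p \<Gamma>] 0 1 assms by simp
qed

lemma Add_Zero_left:
  assumes "infer E n = Some Nat"
  shows "HA E \<Gamma> (Eq Nat (Add \<cdot> Zero \<cdot> n) n)"
proof -
  let ?A = "Eq Nat (Add \<cdot> Zero \<cdot> Var 0) (Var 0)"
  have 1: "HA (Nat # E) (?A # lift_fms \<Gamma>) (Eq Nat (Add \<cdot> Zero \<cdot> (Succ \<cdot> Var 0)) (Succ \<cdot> Var 0))"
    by (rule Eq_trans[OF Add_Succ Eq_arg[OF Hyp0]]) auto
  show ?thesis using Nat_induct[of E ?A n \<Gamma>] Add_Zero[of E Zero \<Gamma>] 1 assms by simp
qed

lemma Add_Succ_left:
  assumes "infer E m = Some Nat" "infer E n = Some Nat"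
  shows "HA E \<Gamma> (Eq Nat (Add \<cdot> (Succ \<cdot> m) \<cdot> n) (Succ \<cdot> (Add \<cdot> m \<cdot> n)))"
proof -
  let ?A = "Eq Nat (Add \<cdot> (Succ \<cdot> lift m 0) \<cdot> Var 0) (Succ \<cdot> (Add \<cdot> lift m 0 \<cdot> Var 0))"
  have 0: "HA E \<Gamma> (Eq Nat (Add \<cdot> (Succ \<cdot> m) \<cdot> Zero) (Succ \<cdot> (Add \<cdot> m \<cdot> Zero)))"
    by (rule Eq_trans[OF Add_Zero Eq_arg[OF Eq_sym[OF Add_Zero]]]) (use assms in auto)
  have 1: "HA (Nat # E) (?A # lift_fms \<Gamma>)
     (Eq Nat (Add \<cdot> (Succ \<cdot> lift m 0) \<cdot> (Succ \<cdot> Var 0)) (Succ \<cdot> (Add \<cdot> lift m 0 \<cdot> (Succ \<cdot> Var 0))))"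
    by (rule Eq_trans[OF Add_Succ Eq_arg[OF Eq_trans[OF Hyp0 Eq_sym[OF Add_Succ]]]]) (use assms in auto)
  show ?thesis using Nat_induct[of E ?A n \<Gamma>] 0 1 assms by simp
qed

lemma Add_Monus:
  assumes "infer E m = Some Nat" "infer E p = Some Nat"
  shows "HA E \<Gamma> (Eq Nat (Monus \<cdot> (Add \<cdot> m \<cdot> p) \<cdot> m) p)"
proof -
  let ?A = "Eq Nat (Monus \<cdot> (Add \<cdot> Var 0 \<cdot> lift p 0) \<cdot> Var 0) (lift p 0)"
  have 0: "HA E \<Gamma> (Eq Nat (Monus \<cdot> (Add \<cdot> Zero \<cdot> p) \<cdot> Zero) p)"
    by (rule Eq_trans[OF Monus_Zero Add_Zero_left]) (use assms in auto)
  have 1: "HA (Nat # E) (?A # lift_fms \<Gamma>)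
     (Eq Nat (Monus \<cdot> (Add \<cdot> (Succ \<cdot> Var 0) \<cdot> lift p 0) \<cdot> (Succ \<cdot> Var 0)) (lift p 0))"
    (is "HA ?E ?\<Gamma> _")
  proof -
    have "HA ?E ?\<Gamma> (Eq Nat (Monus \<cdot> (Add \<cdot> (Succ \<cdot> Var 0) \<cdot> lift p 0) \<cdot> (Succ \<cdot> Var 0))
        (Monus \<cdot> (Succ \<cdot> (Add \<cdot> Var 0 \<cdot> lift p 0)) \<cdot> (Succ \<cdot> Var 0)))"
      by (rule Eq_fun[OF Eq_arg[OF Add_Succ_left]]) (use assms in auto)
    also have "HA ?E ?\<Gamma> (Eq Nat (Monus \<cdot> (Succ \<cdot> (Add \<cdot> Var 0 \<cdot> lift p 0)) \<cdot> (Succ \<cdot> Var 0))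
        (Monus \<cdot> (Add \<cdot> Var 0 \<cdot> lift p 0) \<cdot> Var 0))"
      by (rule Monus_Succ_Succ) (use assms in auto)
    also have "HA ?E ?\<Gamma> (Eq Nat (Monus \<cdot> (Add \<cdot> Var 0 \<cdot> lift p 0) \<cdot> Var 0) (lift p 0))"
      using assms by (intro Hyp0) auto
    finally show ?thesis .
  qed
  show ?thesis using Nat_induct[of E ?A m \<Gamma>] 0 1 assms by simp
qed

section \<open>The order through truncated subtraction\<close>

abbreviation ge :: "tm \<Rightarrow> tm \<Rightarrow> fm" where "ge m n \<equiv> Eq Nat (Monus \<cdot> n \<cdot> m) Zero"
abbreviation lt :: "tm \<Rightarrow> tm \<Rightarrow> fm" where "lt m n \<equiv> Neg (ge m n)"

text \<open>\<open>IfLess\<close> branches on a truncated difference, so the proof works with its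
  vanishing. The existential orders of the final statement are translated into this form and occur
  nowhere else.\<close>

lemma ge_of_GreaterEq:
  assumes "HA E \<Gamma> (GreaterEq m n)" "infer E m = Some Nat" "infer E n = Some Nat"
  shows "HA E \<Gamma> (ge m n)"
proof (rule HA.ExE[OF assms(1)[unfolded GreaterEq_def]])
  let ?\<Gamma> = "Eq Nat (Add \<cdot> lift n 0 \<cdot> Var 0) (lift m 0) # lift_fms \<Gamma>"
  have "HA (Nat # E) ?\<Gamma> (Eq Nat (Monus \<cdot> lift n 0 \<cdot> lift m 0) (Monus \<cdot> lift n 0 \<cdot> (Add \<cdot> lift n 0 \<cdot> Var 0)))"
    by (rule Eq_arg[OF Eq_sym[OF Hyp0]]) (use assms in auto)
  also have "HA (Nat # E) ?\<Gamma> (Eq Nat (Monus \<cdot> lift n 0 \<cdot> (Add \<cdot> lift n 0 \<cdot> Var 0)) Zero)"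
    by (rule Monus_Add) (use assms in auto)
  finally show "HA (Nat # E) ?\<Gamma> (lift_fm (ge m n) 0)" by simp
qed (use assms in auto)

lemma lt_of_Less:
  assumes "HA E \<Gamma> (Less m n)" "infer E m = Some Nat" "infer E n = Some Nat"
  shows "HA E \<Gamma> (lt m n)"
proof (rule HA.ExE[OF assms(1)[unfolded Less_def]])
  let ?\<Gamma> = "Eq Nat (Add \<cdot> lift m 0 \<cdot> (Succ \<cdot> Var 0)) (lift n 0) # lift_fms \<Gamma>"
  have "HA (Nat # E) ?\<Gamma> (Eq Nat (Succ \<cdot> Var 0) (Monus \<cdot> (Add \<cdot> lift m 0 \<cdot> (Succ \<cdot> Var 0)) \<cdot> lift m 0))"
    by (rule Eq_sym[OF Add_Monus]) (use assms in auto)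
  also have "HA (Nat # E) ?\<Gamma> (Eq Nat (Monus \<cdot> (Add \<cdot> lift m 0 \<cdot> (Succ \<cdot> Var 0)) \<cdot> lift m 0) (Monus \<cdot> lift n 0 \<cdot> lift m 0))"
    by (rule Eq_fun[OF Eq_arg[OF Hyp0]]) (use assms in auto)
  finally have "HA (Nat # E) ?\<Gamma> (Neg (Eq Nat (Monus \<cdot> lift n 0 \<cdot> lift m 0) Zero))"
    by (rule Eq_Neg) (rule Neg_Succ_Zero, simp)
  then show "HA (Nat # E) ?\<Gamma> (lift_fm (lt m n) 0)" by simp
qed (use assms in auto)

text \<open>To be read with \<open>a = n - k\<close>, \<open>b = (k + 1) - n\<close> and
  \<open>c = k - n\<close>. For \<open>n = |s|\<close> the term \<open>b\<close> is the number of
  steps that \<open>Psi(k)\<close> assigns to \<open>phi\<close> at \<open>s\<close>: one more than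
  \<open>k - |s|\<close>, or none.\<close>

definition monus_dichotomy :: "tm \<Rightarrow> tm \<Rightarrow> tm \<Rightarrow> fm" where
  "monus_dichotomy a b c = Or (And (Eq Nat a Zero) (Eq Nat b (Succ \<cdot> c)))
    (And (Neg (Eq Nat a Zero)) (Eq Nat b Zero))"

lemma monus_dichotomy_cong:
  assumes "HA E \<Gamma> (monus_dichotomy a b c)"
    "HA E \<Gamma> (Eq Nat a a')" "HA E \<Gamma> (Eq Nat b b')" "HA E \<Gamma> (Eq Nat c c')"
  shows "HA E \<Gamma> (monus_dichotomy a' b' c')"
proof -
  note ty = HA_typed[OF assms(2)] HA_typed[OF assms(3)] HA_typed[OF assms(4)]
  have "HA E \<Gamma> (monus_dichotomy a' b c)"
    using HA.Subst[of E \<Gamma> Nat a a' "monus_dichotomy (Var 0) (lift b 0) (lift c 0)"] assms ty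
    by (simp add: monus_dichotomy_def)
  then have "HA E \<Gamma> (monus_dichotomy a' b' c)"
    using HA.Subst[of E \<Gamma> Nat b b' "monus_dichotomy (lift a' 0) (Var 0) (lift c 0)"] assms ty
    by (simp add: monus_dichotomy_def)
  then show ?thesis
    using HA.Subst[of E \<Gamma> Nat c c' "monus_dichotomy (lift a' 0) (lift b' 0) (Var 0)"] assms ty
    by (simp add: monus_dichotomy_def)
qed

text \<open>The induction on \<open>n\<close> needs \<open>k\<close> universally quantified: in the
  step a successor \<open>k\<close> is handled by the hypothesis at its predecessor, as all three
  terms are invariant under adding 1 to both numbers.\<close>

lemma Monus_dichotomy:
  assumes "infer E n = Some Nat" "infer E k = Some Nat"
  shows "HA E \<Gamma> (monus_dichotomy (Monus \<cdot> n \<cdot> k) (Monus \<cdot> (Succ \<cdot> k) \<cdot> n) (Monus \<cdot> k \<cdot> n))"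
proof -
  let ?D = "\<lambda>n k. monus_dichotomy (Monus \<cdot> n \<cdot> k) (Monus \<cdot> (Succ \<cdot> k) \<cdot> n) (Monus \<cdot> k \<cdot> n)"
  let ?A = "All Nat (?D (Var 1) (Var 0))"
  have 00: "HA F \<Delta> (?D Zero k)" if "infer F k = Some Nat" for F \<Delta> k
    unfolding monus_dichotomy_def
  proof (intro HA.OrI1 HA.AndI)
    show "HA F \<Delta> (Eq Nat (Monus \<cdot> (Succ \<cdot> k) \<cdot> Zero) (Succ \<cdot> (Monus \<cdot> k \<cdot> Zero)))"
      by (rule Eq_trans[OF Monus_Zero Eq_arg[OF Eq_sym[OF Monus_Zero]]]) (use that in auto)
  qed (use that in \<open>auto intro: Monus_Zero_left\<close>)
  have 0: "HA E \<Gamma> (All Nat (?D Zero (Var 0)))"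
    by (rule HA.AllI[OF 00]) simp
  have SZ: "HA F \<Delta> (?D (Succ \<cdot> n) Zero)" if "infer F n = Some Nat" for F \<Delta> n
    unfolding monus_dichotomy_def
  proof (intro HA.OrI2 HA.AndI)
    show "HA F \<Delta> (Neg (Eq Nat (Monus \<cdot> (Succ \<cdot> n) \<cdot> Zero) Zero))"
      by (rule Eq_Neg[OF Eq_sym[OF Monus_Zero] Neg_Succ_Zero]) (use that in auto)
    show "HA F \<Delta> (Eq Nat (Monus \<cdot> (Succ \<cdot> Zero) \<cdot> (Succ \<cdot> n)) Zero)"
      by (rule Eq_trans[OF Monus_Succ_Succ Monus_Zero_left]) (use that in auto)
  qed (use that in auto)
  have SS: "HA F \<Delta> (?D (Succ \<cdot> n) (Succ \<cdot> k))"
    if "HA F \<Delta> (?D n k)" "infer F n = Some Nat" "infer F k = Some Nat" for F \<Delta> n k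
    using that(1) by (rule monus_dichotomy_cong) (rule Eq_sym[OF Monus_Succ_Succ]; use that in simp)+
  have "HA (Nat # Nat # E) (lift_fms (?A # lift_fms \<Gamma>)) (?D (Succ \<cdot> Var 1) (Var 0))"
  proof -
    \<comment> \<open>\<open>?B\<close> has an additional variable 0 in the place of
      \<open>k\<close>; the case distinction runs on this variable, which is then instantiated by
      \<open>k\<close> itself.\<close>
    let ?B = "?D (Succ \<cdot> Var 2) (Var 0)"
    let ?\<Gamma> = "lift_fms (?A # lift_fms \<Gamma>)"
    have "HA (Nat # Nat # E) (lift_fms (?A # lift_fms \<Gamma>)) (subst_fm ?B (Var 0) 0)"
    proof (rule Nat_cases)
      have "HA (Nat # Nat # Nat # E) (lift_fms ?\<Gamma>) (subst_fm (?D (Var 3) (Var 0)) (Var 0) 0)"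
        by (rule HA.AllE[OF HA.Hyp]) (auto simp: monus_dichotomy_def)
      then have "HA (Nat # Nat # Nat # E) (lift_fms ?\<Gamma>) (?D (Var 2) (Var 0))"
        by (simp add: monus_dichotomy_def)
      then have "HA (Nat # Nat # Nat # E) (lift_fms ?\<Gamma>) (?D (Succ \<cdot> Var 2) (Succ \<cdot> Var 0))"
        by (rule SS) auto
      then show "HA (Nat # Nat # Nat # E) (lift_fms ?\<Gamma>) (subst_fm (lift_fm ?B (Suc 0)) (Succ \<cdot> Var 0) 0)"
        by (simp add: monus_dichotomy_def)
      show "HA (Nat # Nat # E) ?\<Gamma> (subst_fm ?B Zero 0)"
        using SZ[of "Nat # Nat # E" "Var 1" ?\<Gamma>] by (simp add: monus_dichotomy_def)
    qed (auto simp: monus_dichotomy_def)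
    then show ?thesis by (simp add: monus_dichotomy_def)
  qed
  then have 1: "HA (Nat # E) (?A # lift_fms \<Gamma>) (All Nat (?D (Succ \<cdot> Var 1) (Var 0)))"
    by (rule HA.AllI)
  have "HA E \<Gamma> (subst_fm ?A n 0)"
    by (rule Nat_induct) (use 0 1 assms in \<open>auto simp: monus_dichotomy_def\<close>)
  from HA.AllE[OF this[simplified], of k] show ?thesis
    using assms by (simp add: monus_dichotomy_def)
qed

lemma lt_imp_Monus:
  assumes "HA E \<Gamma> (lt k n)" "infer E n = Some Nat" "infer E k = Some Nat"
  shows "HA E \<Gamma> (Eq Nat (Monus \<cdot> (Succ \<cdot> k) \<cdot> n) Zero)"
  by (rule HA.OrE[OF Monus_dichotomy[of E n k \<Gamma>, unfolded monus_dichotomy_def]])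
    (auto intro: Neg_elim[OF HA_weaken_Cons[OF assms(1)] HA.AndE1[OF Hyp0]] HA.AndE2[OF Hyp0]
      simp: assms)

lemma ge_imp_Monus:
  assumes "HA E \<Gamma> (ge k n)" "infer E n = Some Nat" "infer E k = Some Nat"
  shows "HA E \<Gamma> (Eq Nat (Monus \<cdot> (Succ \<cdot> k) \<cdot> n) (Succ \<cdot> (Monus \<cdot> k \<cdot> n)))"
  by (rule HA.OrE[OF Monus_dichotomy[of E n k \<Gamma>, unfolded monus_dichotomy_def]])
    (auto intro: Neg_elim[OF HA.AndE1[OF Hyp0] HA_weaken_Cons[OF assms(1)]] HA.AndE2[OF Hyp0]
      simp: assms)

lemma lt_Succ:
  assumes "HA E \<Gamma> (lt i n)" "infer E n = Some Nat" "infer E i = Some Nat"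
  shows "HA E \<Gamma> (lt i (Succ \<cdot> n))"
proof (rule HA.ImpI)
  let ?\<Gamma> = "ge i (Succ \<cdot> n) # \<Gamma>"
  have "HA E ?\<Gamma> (Eq Nat (Monus \<cdot> n \<cdot> i) (Monus \<cdot> (Succ \<cdot> n) \<cdot> (Succ \<cdot> i)))"
    by (rule Eq_sym[OF Monus_Succ_Succ]) (use assms in auto)
  also have "HA E ?\<Gamma> (Eq Nat (Monus \<cdot> (Succ \<cdot> n) \<cdot> (Succ \<cdot> i)) (Pred \<cdot> (Monus \<cdot> (Succ \<cdot> n) \<cdot> i)))"
    by (rule Monus_Succ) (use assms in auto)
  also have "HA E ?\<Gamma> (Eq Nat (Pred \<cdot> (Monus \<cdot> (Succ \<cdot> n) \<cdot> i)) (Pred \<cdot> Zero))"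
    by (rule Eq_arg[OF Hyp0]) (use assms in auto)
  also note Pred_Zero
  finally show "HA E ?\<Gamma> Bot" by (rule HA.ImpE[OF HA_weaken_Cons[OF assms(1)]])
qed (use assms in auto)

section \<open>Definition by cases\<close>

lemma IfLess_unfold:
  assumes "infer E m = Some Nat" "infer E n = Some Nat" "infer E a = Some T" "infer E b = Some T"
  shows "HA E \<Gamma> (Eq T (IfLess T \<cdot> m \<cdot> n \<cdot> a \<cdot> b)
    (Rec T \<cdot> b \<cdot> Lam Nat (Lam T (lift (lift a 0) 0)) \<cdot> (Monus \<cdot> n \<cdot> m)))"
  using Eq_reds[of E "IfLess T \<cdot> m \<cdot> n \<cdot> a \<cdot> b" T \<Gamma> "Suc (Suc (Suc (Suc 0)))"] assms
  by (simp add: IfLess_def)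

lemma IfLess_ge:
  assumes "HA E \<Gamma> (ge m n)"
    "infer E m = Some Nat" "infer E n = Some Nat" "infer E a = Some T" "infer E b = Some T"
  shows "HA E \<Gamma> (Eq T (IfLess T \<cdot> m \<cdot> n \<cdot> a \<cdot> b) b)"
  by (rule Eq_trans[OF IfLess_unfold Eq_trans[OF Eq_arg[OF assms(1)] Rec_Zero]]) (use assms in auto)

lemma Rec_const:
  assumes "HA E \<Gamma> (Neg (Eq Nat d Zero))" "infer E d = Some Nat" "infer E a = Some T" "infer E b = Some T"
  shows "HA E \<Gamma> (Eq T (Rec T \<cdot> b \<cdot> Lam Nat (Lam T (lift (lift a 0) 0)) \<cdot> d) a)"
proof -
  let ?R = "\<lambda>a b d. Rec T \<cdot> b \<cdot> Lam Nat (Lam T (lift (lift a 0) 0)) \<cdot> d"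
  let ?A = "Imp (Neg (Eq Nat (Var 0) Zero)) (Eq T (?R (lift a 0) (lift b 0) (Var 0)) (lift a 0))"
  have S: "HA F \<Delta> (Eq T (?R a b (Succ \<cdot> d)) a)"
    if "infer F d = Some Nat" "infer F a = Some T" "infer F b = Some T" for F \<Delta> a b d
  proof -
    let ?f = "Lam Nat (Lam T (lift (lift a 0) 0))"
    have "HA F \<Delta> (Eq T (?R a b (Succ \<cdot> d)) (?f \<cdot> d \<cdot> ?R a b d))"
      by (rule Rec_Succ) (use that in auto)
    also have "HA F \<Delta> (Eq T (?f \<cdot> d \<cdot> ?R a b d) a)"
      using Eq_reds[of F "?f \<cdot> d \<cdot> ?R a b d" T \<Delta> "Suc (Suc 0)"] that by simp
    finally show ?thesis .
  qed
  have "HA E \<Gamma> (subst_fm ?A d 0)"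
  proof (rule Nat_cases)
    show "HA E \<Gamma> (subst_fm ?A Zero 0)"
      by (auto intro!: HA.ImpI Neg_elim[OF Hyp0] Eq_refl simp: assms)
    show "HA (Nat # E) (lift_fms \<Gamma>) (subst_fm (lift_fm ?A (Suc 0)) (Succ \<cdot> Var 0) 0)"
      using S[of "Nat # E" "Var 0" "lift a 0" "lift b 0"] by (auto intro!: HA.ImpI simp: assms)
  qed (use assms in auto)
  then show ?thesis using HA.ImpE[OF _ assms(1)] by simp
qed

lemma IfLess_lt:
  assumes "HA E \<Gamma> (lt m n)"
    "infer E m = Some Nat" "infer E n = Some Nat" "infer E a = Some T" "infer E b = Some T"
  shows "HA E \<Gamma> (Eq T (IfLess T \<cdot> m \<cdot> n \<cdot> a \<cdot> b) a)"
  by (rule Eq_trans[OF IfLess_unfold Rec_const]) (use assms in auto)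

lemma Len_Snoc:
  "infer E s = Some (Star T) \<Longrightarrow> infer E x = Some T \<Longrightarrow>
    HA E \<Gamma> (Eq Nat (Len T \<cdot> (Snoc T \<cdot> s \<cdot> x)) (Succ \<cdot> (Len T \<cdot> s)))"
  by (rule HA.LenSnoc) auto

section \<open>The finite recursion of \<open>phi\<close> and \<open>Psi\<close>\<close>

lemma phi_unfold:
  assumes "infer E G = Some (G_ty \<tau> \<sigma>)" "infer E H = Some (H_ty \<tau> \<sigma>)"
  shows "HA E \<Gamma> (Eq (Nat \<rightarrow> Star \<tau> \<rightarrow> \<sigma>) (phi \<tau> \<sigma> \<cdot> G \<cdot> H)
    (Rec (Star \<tau> \<rightarrow> \<sigma>) \<cdot> G \<cdot>
      Lam Nat (Lam (Star \<tau> \<rightarrow> \<sigma>) (Lam (Star \<tau>)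
        (lift (lift (lift H 0) 0) 0 \<cdot> Var 0 \<cdot> Lam \<tau> (Var 2 \<cdot> (Snoc \<tau> \<cdot> Var 1 \<cdot> Var 0)))))))"
  using Eq_reds[of E "phi \<tau> \<sigma> \<cdot> G \<cdot> H" "Nat \<rightarrow> Star \<tau> \<rightarrow> \<sigma>" \<Gamma> "Suc (Suc 0)"] assms
  by (simp add: phi_def)

lemma phi_Zero:
  assumes "infer E G = Some (G_ty \<tau> \<sigma>)" "infer E H = Some (H_ty \<tau> \<sigma>)"
  shows "HA E \<Gamma> (Eq (Star \<tau> \<rightarrow> \<sigma>) (phi \<tau> \<sigma> \<cdot> G \<cdot> H \<cdot> Zero) G)"
  by (rule Eq_trans[OF Eq_fun[OF phi_unfold] Rec_Zero]) (use assms in auto)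

text \<open>The argument given to \<open>H(s)\<close> in the equation of a bar recursor. Naming it
  lets one simplifier rule carry lifts and substitutions through the abstraction.\<close>

definition below :: "ty \<Rightarrow> tm \<Rightarrow> tm \<Rightarrow> tm \<Rightarrow> tm \<Rightarrow> tm" where
  "below \<tau> B G H s = Lam \<tau> (lift B 0 \<cdot> lift G 0 \<cdot> lift H 0 \<cdot> (Snoc \<tau> \<cdot> lift s 0 \<cdot> Var 0))"

lemma lift_below [simp]:
  "lift (below \<tau> B G H s) k = below \<tau> (lift B k) (lift G k) (lift H k) (lift s k)"
  by (simp add: below_def)

lemma subst_below [simp]:
  "subst (below \<tau> B G H s) t k = below \<tau> (subst B t k) (subst G t k) (subst H t k) (subst s t k)"
  by (simp add: below_def subst_lift_0)

lemma infer_below [simp]: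
  assumes "infer E B = Some (BR_ty \<tau> \<sigma>)" "infer E G = Some (G_ty \<tau> \<sigma>)" "infer E H = Some (H_ty \<tau> \<sigma>)"
    "infer E s = Some (Star \<tau>)"
  shows "infer E (below \<tau> B G H s) = Some (\<tau> \<rightarrow> \<sigma>)"
  using assms by (simp add: below_def)

lemma phi_Succ:
  assumes "infer E G = Some (G_ty \<tau> \<sigma>)" "infer E H = Some (H_ty \<tau> \<sigma>)" "infer E s = Some (Star \<tau>)"
    "infer E n = Some Nat"
  shows "HA E \<Gamma> (Eq \<sigma> (phi \<tau> \<sigma> \<cdot> G \<cdot> H \<cdot> (Succ \<cdot> n) \<cdot> s)
    (H \<cdot> s \<cdot> Lam \<tau> (phi \<tau> \<sigma> \<cdot> lift G 0 \<cdot> lift H 0 \<cdot> lift n 0 \<cdot> (Snoc \<tau> \<cdot> lift s 0 \<cdot> Var 0))))"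
proof -
  let ?f = "\<lambda>H. Lam Nat (Lam (Star \<tau> \<rightarrow> \<sigma>) (Lam (Star \<tau>)
        (lift (lift (lift H 0) 0) 0 \<cdot> Var 0 \<cdot> Lam \<tau> (Var 2 \<cdot> (Snoc \<tau> \<cdot> Var 1 \<cdot> Var 0)))))"
  let ?R = "Rec (Star \<tau> \<rightarrow> \<sigma>) \<cdot> G \<cdot> ?f H \<cdot> n"
  have "HA E \<Gamma> (Eq \<sigma> (phi \<tau> \<sigma> \<cdot> G \<cdot> H \<cdot> (Succ \<cdot> n) \<cdot> s) (Rec (Star \<tau> \<rightarrow> \<sigma>) \<cdot> G \<cdot> ?f H \<cdot> (Succ \<cdot> n) \<cdot> s))"
    by (rule Eq_fun[OF Eq_fun[OF phi_unfold]]) (use assms in auto)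
  also have "HA E \<Gamma> (Eq \<sigma> (Rec (Star \<tau> \<rightarrow> \<sigma>) \<cdot> G \<cdot> ?f H \<cdot> (Succ \<cdot> n) \<cdot> s) (?f H \<cdot> n \<cdot> ?R \<cdot> s))"
    by (rule Eq_fun[OF Rec_Succ]) (use assms in auto)
  also have "HA E \<Gamma> (Eq \<sigma> (?f H \<cdot> n \<cdot> ?R \<cdot> s) (H \<cdot> s \<cdot> Lam \<tau> (lift ?R 0 \<cdot> (Snoc \<tau> \<cdot> lift s 0 \<cdot> Var 0))))"
    using Eq_reds[of E "?f H \<cdot> n \<cdot> ?R \<cdot> s" \<sigma> \<Gamma> "Suc (Suc (Suc 0))"] assms by (simp add: eval_nat_numeral)
  also have "HA E \<Gamma> (Eq \<sigma> (H \<cdot> s \<cdot> Lam \<tau> (lift ?R 0 \<cdot> (Snoc \<tau> \<cdot> lift s 0 \<cdot> Var 0)))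
    (H \<cdot> s \<cdot> Lam \<tau> (phi \<tau> \<sigma> \<cdot> lift G 0 \<cdot> lift H 0 \<cdot> lift n 0 \<cdot> (Snoc \<tau> \<cdot> lift s 0 \<cdot> Var 0))))"
  \<comment> \<open>Reduction leaves the unfolded recursor under the abstraction; it is folded back
    to \<open>phi\<close> there.\<close>
  proof (rule Eq_arg[OF Eq_Lam])
    have "HA (\<tau> # E) (lift_fms \<Gamma>) (Eq \<sigma>
       (phi \<tau> \<sigma> \<cdot> lift G 0 \<cdot> lift H 0 \<cdot> lift n 0 \<cdot> (Snoc \<tau> \<cdot> lift s 0 \<cdot> Var 0))
       (Rec (Star \<tau> \<rightarrow> \<sigma>) \<cdot> lift G 0 \<cdot> ?f (lift H 0) \<cdot> lift n 0 \<cdot> (Snoc \<tau> \<cdot> lift s 0 \<cdot> Var 0)))"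
      by (rule Eq_fun[OF Eq_fun[OF phi_unfold]]) (use assms in auto)
    from Eq_sym[OF this] show "HA (\<tau> # E) (lift_fms \<Gamma>) (Eq \<sigma> (lift ?R 0 \<cdot> (Snoc \<tau> \<cdot> lift s 0 \<cdot> Var 0))
       (phi \<tau> \<sigma> \<cdot> lift G 0 \<cdot> lift H 0 \<cdot> lift n 0 \<cdot> (Snoc \<tau> \<cdot> lift s 0 \<cdot> Var 0)))"
      by simp
  qed (use assms in auto)
  finally show ?thesis .
qed

lemma Psi_unfold:
  assumes "infer E k = Some Nat" "infer E G = Some (G_ty \<tau> \<sigma>)" "infer E H = Some (H_ty \<tau> \<sigma>)"
    "infer E s = Some (Star \<tau>)"
  shows "HA E \<Gamma> (Eq \<sigma> (Psi \<tau> \<sigma> \<cdot> k \<cdot> G \<cdot> H \<cdot> s)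
    (IfLess \<sigma> \<cdot> k \<cdot> (Len \<tau> \<cdot> s) \<cdot> (G \<cdot> s) \<cdot>
      (phi \<tau> \<sigma> \<cdot> G \<cdot> H \<cdot> (Monus \<cdot> (Succ \<cdot> k) \<cdot> (Len \<tau> \<cdot> s)) \<cdot> s)))"
  using Eq_reds[of E "Psi \<tau> \<sigma> \<cdot> k \<cdot> G \<cdot> H \<cdot> s" \<sigma> \<Gamma> "Suc (Suc (Suc (Suc 0)))"] assms
  by (simp add: Psi_def eval_nat_numeral)

lemma Psi_lt:
  assumes "HA E \<Gamma> (lt k (Len \<tau> \<cdot> s))"
    "infer E k = Some Nat" "infer E G = Some (G_ty \<tau> \<sigma>)" "infer E H = Some (H_ty \<tau> \<sigma>)"
    "infer E s = Some (Star \<tau>)"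
  shows "HA E \<Gamma> (Eq \<sigma> (Psi \<tau> \<sigma> \<cdot> k \<cdot> G \<cdot> H \<cdot> s) (G \<cdot> s))"
  by (rule Eq_trans[OF Psi_unfold IfLess_lt]) (use assms in auto)

text \<open>The case distinction in \<open>Psi\<close> is redundant, as \<open>\<phi>(G,H)(0) = G\<close>.\<close>

lemma Psi_phi:
  assumes "infer E k = Some Nat" "infer E G = Some (G_ty \<tau> \<sigma>)" "infer E H = Some (H_ty \<tau> \<sigma>)"
    "infer E s = Some (Star \<tau>)"
  shows "HA E \<Gamma> (Eq \<sigma> (Psi \<tau> \<sigma> \<cdot> k \<cdot> G \<cdot> H \<cdot> s)
      (phi \<tau> \<sigma> \<cdot> G \<cdot> H \<cdot> (Monus \<cdot> (Succ \<cdot> k) \<cdot> (Len \<tau> \<cdot> s)) \<cdot> s))"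
proof (rule HA.OrE[OF Eq_Zero_dec[of E "Monus \<cdot> (Len \<tau> \<cdot> s) \<cdot> k"]])
  let ?\<Gamma> = "ge k (Len \<tau> \<cdot> s) # \<Gamma>"
  have "HA E ?\<Gamma> (ge k (Len \<tau> \<cdot> s))" by (rule Hyp0) (use assms in auto)
  then show "HA E ?\<Gamma> (Eq \<sigma> (Psi \<tau> \<sigma> \<cdot> k \<cdot> G \<cdot> H \<cdot> s)
      (phi \<tau> \<sigma> \<cdot> G \<cdot> H \<cdot> (Monus \<cdot> (Succ \<cdot> k) \<cdot> (Len \<tau> \<cdot> s)) \<cdot> s))"
    by (intro Eq_trans[OF Psi_unfold IfLess_ge]) (use assms in auto)
next
  let ?\<Gamma> = "lt k (Len \<tau> \<cdot> s) # \<Gamma>"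
  have lt: "HA E ?\<Gamma> (lt k (Len \<tau> \<cdot> s))" by (rule Hyp0) (use assms in auto)
  have "HA E ?\<Gamma> (Eq \<sigma> (phi \<tau> \<sigma> \<cdot> G \<cdot> H \<cdot> (Monus \<cdot> (Succ \<cdot> k) \<cdot> (Len \<tau> \<cdot> s)) \<cdot> s)
      (phi \<tau> \<sigma> \<cdot> G \<cdot> H \<cdot> Zero \<cdot> s))"
    by (rule Eq_fun[OF Eq_arg[OF lt_imp_Monus[OF lt]]]) (use assms in auto)
  also have "HA E ?\<Gamma> (Eq \<sigma> (phi \<tau> \<sigma> \<cdot> G \<cdot> H \<cdot> Zero \<cdot> s) (G \<cdot> s))"
    by (rule Eq_fun[OF phi_Zero]) (use assms in auto)
  finally show "HA E ?\<Gamma> (Eq \<sigma> (Psi \<tau> \<sigma> \<cdot> k \<cdot> G \<cdot> H \<cdot> s)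
      (phi \<tau> \<sigma> \<cdot> G \<cdot> H \<cdot> (Monus \<cdot> (Succ \<cdot> k) \<cdot> (Len \<tau> \<cdot> s)) \<cdot> s))"
    by (intro Eq_trans[OF Psi_lt[OF lt] Eq_sym]) (use assms in auto)
qed (use assms in auto)

text \<open>At \<open>s*x\<close> it is open whether the length exceeds \<open>k\<close>, and
  \<open>Psi_phi\<close> avoids deciding this under the abstraction. The step count at
  \<open>s*x\<close> is \<open>(k + 1) - (|s| + 1) = k - |s|\<close>, exactly what
  \<open>phi\<close> has left after one step at \<open>s\<close>.\<close>

lemma Psi_ge:
  assumes "HA E \<Gamma> (ge k (Len \<tau> \<cdot> s))"
    "infer E k = Some Nat" "infer E G = Some (G_ty \<tau> \<sigma>)" "infer E H = Some (H_ty \<tau> \<sigma>)"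
    "infer E s = Some (Star \<tau>)"
  shows "HA E \<Gamma> (Eq \<sigma> (Psi \<tau> \<sigma> \<cdot> k \<cdot> G \<cdot> H \<cdot> s) (H \<cdot> s \<cdot> below \<tau> (Psi \<tau> \<sigma> \<cdot> k) G H s))"
proof -
  let ?d = "Monus \<cdot> k \<cdot> (Len \<tau> \<cdot> s)"
  let ?L = "\<lambda>d. Lam \<tau> (phi \<tau> \<sigma> \<cdot> lift G 0 \<cdot> lift H 0 \<cdot> d \<cdot> (Snoc \<tau> \<cdot> lift s 0 \<cdot> Var 0))"
  have "HA E \<Gamma> (Eq \<sigma> (Psi \<tau> \<sigma> \<cdot> k \<cdot> G \<cdot> H \<cdot> s)
      (phi \<tau> \<sigma> \<cdot> G \<cdot> H \<cdot> (Monus \<cdot> (Succ \<cdot> k) \<cdot> (Len \<tau> \<cdot> s)) \<cdot> s))"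
    by (rule Psi_phi) (use assms in auto)
  also have "HA E \<Gamma> (Eq \<sigma> (phi \<tau> \<sigma> \<cdot> G \<cdot> H \<cdot> (Monus \<cdot> (Succ \<cdot> k) \<cdot> (Len \<tau> \<cdot> s)) \<cdot> s)
     (phi \<tau> \<sigma> \<cdot> G \<cdot> H \<cdot> (Succ \<cdot> ?d) \<cdot> s))"
    by (rule Eq_fun[OF Eq_arg[OF ge_imp_Monus]]) (use assms in auto)
  also have "HA E \<Gamma> (Eq \<sigma> (phi \<tau> \<sigma> \<cdot> G \<cdot> H \<cdot> (Succ \<cdot> ?d) \<cdot> s) (H \<cdot> s \<cdot> ?L (lift ?d 0)))"
    by (rule phi_Succ) (use assms in auto)
  also have "HA E \<Gamma> (Eq \<sigma> (H \<cdot> s \<cdot> ?L (lift ?d 0)) (H \<cdot> s \<cdot> below \<tau> (Psi \<tau> \<sigma> \<cdot> k) G H s))"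
    unfolding below_def
  proof (rule Eq_arg[OF Eq_Lam])
    let ?E = "\<tau> # E" and ?\<Gamma> = "lift_fms \<Gamma>" and ?s = "Snoc \<tau> \<cdot> lift s 0 \<cdot> Var 0"
      and ?k = "lift k 0" and ?G = "lift G 0" and ?H = "lift H 0"
    have "HA ?E ?\<Gamma> (Eq \<sigma> (Psi \<tau> \<sigma> \<cdot> ?k \<cdot> ?G \<cdot> ?H \<cdot> ?s)
      (phi \<tau> \<sigma> \<cdot> ?G \<cdot> ?H \<cdot> (Monus \<cdot> (Succ \<cdot> ?k) \<cdot> (Len \<tau> \<cdot> ?s)) \<cdot> ?s))"
      by (rule Psi_phi) (use assms in auto)
    also have "HA ?E ?\<Gamma> (Eq \<sigma> (phi \<tau> \<sigma> \<cdot> ?G \<cdot> ?H \<cdot> (Monus \<cdot> (Succ \<cdot> ?k) \<cdot> (Len \<tau> \<cdot> ?s)) \<cdot> ?s)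
       (phi \<tau> \<sigma> \<cdot> ?G \<cdot> ?H \<cdot> (Monus \<cdot> (Succ \<cdot> ?k) \<cdot> (Succ \<cdot> (Len \<tau> \<cdot> lift s 0))) \<cdot> ?s))"
      by (rule Eq_fun[OF Eq_arg[OF Eq_arg[OF Len_Snoc]]]) (use assms in auto)
    also have "HA ?E ?\<Gamma> (Eq \<sigma>
       (phi \<tau> \<sigma> \<cdot> ?G \<cdot> ?H \<cdot> (Monus \<cdot> (Succ \<cdot> ?k) \<cdot> (Succ \<cdot> (Len \<tau> \<cdot> lift s 0))) \<cdot> ?s)
       (phi \<tau> \<sigma> \<cdot> ?G \<cdot> ?H \<cdot> (Monus \<cdot> ?k \<cdot> (Len \<tau> \<cdot> lift s 0)) \<cdot> ?s))"
      by (rule Eq_fun[OF Eq_arg[OF Monus_Succ_Succ]]) (use assms in auto)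
    finally show "HA ?E ?\<Gamma> (Eq \<sigma> (phi \<tau> \<sigma> \<cdot> ?G \<cdot> ?H \<cdot> lift ?d 0 \<cdot> ?s)
      (lift (Psi \<tau> \<sigma> \<cdot> k) 0 \<cdot> ?G \<cdot> ?H \<cdot> ?s))"
      by (simp add: Eq_sym)
  qed (use assms in auto)
  finally show ?thesis .
qed


section \<open>Regular pairs\<close>

text \<open>This says that \<open>s\<close> is an initial segment of the function \<open>b\<close>.
  The entries of a sequence are accessible only through \<open>Hat\<close>.\<close>

definition agree :: "tm \<Rightarrow> tm \<Rightarrow> fm" where
  "agree s b = All Nat (Imp (lt (Var 0) (Len Nat \<cdot> lift s 0)) (Eq Nat (lift b 0 \<cdot> Var 0) (Hat Nat \<cdot> lift s 0 \<cdot> Var 0)))"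

text \<open>The first conjunct says that \<open>|s| \<le> |s'|\<close>.\<close>

definition extends :: "tm \<Rightarrow> tm \<Rightarrow> fm" where
  "extends s s' = And
    (All Nat (Imp (lt (Var 0) (Len Nat \<cdot> lift s 0)) (lt (Var 0) (Len Nat \<cdot> lift s' 0))))
    (agree s (Hat Nat \<cdot> s'))"

text \<open>Both conjuncts speak about everything above \<open>s\<close>, because the equation of a
  bar recursor at \<open>s\<close> also involves its values at \<open>s*x\<close>. Stopping is
  demanded for all \<open>G\<close> and \<open>H\<close>, since bind and \<open>Phi\<close> run
  \<open>B\<close> on functionals other than the given ones.\<close>

definition secured :: "ty \<Rightarrow> tm \<Rightarrow> tm \<Rightarrow> tm \<Rightarrow> fm" where
  "secured \<sigma> V B s = And
    (All (Star Nat) (Imp (extends (lift s 0) (Var 0)) (All (G_ty Nat \<sigma>) (All (H_ty Nat \<sigma>)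
      (Eq \<sigma> (lift (lift (lift B 0) 0) 0 \<cdot> Var 1 \<cdot> Var 0 \<cdot> Var 2) (Var 1 \<cdot> Var 2))))))
    (All (Nat \<rightarrow> Nat) (Imp (agree (lift s 0) (Var 0))
      (Eq Nat (lift V 0 \<cdot> Var 0) (lift V 0 \<cdot> (Hat Nat \<cdot> lift s 0)))))"

definition recurs :: "ty \<Rightarrow> tm \<Rightarrow> tm \<Rightarrow> fm" where
  "recurs \<sigma> B s = All (G_ty Nat \<sigma>) (All (H_ty Nat \<sigma>)
    (Eq \<sigma> (lift (lift B 0) 0 \<cdot> Var 1 \<cdot> Var 0 \<cdot> lift (lift s 0) 0)
      (Var 0 \<cdot> lift (lift s 0) 0 \<cdot> below Nat (lift (lift B 0) 0) (Var 1) (Var 0) (lift (lift s 0) 0))))"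

text \<open>
  \<open>B\<close> is a general bar recursor for a bar that secures \<open>V\<close>. The bar is not an extra parameter: it
  consists of the sequences from which on \<open>B\<close> stops and \<open>V\<close> is constant. So no choice is needed
  when a family of regular pairs is combined in \<open>regular_bind\<close>.
\<close>

definition regular :: "ty \<Rightarrow> tm \<Rightarrow> tm \<Rightarrow> fm" where
  "regular \<sigma> V B = All (Star Nat) (Or (secured \<sigma> (lift V 0) (lift B 0) (Var 0)) (recurs \<sigma> (lift B 0) (Var 0)))"

lemma lift_agree [simp]: "lift_fm (agree s b) k = agree (lift s k) (lift b k)"
  by (simp add: agree_def)

lemma subst_agree [simp]: "subst_fm (agree s b) t k = agree (subst s t k) (subst b t k)"
  by (simp add: agree_def subst_lift_0)

lemma wf_agree [simp]:
  "infer E s = Some (Star Nat) \<Longrightarrow> infer E b = Some (Nat \<rightarrow> Nat) \<Longrightarrow> wf_fm E (agree s b)"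
  by (simp add: agree_def)

lemma lift_extends [simp]: "lift_fm (extends s b) k = extends (lift s k) (lift b k)"
  by (simp add: extends_def)

lemma subst_extends [simp]: "subst_fm (extends s b) t k = extends (subst s t k) (subst b t k)"
  by (simp add: extends_def subst_lift_0)

lemma wf_extends [simp]:
  "infer E s = Some (Star Nat) \<Longrightarrow> infer E s' = Some (Star Nat) \<Longrightarrow> wf_fm E (extends s s')"
  by (simp add: extends_def)

lemma lift_secured [simp]: "lift_fm (secured \<sigma> V B s) k = secured \<sigma> (lift V k) (lift B k) (lift s k)"
  by (simp add: secured_def)

lemma subst_secured [simp]:
  "subst_fm (secured \<sigma> V B s) t k = secured \<sigma> (subst V t k) (subst B t k) (subst s t k)"
  by (simp add: secured_def subst_lift_0)

lemma wf_secured [simp]: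
  "infer E V = Some (Val_ty Nat) \<Longrightarrow> infer E B = Some (BR_ty Nat \<sigma>) \<Longrightarrow> infer E s = Some (Star Nat) \<Longrightarrow>
    wf_fm E (secured \<sigma> V B s)"
  by (simp add: secured_def)

lemma lift_recurs [simp]: "lift_fm (recurs \<sigma> B s) k = recurs \<sigma> (lift B k) (lift s k)"
  by (simp add: recurs_def)

lemma subst_recurs [simp]: "subst_fm (recurs \<sigma> B s) t k = recurs \<sigma> (subst B t k) (subst s t k)"
  by (simp add: recurs_def subst_lift_0)

lemma wf_recurs [simp]:
  "infer E B = Some (BR_ty Nat \<sigma>) \<Longrightarrow> infer E s = Some (Star Nat) \<Longrightarrow> wf_fm E (recurs \<sigma> B s)"
  by (simp add: recurs_def)

lemma lift_regular [simp]: "lift_fm (regular \<sigma> V B) k = regular \<sigma> (lift V k) (lift B k)"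
  by (simp add: regular_def)

lemma subst_regular [simp]: "subst_fm (regular \<sigma> V B) t k = regular \<sigma> (subst V t k) (subst B t k)"
  by (simp add: regular_def subst_lift_0)

lemma wf_regular [simp]:
  "infer E V = Some (Val_ty Nat) \<Longrightarrow> infer E B = Some (BR_ty Nat \<sigma>) \<Longrightarrow> wf_fm E (regular \<sigma> V B)"
  by (simp add: regular_def)

section \<open>Use of the notions, and extension by one element\<close>

lemma agree_elim:
  assumes "HA E \<Gamma> (agree s b)" "HA E \<Gamma> (lt k (Len Nat \<cdot> s))" "infer E k = Some Nat"
  shows "HA E \<Gamma> (Eq Nat (b \<cdot> k) (Hat Nat \<cdot> s \<cdot> k))"
  using HA.ImpE[OF _ assms(2)] HA.AllE[OF assms(1)[unfolded agree_def], of k] assms(3) by simp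

lemma agree_refl:
  assumes "infer E s = Some (Star Nat)" shows "HA E \<Gamma> (agree s (Hat Nat \<cdot> s))"
  unfolding agree_def by (intro HA.AllI HA.ImpI) (auto intro!: Eq_refl simp: assms)

lemma extends_agree: "HA E \<Gamma> (extends s s') \<Longrightarrow> HA E \<Gamma> (agree s (Hat Nat \<cdot> s'))"
  unfolding extends_def by (rule HA.AndE2)

lemma extends_lt:
  assumes "HA E \<Gamma> (extends s s')" "HA E \<Gamma> (lt k (Len Nat \<cdot> s))" "infer E k = Some Nat"
  shows "HA E \<Gamma> (lt k (Len Nat \<cdot> s'))"
  using HA.ImpE[OF _ assms(2)] HA.AllE[OF HA.AndE1[OF assms(1)[unfolded extends_def]], of k] assms(3) by simp

lemma extends_refl:
  assumes "infer E s = Some (Star Nat)" shows "HA E \<Gamma> (extends s s)"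
  unfolding extends_def
  by (intro HA.AndI agree_refl HA.AllI HA.ImpI[OF Hyp0]) (auto simp: assms)

lemma extends_Snoc:
  assumes "infer E s = Some (Star Nat)" "infer E x = Some Nat"
  shows "HA E \<Gamma> (extends s (Snoc Nat \<cdot> s \<cdot> x))"
  unfolding extends_def agree_def
proof (intro HA.AndI HA.AllI HA.ImpI)
  let ?E = "Nat # E" and ?l = "Len Nat \<cdot> lift s 0"
  let ?\<Gamma> = "lt (Var 0) ?l # lift_fms \<Gamma>"
  let ?sx = "Snoc Nat \<cdot> lift s 0 \<cdot> lift x 0"
  have lt: "HA ?E ?\<Gamma> (lt (Var 0) ?l)" by (rule Hyp0) (use assms in auto)
  have "HA ?E ?\<Gamma> (Eq Nat (Monus \<cdot> (Succ \<cdot> ?l) \<cdot> Var 0) (Monus \<cdot> (Len Nat \<cdot> ?sx) \<cdot> Var 0))"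
    by (rule Eq_fun[OF Eq_arg[OF Eq_sym[OF Len_Snoc]]]) (use assms in auto)
  moreover have "HA ?E ?\<Gamma> (lt (Var 0) (Succ \<cdot> ?l))"
    by (rule lt_Succ[OF lt]) (use assms in auto)
  ultimately have "HA ?E ?\<Gamma> (lt (Var 0) (Len Nat \<cdot> ?sx))"
    by (rule Eq_Neg)
  from HA.ImpE[OF HA_weaken_Cons[OF this] Hyp0] assms
  show "HA ?E (ge (Var 0) (Len Nat \<cdot> lift (Snoc Nat \<cdot> s \<cdot> x) 0) # ?\<Gamma>) Bot" by simp
  \<comment> \<open>An index below \<open>|s|\<close> differs from \<open>|s|\<close>, since
    \<open>|s| - |s|\<close> vanishes; hence appending an element leaves the entry there
    unchanged.\<close>
  have "HA ?E ?\<Gamma> (Imp (Eq Nat (Var 0) ?l) Bot)"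
  proof (rule HA.ImpI)
    let ?\<Delta> = "Eq Nat (Var 0) ?l # ?\<Gamma>"
    have "HA ?E ?\<Delta> (Eq Nat (Monus \<cdot> ?l \<cdot> Var 0) (Monus \<cdot> ?l \<cdot> ?l))"
      by (rule Eq_arg[OF Hyp0]) (use assms in auto)
    also have "HA ?E ?\<Delta> (Eq Nat (Monus \<cdot> ?l \<cdot> ?l) Zero)" by (rule Monus_self) (use assms in auto)
    finally show "HA ?E ?\<Delta> Bot" by (rule HA.ImpE[OF HA_weaken_Cons[OF lt]])
  qed (use assms in auto)
  from HA.HatSnocOther[OF this] assms
  show "HA ?E ?\<Gamma> (Eq Nat (lift (Hat Nat \<cdot> (Snoc Nat \<cdot> s \<cdot> x)) 0 \<cdot> Var 0) (Hat Nat \<cdot> lift s 0 \<cdot> Var 0))"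
    by simp
qed (use assms in auto)

lemma secured_stop:
  assumes "HA E \<Gamma> (secured \<sigma> V B s)" "HA E \<Gamma> (extends s s')"
    "infer E s' = Some (Star Nat)" "infer E G = Some (G_ty Nat \<sigma>)" "infer E H = Some (H_ty Nat \<sigma>)"
  shows "HA E \<Gamma> (Eq \<sigma> (B \<cdot> G \<cdot> H \<cdot> s') (G \<cdot> s'))"
proof -
  have "HA E \<Gamma> (All (G_ty Nat \<sigma>) (All (H_ty Nat \<sigma>)
      (Eq \<sigma> (lift (lift B 0) 0 \<cdot> Var 1 \<cdot> Var 0 \<cdot> lift (lift s' 0) 0) (Var 1 \<cdot> lift (lift s' 0) 0))))"
    using HA.ImpE[OF _ assms(2)] HA.AllE[OF HA.AndE1[OF assms(1)[unfolded secured_def]], of s'] assms(3)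
    by (simp add: eval_nat_numeral)
  from HA.AllE[OF this, of G] assms
  have "HA E \<Gamma> (All (H_ty Nat \<sigma>)
      (Eq \<sigma> (lift B 0 \<cdot> lift G 0 \<cdot> Var 0 \<cdot> lift s' 0) (lift G 0 \<cdot> lift s' 0)))"
    by simp
  from HA.AllE[OF this, of H] assms show ?thesis by simp
qed

lemma secured_const:
  assumes "HA E \<Gamma> (secured \<sigma> V B s)" "HA E \<Gamma> (agree s b)" "infer E b = Some (Nat \<rightarrow> Nat)"
  shows "HA E \<Gamma> (Eq Nat (V \<cdot> b) (V \<cdot> (Hat Nat \<cdot> s)))"
  using HA.ImpE[OF _ assms(2)] HA.AllE[OF HA.AndE2[OF assms(1)[unfolded secured_def]], of b] assms(3) by simp

lemma recurs_elim:
  assumes "HA E \<Gamma> (recurs \<sigma> B s)" "infer E G = Some (G_ty Nat \<sigma>)" "infer E H = Some (H_ty Nat \<sigma>)"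
  shows "HA E \<Gamma> (Eq \<sigma> (B \<cdot> G \<cdot> H \<cdot> s) (H \<cdot> s \<cdot> below Nat B G H s))"
proof -
  from HA.AllE[OF assms(1)[unfolded recurs_def], of G] assms
  have "HA E \<Gamma> (All (H_ty Nat \<sigma>)
      (Eq \<sigma> (lift B 0 \<cdot> lift G 0 \<cdot> Var 0 \<cdot> lift s 0)
      (Var 0 \<cdot> lift s 0 \<cdot> below Nat (lift B 0) (lift G 0) (Var 0) (lift s 0))))"
    by simp
  from HA.AllE[OF this, of H] assms show ?thesis by simp
qed

lemma regular_elim:
  assumes "HA E \<Gamma> (regular \<sigma> V B)" "infer E s = Some (Star Nat)"
  shows "HA E \<Gamma> (Or (secured \<sigma> V B s) (recurs \<sigma> B s))"
  using HA.AllE[OF assms(1)[unfolded regular_def], of s] assms(2) by simp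

lemma regular_cong:
  assumes "HA E \<Gamma> (regular \<sigma> V B)" "HA E \<Gamma> (Eq (Val_ty Nat) V V')" "HA E \<Gamma> (Eq (BR_ty Nat \<sigma>) B B')"
  shows "HA E \<Gamma> (regular \<sigma> V' B')"
proof -
  note ty = HA_typed[OF assms(2)] HA_typed[OF assms(3)]
  have "HA E \<Gamma> (regular \<sigma> V' B)"
    using HA.Subst[OF assms(2), of "regular \<sigma> (Var 0) (lift B 0)"] assms(1) ty by simp
  then show ?thesis
    using HA.Subst[OF assms(3), of "regular \<sigma> (lift V' 0) (Var 0)"] ty by simp
qed

lemma securedI:
  assumes "HA (H_ty Nat \<sigma> # G_ty Nat \<sigma> # Star Nat # E)
      (lift_fms (lift_fms (extends (lift s 0) (Var 0) # lift_fms \<Gamma>)))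
      (Eq \<sigma> (lift (lift (lift B 0) 0) 0 \<cdot> Var 1 \<cdot> Var 0 \<cdot> Var 2) (Var 1 \<cdot> Var 2))"
    "HA ((Nat \<rightarrow> Nat) # E) (agree (lift s 0) (Var 0) # lift_fms \<Gamma>)
      (Eq Nat (lift V 0 \<cdot> Var 0) (lift V 0 \<cdot> (Hat Nat \<cdot> lift s 0)))"
    "infer E s = Some (Star Nat)"
  shows "HA E \<Gamma> (secured \<sigma> V B s)"
  unfolding secured_def
  by (intro HA.AndI HA.AllI HA.ImpI) (use assms in auto)

text \<open>Regular pairs compose: first compute \<open>n\<close> by \<open>V\<close>, then proceed with the \<open>n\<close>-th pair.\<close>

definition bind_val :: "tm \<Rightarrow> tm \<Rightarrow> tm" where
  "bind_val V KV = Lam (Nat \<rightarrow> Nat) (lift KV 0 \<cdot> (lift V 0 \<cdot> Var 0) \<cdot> Var 0)"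

text \<open>Where \<open>B\<close> stops, the recursion continues with the recursor selected by the
  value of \<open>V\<close>. With \<open>Psi\<close> for \<open>KB\<close>, this is the first
  argument that \<open>Phi\<close> passes on.\<close>

definition bind_stop :: "tm \<Rightarrow> tm \<Rightarrow> tm \<Rightarrow> tm \<Rightarrow> tm" where
  "bind_stop V KB G H =
    Lam (Star Nat) (lift KB 0 \<cdot> (lift V 0 \<cdot> (Hat Nat \<cdot> Var 0)) \<cdot> lift G 0 \<cdot> lift H 0 \<cdot> Var 0)"

definition bind_rec :: "ty \<Rightarrow> tm \<Rightarrow> tm \<Rightarrow> tm \<Rightarrow> tm" where
  "bind_rec \<sigma> V B KB = Lam (G_ty Nat \<sigma>) (Lam (H_ty Nat \<sigma>) (Lam (Star Nat)
    (lift (lift (lift B 0) 0) 0 \<cdot>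
      bind_stop (lift (lift (lift V 0) 0) 0) (lift (lift (lift KB 0) 0) 0) (Var 2) (Var 1) \<cdot>
      Var 1 \<cdot> Var 0)))"

lemma lift_bind_stop [simp]:
  "lift (bind_stop V KB G H) k = bind_stop (lift V k) (lift KB k) (lift G k) (lift H k)"
  by (simp add: bind_stop_def)

lemma subst_bind_stop [simp]:
  "subst (bind_stop V KB G H) t k = bind_stop (subst V t k) (subst KB t k) (subst G t k) (subst H t k)"
  by (simp add: bind_stop_def subst_lift_0)

lemma lift_bind_val [simp]: "lift (bind_val V KV) k = bind_val (lift V k) (lift KV k)"
  by (simp add: bind_val_def)

lemma lift_bind_rec [simp]: "lift (bind_rec \<sigma> V B KB) k = bind_rec \<sigma> (lift V k) (lift B k) (lift KB k)"
  by (simp add: bind_rec_def)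

lemma infer_bind_stop [simp]:
  "infer E V = Some (Val_ty Nat) \<Longrightarrow> infer E KB = Some (Nat \<rightarrow> BR_ty Nat \<sigma>) \<Longrightarrow>
   infer E G = Some (G_ty Nat \<sigma>) \<Longrightarrow> infer E H = Some (H_ty Nat \<sigma>) \<Longrightarrow>
   infer E (bind_stop V KB G H) = Some (G_ty Nat \<sigma>)"
  by (simp add: bind_stop_def)

lemma infer_bind_val [simp]:
  "infer E V = Some (Val_ty Nat) \<Longrightarrow> infer E KV = Some (Nat \<rightarrow> Val_ty Nat) \<Longrightarrow>
   infer E (bind_val V KV) = Some (Val_ty Nat)"
  by (simp add: bind_val_def)

lemma infer_bind_rec [simp]:
  "infer E V = Some (Val_ty Nat) \<Longrightarrow> infer E B = Some (BR_ty Nat \<sigma>) \<Longrightarrow>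
   infer E KB = Some (Nat \<rightarrow> BR_ty Nat \<sigma>) \<Longrightarrow>
   infer E (bind_rec \<sigma> V B KB) = Some (BR_ty Nat \<sigma>)"
  \<comment> \<open>The result type does not occur in the term \<open>bind_stop\<close>, so
    \<open>\<sigma>\<close> is supplied to make the rule usable for rewriting.\<close>
  by (simp add: bind_rec_def infer_bind_stop[of _ _ _ \<sigma>])

lemma bind_val_eq:
  assumes "infer E V = Some (Val_ty Nat)" "infer E KV = Some (Nat \<rightarrow> Val_ty Nat)" "infer E b = Some (Nat \<rightarrow> Nat)"
  shows "HA E \<Gamma> (Eq Nat (bind_val V KV \<cdot> b) (KV \<cdot> (V \<cdot> b) \<cdot> b))"
  using Eq_reds[of E "bind_val V KV \<cdot> b" Nat \<Gamma> "Suc 0"] assms by (simp add: bind_val_def)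

lemma bind_stop_eq:
  assumes "infer E V = Some (Val_ty Nat)" "infer E KB = Some (Nat \<rightarrow> BR_ty Nat \<sigma>)"
   "infer E G = Some (G_ty Nat \<sigma>)" "infer E H = Some (H_ty Nat \<sigma>)" "infer E s = Some (Star Nat)"
  shows "HA E \<Gamma> (Eq \<sigma> (bind_stop V KB G H \<cdot> s) (KB \<cdot> (V \<cdot> (Hat Nat \<cdot> s)) \<cdot> G \<cdot> H \<cdot> s))"
  using Eq_reds[of E "bind_stop V KB G H \<cdot> s" \<sigma> \<Gamma> "Suc 0"] assms by (simp add: bind_stop_def)

lemma bind_rec_eq:
  assumes "infer E V = Some (Val_ty Nat)" "infer E B = Some (BR_ty Nat \<sigma>)" "infer E KB = Some (Nat \<rightarrow> BR_ty Nat \<sigma>)"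
   "infer E G = Some (G_ty Nat \<sigma>)" "infer E H = Some (H_ty Nat \<sigma>)" "infer E s = Some (Star Nat)"
  shows "HA E \<Gamma> (Eq \<sigma> (bind_rec \<sigma> V B KB \<cdot> G \<cdot> H \<cdot> s) (B \<cdot> bind_stop V KB G H \<cdot> H \<cdot> s))"
  using Eq_reds[of E "bind_rec \<sigma> V B KB \<cdot> G \<cdot> H \<cdot> s" \<sigma> \<Gamma> "Suc (Suc (Suc 0))"] assms
  by (simp add: bind_rec_def eval_nat_numeral infer_bind_stop[of _ _ _ \<sigma>])

text \<open>Above a secured \<open>s\<close> the value of \<open>V\<close> no longer changes, so
  there the composite is the recursor of one fixed pair, the one with index
  \<open>V(hat s)\<close>.\<close>

lemma bind_rec_secured:
  assumes sec: "HA E \<Gamma> (secured \<sigma> V B s)" and ext: "HA E \<Gamma> (extends s s')"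
    and ty: "infer E V = Some (Val_ty Nat)" "infer E B = Some (BR_ty Nat \<sigma>)"
      "infer E KB = Some (Nat \<rightarrow> BR_ty Nat \<sigma>)"
      "infer E s = Some (Star Nat)" "infer E s' = Some (Star Nat)"
      "infer E G = Some (G_ty Nat \<sigma>)" "infer E H = Some (H_ty Nat \<sigma>)"
  shows "HA E \<Gamma> (Eq \<sigma> (bind_rec \<sigma> V B KB \<cdot> G \<cdot> H \<cdot> s') (KB \<cdot> (V \<cdot> (Hat Nat \<cdot> s)) \<cdot> G \<cdot> H \<cdot> s'))"
proof -
  have "HA E \<Gamma> (Eq \<sigma> (bind_rec \<sigma> V B KB \<cdot> G \<cdot> H \<cdot> s') (B \<cdot> bind_stop V KB G H \<cdot> H \<cdot> s'))"
    by (rule bind_rec_eq) (use ty in auto)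
  also have "HA E \<Gamma> (Eq \<sigma> (B \<cdot> bind_stop V KB G H \<cdot> H \<cdot> s') (bind_stop V KB G H \<cdot> s'))"
    by (rule secured_stop[OF sec ext]) (use ty in auto)
  also have "HA E \<Gamma> (Eq \<sigma> (bind_stop V KB G H \<cdot> s') (KB \<cdot> (V \<cdot> (Hat Nat \<cdot> s')) \<cdot> G \<cdot> H \<cdot> s'))"
    by (rule bind_stop_eq) (use ty in auto)
  also have "HA E \<Gamma> (Eq \<sigma> (KB \<cdot> (V \<cdot> (Hat Nat \<cdot> s')) \<cdot> G \<cdot> H \<cdot> s') (KB \<cdot> (V \<cdot> (Hat Nat \<cdot> s)) \<cdot> G \<cdot> H \<cdot> s'))"
    by (rule Eq_fun[OF Eq_fun[OF Eq_fun[OF Eq_arg[OF secured_const[OF sec extends_agree[OF ext]]]]]])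
      (use ty in auto)
  finally show ?thesis .
qed

lemma bind_val_secured:
  assumes sec: "HA E \<Gamma> (secured \<sigma> V B s)" and agr: "HA E \<Gamma> (agree s b)"
    and ty: "infer E V = Some (Val_ty Nat)" "infer E KV = Some (Nat \<rightarrow> Val_ty Nat)"
      "infer E s = Some (Star Nat)" "infer E b = Some (Nat \<rightarrow> Nat)"
  shows "HA E \<Gamma> (Eq Nat (bind_val V KV \<cdot> b) (KV \<cdot> (V \<cdot> (Hat Nat \<cdot> s)) \<cdot> b))"
  by (rule Eq_trans[OF bind_val_eq Eq_fun[OF Eq_arg[OF secured_const[OF sec agr]]]])
    (use ty in auto)

text \<open>Above \<open>s\<close> both components of the composite coincide with those of the
  selected pair, so they inherit its stopping and its constancy.\<close>

lemma bind_secured: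
  assumes sec: "HA E \<Gamma> (secured \<sigma> V B s)"
    and sec': "HA E \<Gamma> (secured \<sigma> (KV \<cdot> (V \<cdot> (Hat Nat \<cdot> s))) (KB \<cdot> (V \<cdot> (Hat Nat \<cdot> s))) s)"
    and ty: "infer E V = Some (Val_ty Nat)" "infer E B = Some (BR_ty Nat \<sigma>)"
      "infer E KV = Some (Nat \<rightarrow> Val_ty Nat)" "infer E KB = Some (Nat \<rightarrow> BR_ty Nat \<sigma>)"
      "infer E s = Some (Star Nat)"
  shows "HA E \<Gamma> (secured \<sigma> (bind_val V KV) (bind_rec \<sigma> V B KB) s)"
proof (rule securedI)
  let ?E = "H_ty Nat \<sigma> # G_ty Nat \<sigma> # Star Nat # E"
  let ?\<Gamma> = "lift_fms (lift_fms (extends (lift s 0) (Var 0) # lift_fms \<Gamma>))"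
  let ?l = "\<lambda>t. lift (lift (lift t 0) 0) 0"
  note lift = HA_lift[OF HA_lift[OF HA_lift_Cons[where B = "extends (lift s 0) (Var 0)"]]]
  have s: "HA ?E ?\<Gamma> (secured \<sigma> (?l V) (?l B) (?l s))"
    and s': "HA ?E ?\<Gamma> (secured \<sigma> (?l KV \<cdot> (?l V \<cdot> (Hat Nat \<cdot> ?l s))) (?l KB \<cdot> (?l V \<cdot> (Hat Nat \<cdot> ?l s))) (?l s))"
    using lift[OF sec] lift[OF sec'] by simp_all
  have ext: "HA ?E ?\<Gamma> (extends (?l s) (Var 2))"
    by (rule HA.Hyp) (use ty in \<open>simp_all add: eval_nat_numeral\<close>)
  have "HA ?E ?\<Gamma> (Eq \<sigma> (bind_rec \<sigma> (?l V) (?l B) (?l KB) \<cdot> Var 1 \<cdot> Var 0 \<cdot> Var 2)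
     (?l KB \<cdot> (?l V \<cdot> (Hat Nat \<cdot> ?l s)) \<cdot> Var 1 \<cdot> Var 0 \<cdot> Var 2))"
    by (rule bind_rec_secured[OF s ext]) (use ty in auto)
  also have "HA ?E ?\<Gamma> (Eq \<sigma> (?l KB \<cdot> (?l V \<cdot> (Hat Nat \<cdot> ?l s)) \<cdot> Var 1 \<cdot> Var 0 \<cdot> Var 2) (Var 1 \<cdot> Var 2))"
    by (rule secured_stop[OF s' ext]) (use ty in auto)
  finally show "HA ?E ?\<Gamma> (Eq \<sigma> (?l (bind_rec \<sigma> V B KB) \<cdot> Var 1 \<cdot> Var 0 \<cdot> Var 2) (Var 1 \<cdot> Var 2))"
    by simp
next
  let ?E = "(Nat \<rightarrow> Nat) # E"
  let ?\<Gamma> = "agree (lift s 0) (Var 0) # lift_fms \<Gamma>"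
  let ?l = "\<lambda>t. lift t 0"
  let ?n = "?l V \<cdot> (Hat Nat \<cdot> ?l s)"
  have s: "HA ?E ?\<Gamma> (secured \<sigma> (?l V) (?l B) (?l s))"
    and s': "HA ?E ?\<Gamma> (secured \<sigma> (?l KV \<cdot> ?n) (?l KB \<cdot> ?n) (?l s))"
    using HA_lift_Cons[OF sec] HA_lift_Cons[OF sec'] by simp_all
  have agr: "HA ?E ?\<Gamma> (agree (?l s) (Var 0))" by (rule Hyp0) (use ty in auto)
  have agr': "HA ?E ?\<Gamma> (agree (?l s) (Hat Nat \<cdot> ?l s))" by (rule agree_refl) (use ty in auto)
  have "HA ?E ?\<Gamma> (Eq Nat (bind_val (?l V) (?l KV) \<cdot> Var 0) (?l KV \<cdot> ?n \<cdot> Var 0))"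
    by (rule bind_val_secured[OF s agr]) (use ty in auto)
  also have "HA ?E ?\<Gamma> (Eq Nat (?l KV \<cdot> ?n \<cdot> Var 0) (?l KV \<cdot> ?n \<cdot> (Hat Nat \<cdot> ?l s)))"
    by (rule secured_const[OF s' agr]) (use ty in auto)
  also have "HA ?E ?\<Gamma> (Eq Nat (?l KV \<cdot> ?n \<cdot> (Hat Nat \<cdot> ?l s)) (bind_val (?l V) (?l KV) \<cdot> (Hat Nat \<cdot> ?l s)))"
    by (rule Eq_sym[OF bind_val_secured[OF s agr']]) (use ty in auto)
  finally show "HA ?E ?\<Gamma> (Eq Nat (?l (bind_val V KV) \<cdot> Var 0) (?l (bind_val V KV) \<cdot> (Hat Nat \<cdot> ?l s)))"
    by simp
qed (use ty in auto)

lemma recursI: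
  assumes "HA (H_ty Nat \<sigma> # G_ty Nat \<sigma> # E) (lift_fms (lift_fms \<Gamma>))
    (Eq \<sigma> (lift (lift B 0) 0 \<cdot> Var 1 \<cdot> Var 0 \<cdot> lift (lift s 0) 0)
      (Var 0 \<cdot> lift (lift s 0) 0 \<cdot> below Nat (lift (lift B 0) 0) (Var 1) (Var 0) (lift (lift s 0) 0)))"
  shows "HA E \<Gamma> (recurs \<sigma> B s)"
  unfolding recurs_def using assms by (intro HA.AllI)

text \<open>The selected recursor makes a step at \<open>s\<close>. Since \<open>s*x\<close> extends
  the secured \<open>s\<close>, the same index is selected at \<open>s*x\<close>, and the composite
  can be put back under the abstraction.\<close>

lemma bind_recurs_secured:
  assumes sec: "HA E \<Gamma> (secured \<sigma> V B s)"
    and rc: "HA E \<Gamma> (recurs \<sigma> (KB \<cdot> (V \<cdot> (Hat Nat \<cdot> s))) s)"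
    and ty: "infer E V = Some (Val_ty Nat)" "infer E B = Some (BR_ty Nat \<sigma>)"
      "infer E KB = Some (Nat \<rightarrow> BR_ty Nat \<sigma>)" "infer E s = Some (Star Nat)"
      "infer E G = Some (G_ty Nat \<sigma>)" "infer E H = Some (H_ty Nat \<sigma>)"
  shows "HA E \<Gamma> (Eq \<sigma> (bind_rec \<sigma> V B KB \<cdot> G \<cdot> H \<cdot> s) (H \<cdot> s \<cdot> below Nat (bind_rec \<sigma> V B KB) G H s))"
proof -
  let ?n = "V \<cdot> (Hat Nat \<cdot> s)"
  have refl: "HA E \<Gamma> (extends s s)" by (rule extends_refl) (use ty in auto)
  have "HA E \<Gamma> (Eq \<sigma> (bind_rec \<sigma> V B KB \<cdot> G \<cdot> H \<cdot> s) (KB \<cdot> ?n \<cdot> G \<cdot> H \<cdot> s))"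
    by (rule bind_rec_secured[OF sec refl]) (use ty in auto)
  also have "HA E \<Gamma> (Eq \<sigma> (KB \<cdot> ?n \<cdot> G \<cdot> H \<cdot> s) (H \<cdot> s \<cdot> below Nat (KB \<cdot> ?n) G H s))"
    by (rule recurs_elim[OF rc]) (use ty in auto)
  also have "HA E \<Gamma> (Eq \<sigma> (H \<cdot> s \<cdot> below Nat (KB \<cdot> ?n) G H s) (H \<cdot> s \<cdot> below Nat (bind_rec \<sigma> V B KB) G H s))"
    unfolding below_def
  proof (rule Eq_arg[OF Eq_Lam[OF Eq_sym]])
    let ?sx = "Snoc Nat \<cdot> lift s 0 \<cdot> Var 0"
    have ext: "HA (Nat # E) (lift_fms \<Gamma>) (extends (lift s 0) ?sx)"
      by (rule extends_Snoc) (use ty in auto)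
    have "HA (Nat # E) (lift_fms \<Gamma>) (secured \<sigma> (lift V 0) (lift B 0) (lift s 0))"
      using HA_lift[OF sec] by simp
    from bind_rec_secured[OF this ext]
    show "HA (Nat # E) (lift_fms \<Gamma>) (Eq \<sigma> (lift (bind_rec \<sigma> V B KB) 0 \<cdot> lift G 0 \<cdot> lift H 0 \<cdot> ?sx)
       (lift (KB \<cdot> ?n) 0 \<cdot> lift G 0 \<cdot> lift H 0 \<cdot> ?sx))"
      using ty by simp
  qed (use ty in auto)
  finally show ?thesis .
qed

text \<open>The function \<open>bind_stop\<close> does not depend on \<open>s\<close>, so a step of
  \<open>B\<close> with this stop function is a step of the composite.\<close>

lemma bind_recurs_recurs:
  assumes rc: "HA E \<Gamma> (recurs \<sigma> B s)"
    and ty: "infer E V = Some (Val_ty Nat)" "infer E B = Some (BR_ty Nat \<sigma>)"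
      "infer E KB = Some (Nat \<rightarrow> BR_ty Nat \<sigma>)" "infer E s = Some (Star Nat)"
      "infer E G = Some (G_ty Nat \<sigma>)" "infer E H = Some (H_ty Nat \<sigma>)"
  shows "HA E \<Gamma> (Eq \<sigma> (bind_rec \<sigma> V B KB \<cdot> G \<cdot> H \<cdot> s) (H \<cdot> s \<cdot> below Nat (bind_rec \<sigma> V B KB) G H s))"
proof -
  let ?G = "bind_stop V KB G H"
  have "HA E \<Gamma> (Eq \<sigma> (bind_rec \<sigma> V B KB \<cdot> G \<cdot> H \<cdot> s) (B \<cdot> ?G \<cdot> H \<cdot> s))"
    by (rule bind_rec_eq) (use ty in auto)
  also have "HA E \<Gamma> (Eq \<sigma> (B \<cdot> ?G \<cdot> H \<cdot> s) (H \<cdot> s \<cdot> below Nat B ?G H s))"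
    by (rule recurs_elim[OF rc]) (use ty in auto)
  also have "HA E \<Gamma> (Eq \<sigma> (H \<cdot> s \<cdot> below Nat B ?G H s) (H \<cdot> s \<cdot> below Nat (bind_rec \<sigma> V B KB) G H s))"
    unfolding below_def
  proof (rule Eq_arg[OF Eq_Lam[OF Eq_sym]])
    let ?sx = "Snoc Nat \<cdot> lift s 0 \<cdot> Var 0"
    have "HA (Nat # E) (lift_fms \<Gamma>) (Eq \<sigma> (bind_rec \<sigma> (lift V 0) (lift B 0) (lift KB 0) \<cdot> lift G 0 \<cdot> lift H 0 \<cdot> ?sx)
       (lift B 0 \<cdot> bind_stop (lift V 0) (lift KB 0) (lift G 0) (lift H 0) \<cdot> lift H 0 \<cdot> ?sx))"
      by (rule bind_rec_eq) (use ty in auto)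
    then show "HA (Nat # E) (lift_fms \<Gamma>) (Eq \<sigma> (lift (bind_rec \<sigma> V B KB) 0 \<cdot> lift G 0 \<cdot> lift H 0 \<cdot> ?sx)
       (lift B 0 \<cdot> lift ?G 0 \<cdot> lift H 0 \<cdot> ?sx))"
      by simp
  qed (use ty in auto)
  finally show ?thesis .
qed

lemma regularI:
  assumes "HA (Star Nat # E) (lift_fms \<Gamma>) (Or (secured \<sigma> (lift V 0) (lift B 0) (Var 0)) (recurs \<sigma> (lift B 0) (Var 0)))"
  shows "HA E \<Gamma> (regular \<sigma> V B)"
  unfolding regular_def using assms by (rule HA.AllI)

text \<open>At each \<open>s\<close> two disjunctions suffice: the one for \<open>V\<close> and
  \<open>B\<close> and, if they are secured, the one for the selected pair. The composite is secured
  if both are secured and recurs otherwise.\<close>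

lemma regular_bind:
  assumes reg: "HA E \<Gamma> (regular \<sigma> V B)"
    and K: "HA E \<Gamma> (All Nat (regular \<sigma> (lift KV 0 \<cdot> Var 0) (lift KB 0 \<cdot> Var 0)))"
    and ty: "infer E V = Some (Val_ty Nat)" "infer E B = Some (BR_ty Nat \<sigma>)"
      "infer E KV = Some (Nat \<rightarrow> Val_ty Nat)" "infer E KB = Some (Nat \<rightarrow> BR_ty Nat \<sigma>)"
  shows "HA E \<Gamma> (regular \<sigma> (bind_val V KV) (bind_rec \<sigma> V B KB))"
proof (rule regularI)
  let ?E = "Star Nat # E" and ?\<Gamma> = "lift_fms \<Gamma>"
  let ?V = "lift V 0" and ?B = "lift B 0" and ?KV = "lift KV 0" and ?KB = "lift KB 0"
  let ?S = "secured \<sigma> (bind_val ?V ?KV) (bind_rec \<sigma> ?V ?B ?KB) (Var 0)"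
  let ?R = "recurs \<sigma> (bind_rec \<sigma> ?V ?B ?KB) (Var 0)"
  let ?n = "?V \<cdot> (Hat Nat \<cdot> Var 0)"
  have wf: "wf_fm ?E ?S" "wf_fm ?E ?R" using ty by auto
  have "HA ?E ?\<Gamma> (Or (secured \<sigma> ?V ?B (Var 0)) (recurs \<sigma> ?B (Var 0)))"
    using regular_elim[OF HA_lift[OF reg, of "Star Nat", simplified], of "Var 0"] by simp
  then have "HA ?E ?\<Gamma> (Or ?S ?R)"
  proof (rule HA.OrE)
    let ?\<Delta> = "secured \<sigma> ?V ?B (Var 0) # ?\<Gamma>"
    have sec: "HA ?E ?\<Delta> (secured \<sigma> ?V ?B (Var 0))" by (rule Hyp0) (use ty in auto)
    \<comment> \<open>The family is consulted at the single index \<open>V(hat s)\<close>, which the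
      secured case makes valid for all extensions of \<open>s\<close>.\<close>
    have "HA ?E ?\<Delta> (regular \<sigma> (?KV \<cdot> ?n) (?KB \<cdot> ?n))"
      using HA.AllE[OF HA_lift_Cons[OF K, of "Star Nat", simplified], of ?n] ty by simp
    from regular_elim[OF this, of "Var 0", simplified]
    show "HA ?E ?\<Delta> (Or ?S ?R)"
    proof (rule HA.OrE)
      let ?\<Delta>' = "secured \<sigma> (?KV \<cdot> ?n) (?KB \<cdot> ?n) (Var 0) # ?\<Delta>"
      have "HA ?E ?\<Delta>' ?S"
        by (rule bind_secured[OF HA_weaken_Cons[OF sec] Hyp0]) (use ty in auto)
      then show "HA ?E ?\<Delta>' (Or ?S ?R)" using wf by (intro HA.OrI1)
    next
      let ?\<Delta>' = "recurs \<sigma> (?KB \<cdot> ?n) (Var 0) # ?\<Delta>"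
      have "HA ?E ?\<Delta>' ?R"
      proof (rule recursI)
        let ?E' = "H_ty Nat \<sigma> # G_ty Nat \<sigma> # ?E" and ?\<Delta>'' = "lift_fms (lift_fms ?\<Delta>')"
        let ?l = "\<lambda>t. lift (lift (lift t 0) 0) 0"
        have "HA ?E' ?\<Delta>'' (secured \<sigma> (?l V) (?l B) (Var 2))"
          by (rule HA.Hyp) (use ty in \<open>auto simp: eval_nat_numeral\<close>)
        moreover have "HA ?E' ?\<Delta>'' (recurs \<sigma> (?l KB \<cdot> (?l V \<cdot> (Hat Nat \<cdot> Var 2))) (Var 2))"
          by (rule HA.Hyp) (use ty in \<open>auto simp: eval_nat_numeral\<close>)
        ultimately have "HA ?E' ?\<Delta>'' (Eq \<sigma> (bind_rec \<sigma> (?l V) (?l B) (?l KB) \<cdot> Var 1 \<cdot> Var 0 \<cdot> Var 2)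
          (Var 0 \<cdot> Var 2 \<cdot> below Nat (bind_rec \<sigma> (?l V) (?l B) (?l KB)) (Var 1) (Var 0) (Var 2)))"
          by (rule bind_recurs_secured) (use ty in auto)
        then show "HA ?E' ?\<Delta>'' (Eq \<sigma>
          (lift (lift (bind_rec \<sigma> ?V ?B ?KB) 0) 0 \<cdot> Var 1 \<cdot> Var 0 \<cdot> lift (lift (Var 0) 0) 0)
          (Var 0 \<cdot> lift (lift (Var 0) 0) 0 \<cdot>
            below Nat (lift (lift (bind_rec \<sigma> ?V ?B ?KB) 0) 0) (Var 1) (Var 0) (lift (lift (Var 0) 0) 0)))"
          by (simp add: eval_nat_numeral)
      qed
      then show "HA ?E ?\<Delta>' (Or ?S ?R)" using wf by (intro HA.OrI2)
    qed
  next
    let ?\<Delta> = "recurs \<sigma> ?B (Var 0) # ?\<Gamma>"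
    have "HA ?E ?\<Delta> ?R"
    proof (rule recursI)
      let ?E' = "H_ty Nat \<sigma> # G_ty Nat \<sigma> # ?E" and ?\<Delta>' = "lift_fms (lift_fms ?\<Delta>)"
      let ?l = "\<lambda>t. lift (lift (lift t 0) 0) 0"
      have "HA ?E' ?\<Delta>' (recurs \<sigma> (?l B) (Var 2))"
        by (rule HA.Hyp) (use ty in \<open>auto simp: eval_nat_numeral\<close>)
      then have "HA ?E' ?\<Delta>' (Eq \<sigma> (bind_rec \<sigma> (?l V) (?l B) (?l KB) \<cdot> Var 1 \<cdot> Var 0 \<cdot> Var 2)
        (Var 0 \<cdot> Var 2 \<cdot> below Nat (bind_rec \<sigma> (?l V) (?l B) (?l KB)) (Var 1) (Var 0) (Var 2)))"
        by (rule bind_recurs_recurs) (use ty in auto)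
      then show "HA ?E' ?\<Delta>' (Eq \<sigma>
        (lift (lift (bind_rec \<sigma> ?V ?B ?KB) 0) 0 \<cdot> Var 1 \<cdot> Var 0 \<cdot> lift (lift (Var 0) 0) 0)
        (Var 0 \<cdot> lift (lift (Var 0) 0) 0 \<cdot>
          below Nat (lift (lift (bind_rec \<sigma> ?V ?B ?KB) 0) 0) (Var 1) (Var 0) (lift (lift (Var 0) 0) 0)))"
        by (simp add: eval_nat_numeral)
    qed
    then show "HA ?E ?\<Delta> (Or ?S ?R)" using wf by (intro HA.OrI2)
  qed
  then show "HA ?E ?\<Gamma> (Or (secured \<sigma> (lift (bind_val V KV) 0) (lift (bind_rec \<sigma> V B KB) 0) (Var 0))
    (recurs \<sigma> (lift (bind_rec \<sigma> V B KB) 0) (Var 0)))"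
    by simp
qed

section \<open>The basic regular pairs\<close>

lemma regular_num:
  assumes n: "infer E n = Some Nat"
  shows "HA E \<Gamma> (regular \<sigma> (Lam (Nat \<rightarrow> Nat) (lift n 0)) (Lam (G_ty Nat \<sigma>) (Lam (H_ty Nat \<sigma>) (Var 1))))"
proof (rule regularI, rule HA.OrI1)
  let ?B = "Lam (G_ty Nat \<sigma>) (Lam (H_ty Nat \<sigma>) (Var 1))"
  have B: "HA F \<Delta> (Eq \<sigma> (?B \<cdot> G \<cdot> H \<cdot> s) (G \<cdot> s))"
    if "infer F G = Some (G_ty Nat \<sigma>)" "infer F H = Some (H_ty Nat \<sigma>)" "infer F s = Some (Star Nat)" for F \<Delta> G H s
    using Eq_reds[of F "?B \<cdot> G \<cdot> H \<cdot> s" \<sigma> \<Delta> "Suc (Suc 0)"] that by simp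
  have V: "HA F \<Delta> (Eq Nat (Lam (Nat \<rightarrow> Nat) (lift m 0) \<cdot> b) m)"
    if "infer F m = Some Nat" "infer F b = Some (Nat \<rightarrow> Nat)" for F \<Delta> m b
    using Eq_reds[of F "Lam (Nat \<rightarrow> Nat) (lift m 0) \<cdot> b" Nat \<Delta> "Suc 0"] that by simp
  have "HA (Star Nat # E) (lift_fms \<Gamma>) (secured \<sigma> (Lam (Nat \<rightarrow> Nat) (lift (lift n 0) 0)) ?B (Var 0))"
  proof (rule securedI)
    let ?E = "H_ty Nat \<sigma> # G_ty Nat \<sigma> # Star Nat # Star Nat # E"
    show "HA ?E (lift_fms (lift_fms (extends (lift (Var 0) 0) (Var 0) # lift_fms (lift_fms \<Gamma>))))
      (Eq \<sigma> (lift (lift (lift ?B 0) 0) 0 \<cdot> Var 1 \<cdot> Var 0 \<cdot> Var 2) (Var 1 \<cdot> Var 2))"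
      using B[of ?E "Var 1" "Var 0" "Var 2"] by simp
    show "HA ((Nat \<rightarrow> Nat) # Star Nat # E) (agree (lift (Var 0) 0) (Var 0) # lift_fms (lift_fms \<Gamma>))
     (Eq Nat (lift (Lam (Nat \<rightarrow> Nat) (lift (lift n 0) 0)) 0 \<cdot> Var 0)
             (lift (Lam (Nat \<rightarrow> Nat) (lift (lift n 0) 0)) 0 \<cdot> (Hat Nat \<cdot> lift (Var 0) 0)))"
      using Eq_trans[OF V Eq_sym[OF V]] n by simp
  qed simp
  then show "HA (Star Nat # E) (lift_fms \<Gamma>) (secured \<sigma> (lift (Lam (Nat \<rightarrow> Nat) (lift n 0)) 0) (lift ?B 0) (Var 0))"
    by simp
qed simp

text \<open>The pair that reads a function at \<open>n\<close>. All extensions of \<open>s\<close>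
  agree on this entry as soon as \<open>|s| > n\<close>, which is exactly when \<open>Psi(n)\<close>
  stops; before that \<open>Psi_ge\<close> gives the step.\<close>

lemma regular_Psi:
  assumes n: "infer E n = Some Nat"
  shows "HA E \<Gamma> (regular \<sigma> (Lam (Nat \<rightarrow> Nat) (Var 0 \<cdot> lift n 0)) (Psi Nat \<sigma> \<cdot> n))"
proof (rule regularI)
  let ?V = "\<lambda>n. Lam (Nat \<rightarrow> Nat) (Var 0 \<cdot> lift n 0)"
  let ?E = "Star Nat # E" and ?\<Gamma> = "lift_fms \<Gamma>" and ?n = "lift n 0"
  let ?S = "secured \<sigma> (?V ?n) (Psi Nat \<sigma> \<cdot> ?n) (Var 0)" and ?R = "recurs \<sigma> (Psi Nat \<sigma> \<cdot> ?n) (Var 0)"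
  have wf: "wf_fm ?E ?S" "wf_fm ?E ?R" using n by auto
  have V: "HA F \<Delta> (Eq Nat (?V m \<cdot> b) (b \<cdot> m))"
    if "infer F m = Some Nat" "infer F b = Some (Nat \<rightarrow> Nat)" for F \<Delta> m b
    using Eq_reds[of F "?V m \<cdot> b" Nat \<Delta> "Suc 0"] that by simp
  have "HA ?E ?\<Gamma> (Or (ge ?n (Len Nat \<cdot> Var 0)) (lt ?n (Len Nat \<cdot> Var 0)))"
    by (rule Eq_Zero_dec) (use n in auto)
  then have "HA ?E ?\<Gamma> (Or ?S ?R)"
  proof (rule HA.OrE)
    let ?\<Delta> = "ge ?n (Len Nat \<cdot> Var 0) # ?\<Gamma>"
    have "HA ?E ?\<Delta> ?R"
    proof (rule recursI)
      let ?E' = "H_ty Nat \<sigma> # G_ty Nat \<sigma> # ?E" and ?\<Delta>' = "lift_fms (lift_fms ?\<Delta>)"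
      let ?m = "lift (lift ?n 0) 0"
      have "HA ?E' ?\<Delta>' (ge ?m (Len Nat \<cdot> Var 2))"
        by (rule HA.Hyp) (use n in \<open>auto simp: eval_nat_numeral\<close>)
      then have "HA ?E' ?\<Delta>' (Eq \<sigma> (Psi Nat \<sigma> \<cdot> ?m \<cdot> Var 1 \<cdot> Var 0 \<cdot> Var 2)
        (Var 0 \<cdot> Var 2 \<cdot> below Nat (Psi Nat \<sigma> \<cdot> ?m) (Var 1) (Var 0) (Var 2)))"
        by (rule Psi_ge) (use n in auto)
      then show "HA ?E' ?\<Delta>' (Eq \<sigma>
        (lift (lift (Psi Nat \<sigma> \<cdot> ?n) 0) 0 \<cdot> Var 1 \<cdot> Var 0 \<cdot> lift (lift (Var 0) 0) 0)
        (Var 0 \<cdot> lift (lift (Var 0) 0) 0 \<cdot>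
          below Nat (lift (lift (Psi Nat \<sigma> \<cdot> ?n) 0) 0) (Var 1) (Var 0) (lift (lift (Var 0) 0) 0)))"
        by (simp add: eval_nat_numeral)
    qed
    then show "HA ?E ?\<Delta> (Or ?S ?R)" using wf by (intro HA.OrI2)
  next
    let ?\<Delta> = "lt ?n (Len Nat \<cdot> Var 0) # ?\<Gamma>"
    have lt: "HA ?E ?\<Delta> (lt ?n (Len Nat \<cdot> Var 0))" by (rule Hyp0) (use n in auto)
    have "HA ?E ?\<Delta> ?S"
    proof (rule securedI)
      let ?E' = "H_ty Nat \<sigma> # G_ty Nat \<sigma> # Star Nat # ?E"
      let ?\<Delta>' = "lift_fms (lift_fms (extends (lift (Var 0) 0) (Var 0) # lift_fms ?\<Delta>))"
      let ?m = "lift (lift (lift ?n 0) 0) 0"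
      have lt': "HA ?E' ?\<Delta>' (lt ?m (Len Nat \<cdot> Var 3))"
        using HA_lift[OF HA_lift[OF HA_lift_Cons[OF lt, where B = "extends (lift (Var 0) 0) (Var 0)"]]] by (simp add: eval_nat_numeral)
      have "HA ?E' ?\<Delta>' (extends (Var 3) (Var 2))"
        by (rule HA.Hyp) (simp_all add: eval_nat_numeral)
      from extends_lt[OF this lt'] have "HA ?E' ?\<Delta>' (lt ?m (Len Nat \<cdot> Var 2))"
        using n by simp
      then have "HA ?E' ?\<Delta>' (Eq \<sigma> (Psi Nat \<sigma> \<cdot> ?m \<cdot> Var 1 \<cdot> Var 0 \<cdot> Var 2) (Var 1 \<cdot> Var 2))"
        by (rule Psi_lt) (use n in auto)
      then show "HA ?E' ?\<Delta>' (Eq \<sigma> (lift (lift (lift (Psi Nat \<sigma> \<cdot> ?n) 0) 0) 0 \<cdot> Var 1 \<cdot> Var 0 \<cdot> Var 2) (Var 1 \<cdot> Var 2))"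
        by simp
    next
      let ?E' = "(Nat \<rightarrow> Nat) # ?E"
      let ?\<Delta>' = "agree (lift (Var 0) 0) (Var 0) # lift_fms ?\<Delta>"
      let ?m = "lift ?n 0"
      have lt': "HA ?E' ?\<Delta>' (lt ?m (Len Nat \<cdot> Var 1))" using HA_lift_Cons[OF lt] by simp
      have "HA ?E' ?\<Delta>' (agree (Var 1) (Var 0))" by (rule HA.Hyp) simp_all
      from agree_elim[OF this lt'] have "HA ?E' ?\<Delta>' (Eq Nat (Var 0 \<cdot> ?m) (Hat Nat \<cdot> Var 1 \<cdot> ?m))"
        using n by simp
      then have "HA ?E' ?\<Delta>' (Eq Nat (?V ?m \<cdot> Var 0) (?V ?m \<cdot> (Hat Nat \<cdot> Var 1)))"
        by (intro Eq_trans[OF V Eq_trans[OF _ Eq_sym[OF V]]]) (use n in auto)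
      then show "HA ?E' ?\<Delta>' (Eq Nat (lift (?V ?n) 0 \<cdot> Var 0) (lift (?V ?n) 0 \<cdot> (Hat Nat \<cdot> lift (Var 0) 0)))"
        by simp
    qed simp
    then show "HA ?E ?\<Delta> (Or ?S ?R)" using wf by (intro HA.OrI1)
  qed
  then show "HA ?E ?\<Gamma> (Or (secured \<sigma> (lift (?V n) 0) (lift (Psi Nat \<sigma> \<cdot> n) 0) (Var 0))
    (recurs \<sigma> (lift (Psi Nat \<sigma> \<cdot> n) 0) (Var 0)))"
    by simp
qed

section \<open>From regular pairs to Spector's bar recursion\<close>

lemma infer_HY:
  assumes Y: "infer [] Y = Some (Val_ty \<tau>)"
  shows "infer [] (HY \<tau> \<sigma> Y) = Some (G_ty \<tau> \<sigma> \<rightarrow> H_ty \<tau> \<sigma> \<rightarrow> H_ty \<tau> \<sigma>)"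
  by (simp add: HY_def closed_term[OF Y])

lemma infer_Phi:
  assumes Y: "infer [] Y = Some (Val_ty \<tau>)"
  shows "infer [] (Phi \<tau> \<sigma> Y) = Some (BR_ty \<tau> \<sigma> \<rightarrow> BR_ty \<tau> \<sigma>)"
  by (simp add: Phi_def closed_term[OF Y] closed_term[OF infer_HY[OF Y]])

lemma HY_eq:
  assumes Y: "infer [] Y = Some (Val_ty \<tau>)"
    and "infer E G = Some (G_ty \<tau> \<sigma>)" "infer E H = Some (H_ty \<tau> \<sigma>)" "infer E s = Some (Star \<tau>)"
    "infer E f = Some (\<tau> \<rightarrow> \<sigma>)"
  shows "HA E \<Gamma> (Eq \<sigma> (HY \<tau> \<sigma> Y \<cdot> G \<cdot> H \<cdot> s \<cdot> f)
    (IfLess \<sigma> \<cdot> (Y \<cdot> (Hat \<tau> \<cdot> s)) \<cdot> (Len \<tau> \<cdot> s) \<cdot> (G \<cdot> s) \<cdot> (H \<cdot> s \<cdot> f)))"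
  using Eq_reds[of E "HY \<tau> \<sigma> Y \<cdot> G \<cdot> H \<cdot> s \<cdot> f" \<sigma> \<Gamma> "Suc (Suc (Suc (Suc 0)))"] assms(2-)
  by (simp add: HY_def eval_nat_numeral closed_term[OF Y])

lemma Phi_eq:
  assumes Y: "infer [] Y = Some (Val_ty Nat)"
    and "infer E B = Some (BR_ty Nat \<sigma>)"
    "infer E G = Some (G_ty Nat \<sigma>)" "infer E H = Some (H_ty Nat \<sigma>)" "infer E s = Some (Star Nat)"
  shows "HA E \<Gamma> (Eq \<sigma> (Phi Nat \<sigma> Y \<cdot> B \<cdot> G \<cdot> H \<cdot> s)
    (B \<cdot> bind_stop Y (Psi Nat \<sigma>) G H \<cdot> (HY Nat \<sigma> Y \<cdot> G \<cdot> H) \<cdot> s))"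
  using Eq_reds[of E "Phi Nat \<sigma> Y \<cdot> B \<cdot> G \<cdot> H \<cdot> s" \<sigma> \<Gamma> "Suc (Suc (Suc (Suc 0)))"] assms(2-)
  by (simp add: Phi_def eval_nat_numeral bind_stop_def closed_term[OF Y] closed_term[OF infer_HY[OF Y]])

context
  fixes \<sigma> :: ty and E :: "ty list" and \<Gamma> :: "fm list" and Y B G H s :: tm
  assumes Y: "infer [] Y = Some (Val_ty Nat)" and reg: "HA E \<Gamma> (regular \<sigma> Y B)"
    and ty: "infer E B = Some (BR_ty Nat \<sigma>)" "infer E G = Some (G_ty Nat \<sigma>)"
      "infer E H = Some (H_ty Nat \<sigma>)" "infer E s = Some (Star Nat)"
begin

private abbreviation "G' \<equiv> bind_stop Y (Psi Nat \<sigma>) G H"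
private abbreviation "H' \<equiv> HY Nat \<sigma> Y \<cdot> G \<cdot> H"

lemmas closed_Y = closed_term[OF Y] closed_term[OF infer_HY[OF Y]] closed_term[OF infer_Phi[OF Y]]

text \<open>If \<open>s\<close> is secured, \<open>B\<close> falls through to \<open>Psi\<close>,
  which stops by the hypothesis. If \<open>B\<close> makes a step, it calls \<open>HY\<close>, whose
  test succeeds and yields \<open>G(s)\<close>.\<close>

lemma Phi_lt:
  assumes lt: "HA E \<Gamma> (lt (Y \<cdot> (Hat Nat \<cdot> s)) (Len Nat \<cdot> s))"
  shows "HA E \<Gamma> (Eq \<sigma> (Phi Nat \<sigma> Y \<cdot> B \<cdot> G \<cdot> H \<cdot> s) (G \<cdot> s))"
proof (rule HA.OrE[OF regular_elim[OF reg ty(4)]])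
  let ?\<Delta> = "secured \<sigma> Y B s # \<Gamma>"
  have sec: "HA E ?\<Delta> (secured \<sigma> Y B s)" by (rule Hyp0) (auto simp: ty closed_Y)
  have ext: "HA E ?\<Delta> (extends s s)" by (rule extends_refl) (rule ty)
  have "HA E ?\<Delta> (Eq \<sigma> (Phi Nat \<sigma> Y \<cdot> B \<cdot> G \<cdot> H \<cdot> s) (B \<cdot> G' \<cdot> H' \<cdot> s))"
    by (rule Phi_eq) (use ty Y in auto)
  also have "HA E ?\<Delta> (Eq \<sigma> (B \<cdot> G' \<cdot> H' \<cdot> s) (G' \<cdot> s))"
    by (rule secured_stop[OF sec ext]) (auto simp: ty closed_Y)
  also have "HA E ?\<Delta> (Eq \<sigma> (G' \<cdot> s) (Psi Nat \<sigma> \<cdot> (Y \<cdot> (Hat Nat \<cdot> s)) \<cdot> G \<cdot> H \<cdot> s))"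
    by (rule bind_stop_eq) (auto simp: ty closed_Y)
  also have "HA E ?\<Delta> (Eq \<sigma> (Psi Nat \<sigma> \<cdot> (Y \<cdot> (Hat Nat \<cdot> s)) \<cdot> G \<cdot> H \<cdot> s) (G \<cdot> s))"
    by (rule Psi_lt[OF HA_weaken_Cons[OF lt]]) (auto simp: ty closed_Y)
  finally show "HA E ?\<Delta> (Eq \<sigma> (Phi Nat \<sigma> Y \<cdot> B \<cdot> G \<cdot> H \<cdot> s) (G \<cdot> s))" .
next
  let ?\<Delta> = "recurs \<sigma> B s # \<Gamma>"
  have rc: "HA E ?\<Delta> (recurs \<sigma> B s)" by (rule Hyp0) (use ty in auto)
  have "HA E ?\<Delta> (Eq \<sigma> (Phi Nat \<sigma> Y \<cdot> B \<cdot> G \<cdot> H \<cdot> s) (B \<cdot> G' \<cdot> H' \<cdot> s))"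
    by (rule Phi_eq) (use ty Y in auto)
  also have "HA E ?\<Delta> (Eq \<sigma> (B \<cdot> G' \<cdot> H' \<cdot> s) (H' \<cdot> s \<cdot> below Nat B G' H' s))"
    by (rule recurs_elim[OF rc]) (auto simp: ty closed_Y)
  also have "HA E ?\<Delta> (Eq \<sigma> (H' \<cdot> s \<cdot> below Nat B G' H' s)
    (IfLess \<sigma> \<cdot> (Y \<cdot> (Hat Nat \<cdot> s)) \<cdot> (Len Nat \<cdot> s) \<cdot> (G \<cdot> s) \<cdot> (H \<cdot> s \<cdot> below Nat B G' H' s)))"
    by (rule HY_eq[OF Y]) (auto simp: ty closed_Y)
  also have "HA E ?\<Delta> (Eq \<sigma>
    (IfLess \<sigma> \<cdot> (Y \<cdot> (Hat Nat \<cdot> s)) \<cdot> (Len Nat \<cdot> s) \<cdot> (G \<cdot> s) \<cdot> (H \<cdot> s \<cdot> below Nat B G' H' s)) (G \<cdot> s))"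
    by (rule IfLess_lt[OF HA_weaken_Cons[OF lt]]) (auto simp: ty closed_Y)
  finally show "HA E ?\<Delta> (Eq \<sigma> (Phi Nat \<sigma> Y \<cdot> B \<cdot> G \<cdot> H \<cdot> s) (G \<cdot> s))" .
qed

text \<open>If \<open>B\<close> makes a step, the test in \<open>HY\<close> fails and
  \<open>H\<close> itself is called. If \<open>s\<close> is secured, the step is made by
  \<open>Psi\<close>, and it remains to identify \<open>Psi\<close> at \<open>s*x\<close>, with its
  old counter, with \<open>Phi\<close> at \<open>s*x\<close>.\<close>

lemma Phi_ge:
  assumes ge: "HA E \<Gamma> (ge (Y \<cdot> (Hat Nat \<cdot> s)) (Len Nat \<cdot> s))"
  shows "HA E \<Gamma> (Eq \<sigma> (Phi Nat \<sigma> Y \<cdot> B \<cdot> G \<cdot> H \<cdot> s) (H \<cdot> s \<cdot> below Nat (Phi Nat \<sigma> Y \<cdot> B) G H s))"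
proof (rule HA.OrE[OF regular_elim[OF reg ty(4)]])
  let ?\<Delta> = "secured \<sigma> Y B s # \<Gamma>"
  let ?n = "Y \<cdot> (Hat Nat \<cdot> s)"
  have sec: "HA E ?\<Delta> (secured \<sigma> Y B s)" by (rule Hyp0) (auto simp: ty closed_Y)
  have ext: "HA E ?\<Delta> (extends s s)" by (rule extends_refl) (rule ty)
  have "HA E ?\<Delta> (Eq \<sigma> (Phi Nat \<sigma> Y \<cdot> B \<cdot> G \<cdot> H \<cdot> s) (B \<cdot> G' \<cdot> H' \<cdot> s))"
    by (rule Phi_eq) (use ty Y in auto)
  also have "HA E ?\<Delta> (Eq \<sigma> (B \<cdot> G' \<cdot> H' \<cdot> s) (G' \<cdot> s))"
    by (rule secured_stop[OF sec ext]) (auto simp: ty closed_Y)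
  also have "HA E ?\<Delta> (Eq \<sigma> (G' \<cdot> s) (Psi Nat \<sigma> \<cdot> ?n \<cdot> G \<cdot> H \<cdot> s))"
    by (rule bind_stop_eq) (auto simp: ty closed_Y)
  also have "HA E ?\<Delta> (Eq \<sigma> (Psi Nat \<sigma> \<cdot> ?n \<cdot> G \<cdot> H \<cdot> s) (H \<cdot> s \<cdot> below Nat (Psi Nat \<sigma> \<cdot> ?n) G H s))"
    by (rule Psi_ge[OF HA_weaken_Cons[OF ge]]) (auto simp: ty closed_Y)
  also have "HA E ?\<Delta> (Eq \<sigma> (H \<cdot> s \<cdot> below Nat (Psi Nat \<sigma> \<cdot> ?n) G H s)
    (H \<cdot> s \<cdot> below Nat (Phi Nat \<sigma> Y \<cdot> B) G H s))"
    unfolding below_def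
  proof (rule Eq_arg[OF Eq_Lam[OF Eq_sym]])
    let ?E = "Nat # E" and ?\<Delta>' = "lift_fms ?\<Delta>"
    let ?s = "lift s 0" and ?G = "lift G 0" and ?H = "lift H 0" and ?B = "lift B 0"
    let ?sx = "Snoc Nat \<cdot> ?s \<cdot> Var 0"
    have sec': "HA ?E ?\<Delta>' (secured \<sigma> Y ?B ?s)" using HA_lift[OF sec] by (simp add: closed_Y)
    have ext: "HA ?E ?\<Delta>' (extends ?s ?sx)" by (rule extends_Snoc) (use ty in auto)
    have "HA ?E ?\<Delta>' (Eq \<sigma> (Phi Nat \<sigma> Y \<cdot> ?B \<cdot> ?G \<cdot> ?H \<cdot> ?sx)
       (?B \<cdot> bind_stop Y (Psi Nat \<sigma>) ?G ?H \<cdot> (HY Nat \<sigma> Y \<cdot> ?G \<cdot> ?H) \<cdot> ?sx))"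
      by (rule Phi_eq) (use ty Y in auto)
    also have "HA ?E ?\<Delta>' (Eq \<sigma> (?B \<cdot> bind_stop Y (Psi Nat \<sigma>) ?G ?H \<cdot> (HY Nat \<sigma> Y \<cdot> ?G \<cdot> ?H) \<cdot> ?sx)
       (bind_stop Y (Psi Nat \<sigma>) ?G ?H \<cdot> ?sx))"
      by (rule secured_stop[OF sec' ext]) (auto simp: ty closed_Y)
    also have "HA ?E ?\<Delta>' (Eq \<sigma> (bind_stop Y (Psi Nat \<sigma>) ?G ?H \<cdot> ?sx)
       (Psi Nat \<sigma> \<cdot> (Y \<cdot> (Hat Nat \<cdot> ?sx)) \<cdot> ?G \<cdot> ?H \<cdot> ?sx))"
      by (rule bind_stop_eq) (auto simp: ty closed_Y)
    \<comment> \<open>Here the constancy of \<open>Y\<close> above \<open>s\<close> enters: the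
      counter computed at \<open>s*x\<close> is the one computed at \<open>s\<close>.\<close>
    also have "HA ?E ?\<Delta>' (Eq \<sigma> (Psi Nat \<sigma> \<cdot> (Y \<cdot> (Hat Nat \<cdot> ?sx)) \<cdot> ?G \<cdot> ?H \<cdot> ?sx)
       (Psi Nat \<sigma> \<cdot> (Y \<cdot> (Hat Nat \<cdot> ?s)) \<cdot> ?G \<cdot> ?H \<cdot> ?sx))"
      by (rule Eq_fun[OF Eq_fun[OF Eq_fun[OF Eq_arg[OF secured_const[OF sec' extends_agree[OF ext]]]]]])
        (auto simp: ty closed_Y)
    finally show "HA ?E ?\<Delta>' (Eq \<sigma> (lift (Phi Nat \<sigma> Y \<cdot> B) 0 \<cdot> ?G \<cdot> ?H \<cdot> ?sx)
       (lift (Psi Nat \<sigma> \<cdot> ?n) 0 \<cdot> ?G \<cdot> ?H \<cdot> ?sx))"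
      by (simp add: closed_Y)
  qed (use ty in auto)
  finally show "HA E ?\<Delta> (Eq \<sigma> (Phi Nat \<sigma> Y \<cdot> B \<cdot> G \<cdot> H \<cdot> s) (H \<cdot> s \<cdot> below Nat (Phi Nat \<sigma> Y \<cdot> B) G H s))" .
next
  let ?\<Delta> = "recurs \<sigma> B s # \<Gamma>"
  have rc: "HA E ?\<Delta> (recurs \<sigma> B s)" by (rule Hyp0) (use ty in auto)
  let ?b = "below Nat B G' H' s"
  have "HA E ?\<Delta> (Eq \<sigma> (Phi Nat \<sigma> Y \<cdot> B \<cdot> G \<cdot> H \<cdot> s) (B \<cdot> G' \<cdot> H' \<cdot> s))"
    by (rule Phi_eq) (use ty Y in auto)
  also have "HA E ?\<Delta> (Eq \<sigma> (B \<cdot> G' \<cdot> H' \<cdot> s) (H' \<cdot> s \<cdot> ?b))"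
    by (rule recurs_elim[OF rc]) (auto simp: ty closed_Y)
  also have "HA E ?\<Delta> (Eq \<sigma> (H' \<cdot> s \<cdot> ?b)
    (IfLess \<sigma> \<cdot> (Y \<cdot> (Hat Nat \<cdot> s)) \<cdot> (Len Nat \<cdot> s) \<cdot> (G \<cdot> s) \<cdot> (H \<cdot> s \<cdot> ?b)))"
    by (rule HY_eq[OF Y]) (auto simp: ty closed_Y)
  also have "HA E ?\<Delta> (Eq \<sigma>
    (IfLess \<sigma> \<cdot> (Y \<cdot> (Hat Nat \<cdot> s)) \<cdot> (Len Nat \<cdot> s) \<cdot> (G \<cdot> s) \<cdot> (H \<cdot> s \<cdot> ?b)) (H \<cdot> s \<cdot> ?b))"
    by (rule IfLess_ge[OF HA_weaken_Cons[OF ge]]) (auto simp: ty closed_Y)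
  also have "HA E ?\<Delta> (Eq \<sigma> (H \<cdot> s \<cdot> ?b) (H \<cdot> s \<cdot> below Nat (Phi Nat \<sigma> Y \<cdot> B) G H s))"
    unfolding below_def
  proof (rule Eq_arg[OF Eq_Lam[OF Eq_sym]])
    let ?sx = "Snoc Nat \<cdot> lift s 0 \<cdot> Var 0"
    have "HA (Nat # E) (lift_fms ?\<Delta>) (Eq \<sigma> (Phi Nat \<sigma> Y \<cdot> lift B 0 \<cdot> lift G 0 \<cdot> lift H 0 \<cdot> ?sx)
       (lift B 0 \<cdot> bind_stop Y (Psi Nat \<sigma>) (lift G 0) (lift H 0) \<cdot> (HY Nat \<sigma> Y \<cdot> lift G 0 \<cdot> lift H 0) \<cdot> ?sx))"
      by (rule Phi_eq) (use ty Y in auto)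
    then show "HA (Nat # E) (lift_fms ?\<Delta>) (Eq \<sigma> (lift (Phi Nat \<sigma> Y \<cdot> B) 0 \<cdot> lift G 0 \<cdot> lift H 0 \<cdot> ?sx)
       (lift B 0 \<cdot> lift G' 0 \<cdot> lift H' 0 \<cdot> ?sx))"
      by (simp add: closed_Y)
  qed (use ty in auto)
  finally show "HA E ?\<Delta> (Eq \<sigma> (Phi Nat \<sigma> Y \<cdot> B \<cdot> G \<cdot> H \<cdot> s) (H \<cdot> s \<cdot> below Nat (Phi Nat \<sigma> Y \<cdot> B) G H s))" .
qed

end

lemma Phi_Spector_bar_recursor:
  assumes Y: "infer [] Y = Some (Val_ty Nat)" and B: "infer [] B = Some (BR_ty Nat \<sigma>)"
    and reg: "HA [] [] (regular \<sigma> Y B)"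
  shows "HA [] [] (Spector_bar_recursor Nat \<sigma> Y (Phi Nat \<sigma> Y \<cdot> B))"
  unfolding Spector_bar_recursor_def
proof (intro HA.AllI HA.AndI HA.ImpI)
  let ?E = "[Star Nat, H_ty Nat \<sigma>, G_ty Nat \<sigma>]"
  note closed = closed_term[OF Y] closed_term[OF B] closed_term[OF infer_Phi[OF Y]]
  \<comment> \<open>\<open>Y\<close> and \<open>B\<close> are closed, so their regularity is
    available unchanged below the three quantifiers and under any hypotheses.\<close>
  have reg': "HA ?E \<Delta> (regular \<sigma> Y B)" for \<Delta>
    using HA_weaken_Nil[OF HA_lift[OF HA_lift[OF HA_lift[OF reg], simplified], simplified], simplified]
    by (simp add: closed)
  let ?L = "Less (Y \<cdot> (Hat Nat \<cdot> Var 0)) (Len Nat \<cdot> Var 0)"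
  let ?\<Delta> = "?L # lift_fms (lift_fms (lift_fms []))"
  have wfL: "wf_fm ?E ?L" by (simp add: Less_def closed)
  have "HA ?E ?\<Delta> (lt (Y \<cdot> (Hat Nat \<cdot> Var 0)) (Len Nat \<cdot> Var 0))"
    by (rule lt_of_Less[OF Hyp0[OF wfL]]) (simp_all add: closed)
  from Phi_lt[OF Y reg' _ _ _ _ this]
  show "HA ?E ?\<Delta> (Eq \<sigma> (Phi Nat \<sigma> Y \<cdot> B \<cdot> Var 2 \<cdot> Var 1 \<cdot> Var 0) (Var 2 \<cdot> Var 0))"
    by (simp add: closed)
  show "wf_fm ?E ?L" by (rule wfL)
  let ?L = "GreaterEq (Y \<cdot> (Hat Nat \<cdot> Var 0)) (Len Nat \<cdot> Var 0)"
  let ?\<Delta> = "?L # lift_fms (lift_fms (lift_fms []))"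
  have wfL: "wf_fm ?E ?L" by (simp add: GreaterEq_def closed)
  have "HA ?E ?\<Delta> (ge (Y \<cdot> (Hat Nat \<cdot> Var 0)) (Len Nat \<cdot> Var 0))"
    by (rule ge_of_GreaterEq[OF Hyp0[OF wfL]]) (simp_all add: closed)
  from Phi_ge[OF Y reg' _ _ _ _ this, of "Var 2" "Var 1"]
  show "HA ?E ?\<Delta> (Eq \<sigma> (Phi Nat \<sigma> Y \<cdot> B \<cdot> Var 2 \<cdot> Var 1 \<cdot> Var 0)
     (Var 1 \<cdot> Var 0 \<cdot> Lam Nat (Phi Nat \<sigma> Y \<cdot> B \<cdot> Var 3 \<cdot> Var 2 \<cdot> (Snoc Nat \<cdot> Var 1 \<cdot> Var 0))))"
    by (simp add: closed below_def eval_nat_numeral)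
  show "wf_fm ?E ?L" by (rule wfL)
qed

section \<open>The logical relation\<close>

lemma infer_tr_num [simp]:
  "infer E k = Some Nat \<Longrightarrow> infer E (tr_num Nat \<sigma> k) = Some (trN Nat \<sigma>)"
  by (simp add: tr_num_def)

lemma lift_tr_num [simp]: "lift (tr_num \<tau> \<sigma> k) i = tr_num \<tau> \<sigma> (lift k i)"
  by (simp add: tr_num_def)

lemma subst_tr_num [simp]: "subst (tr_num \<tau> \<sigma> k) s i = tr_num \<tau> \<sigma> (subst k s i)"
  by (simp add: tr_num_def subst_lift_0)

lemma infer_tr_Succ: "infer [] (tr_Succ Nat \<sigma>) = Some (trN Nat \<sigma> \<rightarrow> trN Nat \<sigma>)"
  by (simp add: tr_Succ_def)

lemmas closed_tr_Succ [simp] = closed_term[OF infer_tr_Succ]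

lemma infer_tr_alpha: "infer [] (tr_alpha \<sigma>) = Some (trN Nat \<sigma> \<rightarrow> trN Nat \<sigma>)"
  by (simp add: tr_alpha_def eval_nat_numeral)

lemmas closed_tr_alpha [simp] = closed_term[OF infer_tr_alpha]

text \<open>
  \<open>rel \<sigma> a T u f\<close> relates \<open>u\<close> of type \<open>T\<degree>\<close> to \<open>f\<close> of type \<open>T\<close>, where \<open>a\<close> is the value of the special
  variable \<open>\<alpha>\<close>. It is a formula and not a relation of the metalogic, since the case of the
  recursors needs an induction inside Heyting arithmetic.
\<close>

primrec rel :: "ty \<Rightarrow> tm \<Rightarrow> ty \<Rightarrow> tm \<Rightarrow> tm \<Rightarrow> fm" where
  "rel \<sigma> a Nat u f = And (regular \<sigma> (Val Nat \<sigma> u) (BR Nat \<sigma> u)) (Eq Nat (Val Nat \<sigma> u \<cdot> a) f)"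
| "rel \<sigma> a (T \<rightarrow> U) u f = All (tr_ty Nat \<sigma> T) (All T (Imp
    (rel \<sigma> (lift (lift a 0) 0) T (Var 1) (Var 0))
    (rel \<sigma> (lift (lift a 0) 0) U (lift (lift u 0) 0 \<cdot> Var 1) (lift (lift f 0) 0 \<cdot> Var 0))))"
| "rel \<sigma> a (Star T) u f = Bot"
| "rel \<sigma> a (Prod T U) u f = Bot"

lemma lift_rel [simp]: "lift_fm (rel \<sigma> a T u f) k = rel \<sigma> (lift a k) T (lift u k) (lift f k)"
  by (induction T arbitrary: a u f k) simp_all

lemma subst_rel [simp]:
  "subst_fm (rel \<sigma> a T u f) s k = rel \<sigma> (subst a s k) T (subst u s k) (subst f s k)"
  by (induction T arbitrary: a u f k s) (simp_all add: subst_lift_0)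

lemma wf_rel:
  "arith_ty T \<Longrightarrow> infer E a = Some (Nat \<rightarrow> Nat) \<Longrightarrow> infer E u = Some (tr_ty Nat \<sigma> T) \<Longrightarrow>
    infer E f = Some T \<Longrightarrow> wf_fm E (rel \<sigma> a T u f)"
  by (induction T arbitrary: E a u f) simp_all

lemma rel_FunI:
  assumes "HA (T # tr_ty Nat \<sigma> T # E)
      (rel \<sigma> (lift (lift a 0) 0) T (Var 1) (Var 0) # lift_fms (lift_fms \<Gamma>))
      (rel \<sigma> (lift (lift a 0) 0) U (lift (lift u 0) 0 \<cdot> Var 1) (lift (lift f 0) 0 \<cdot> Var 0))"
    "arith_ty T" "infer E a = Some (Nat \<rightarrow> Nat)"
  shows "HA E \<Gamma> (rel \<sigma> a (T \<rightarrow> U) u f)"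
  unfolding rel.simps by (intro HA.AllI HA.ImpI wf_rel) (use assms in auto)

lemma rel_FunE:
  assumes "HA E \<Gamma> (rel \<sigma> a (T \<rightarrow> U) u f)" "HA E \<Gamma> (rel \<sigma> a T v g)"
    "infer E v = Some (tr_ty Nat \<sigma> T)" "infer E g = Some T"
  shows "HA E \<Gamma> (rel \<sigma> a U (u \<cdot> v) (f \<cdot> g))"
proof -
  have "HA E \<Gamma> (All T (Imp (rel \<sigma> (lift a 0) T (lift v 0) (Var 0))
    (rel \<sigma> (lift a 0) U (lift u 0 \<cdot> lift v 0) (lift f 0 \<cdot> Var 0))))"
    using HA.AllE[OF assms(1)[unfolded rel.simps], of v] assms(3) by simp
  from HA.ImpE[OF HA.AllE[OF this, of g, simplified] assms(2)] assms(4) show ?thesis by simp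
qed

lemma rel_cong:
  assumes "HA E \<Gamma> (rel \<sigma> a T u f)" "HA E \<Gamma> (Eq (tr_ty Nat \<sigma> T) u u')" "HA E \<Gamma> (Eq T f f')"
    and a: "arith_ty T" "infer E a = Some (Nat \<rightarrow> Nat)"
  shows "HA E \<Gamma> (rel \<sigma> a T u' f')"
proof -
  note ty = HA_typed[OF assms(2)] HA_typed[OF assms(3)]
  have "HA E \<Gamma> (rel \<sigma> a T u' f)"
    using HA.Subst[OF assms(2), of "rel \<sigma> (lift a 0) T (Var 0) (lift f 0)"] assms(1) ty a
    by (simp add: wf_rel)
  then show ?thesis
    using HA.Subst[OF assms(3), of "rel \<sigma> (lift a 0) T (lift u' 0) (Var 0)"] ty a
    by (simp add: wf_rel)
qed

section \<open>The relation at the base type\<close>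

lemma Val_mkN:
  "infer E V = Some (Val_ty \<tau>) \<Longrightarrow> infer E B = Some (BR_ty \<tau> \<sigma>) \<Longrightarrow>
    HA E \<Gamma> (Eq (Val_ty \<tau>) (Val \<tau> \<sigma> (mkN \<tau> \<sigma> V B)) V)"
  by (rule HA.FstPair) auto

lemma BR_mkN:
  "infer E V = Some (Val_ty \<tau>) \<Longrightarrow> infer E B = Some (BR_ty \<tau> \<sigma>) \<Longrightarrow>
    HA E \<Gamma> (Eq (BR_ty \<tau> \<sigma>) (BR \<tau> \<sigma> (mkN \<tau> \<sigma> V B)) B)"
  by (rule HA.SndPair) auto

text \<open>The relation speaks of the projections of \<open>w\<close>, while the clauses of the
  translation present \<open>w\<close> as a pair; congruence of regularity mediates.\<close>

lemma rel_NatI: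
  assumes w: "HA E \<Gamma> (Eq (trN Nat \<sigma>) w (mkN Nat \<sigma> V B))" and reg: "HA E \<Gamma> (regular \<sigma> V B)"
    and val: "HA E \<Gamma> (Eq Nat (V \<cdot> a) n)"
    and ty: "infer E V = Some (Val_ty Nat)" "infer E B = Some (BR_ty Nat \<sigma>)" "infer E a = Some (Nat \<rightarrow> Nat)"
  shows "HA E \<Gamma> (rel \<sigma> a Nat w n)"
proof -
  have V: "HA E \<Gamma> (Eq (Val_ty Nat) (Val Nat \<sigma> w) V)"
    by (rule Eq_trans[OF Eq_arg[OF w] Val_mkN]) (use ty in auto)
  have B: "HA E \<Gamma> (Eq (BR_ty Nat \<sigma>) (BR Nat \<sigma> w) B)"
    by (rule Eq_trans[OF Eq_arg[OF w] BR_mkN]) (use ty in auto)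
  show ?thesis
    unfolding rel.simps
    by (rule HA.AndI[OF regular_cong[OF reg Eq_sym[OF V] Eq_sym[OF B]] Eq_trans[OF Eq_fun[OF V] val]])
      (rule ty)
qed

lemma rel_NatE:
  assumes "HA E \<Gamma> (rel \<sigma> a Nat u n)"
  shows "HA E \<Gamma> (regular \<sigma> (Val Nat \<sigma> u) (BR Nat \<sigma> u))" "HA E \<Gamma> (Eq Nat (Val Nat \<sigma> u \<cdot> a) n)"
  using assms HA.AndE1 HA.AndE2 unfolding rel.simps by blast+

lemma BR_ext:
  assumes "HA (Star \<tau> # H_ty \<tau> \<sigma> # G_ty \<tau> \<sigma> # E) (lift_fms (lift_fms (lift_fms \<Gamma>)))
     (Eq \<sigma> (lift (lift (lift B 0) 0) 0 \<cdot> Var 2 \<cdot> Var 1 \<cdot> Var 0) (lift (lift (lift B' 0) 0) 0 \<cdot> Var 2 \<cdot> Var 1 \<cdot> Var 0))"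
    "infer E B = Some (BR_ty \<tau> \<sigma>)" "infer E B' = Some (BR_ty \<tau> \<sigma>)"
  shows "HA E \<Gamma> (Eq (BR_ty \<tau> \<sigma>) B B')"
  by (rule Eq_ext, rule Eq_ext, rule Eq_ext) (use assms in \<open>simp_all add: eval_nat_numeral\<close>)

lemma rel_num:
  assumes "infer E n = Some Nat" "infer E a = Some (Nat \<rightarrow> Nat)"
  shows "HA E \<Gamma> (rel \<sigma> a Nat (tr_num Nat \<sigma> n) n)"
proof (rule rel_NatI)
  show "HA E \<Gamma> (Eq (trN Nat \<sigma>) (tr_num Nat \<sigma> n)
    (mkN Nat \<sigma> (Lam (Nat \<rightarrow> Nat) (lift n 0)) (Lam (G_ty Nat \<sigma>) (Lam (H_ty Nat \<sigma>) (Var 1)))))"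
    using Eq_refl[OF infer_tr_num[OF assms(1)]] by (simp add: tr_num_def)
  show "HA E \<Gamma> (Eq Nat (Lam (Nat \<rightarrow> Nat) (lift n 0) \<cdot> a) n)"
    using Eq_beta[of "Nat \<rightarrow> Nat" E "lift n 0" Nat a \<Gamma>] assms by simp
  show "HA E \<Gamma> (regular \<sigma> (Lam (Nat \<rightarrow> Nat) (lift n 0)) (Lam (G_ty Nat \<sigma>) (Lam (H_ty Nat \<sigma>) (Var 1))))"
    by (rule regular_num) (rule assms)
qed (use assms in auto)

lemma bind_stop_ext:
  assumes "HA (Star Nat # E) (lift_fms \<Gamma>)
      (Eq \<sigma> (lift KB 0 \<cdot> (lift V 0 \<cdot> (Hat Nat \<cdot> Var 0)) \<cdot> lift G 0 \<cdot> lift H 0 \<cdot> Var 0) t)"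
  shows "HA E \<Gamma> (Eq (G_ty Nat \<sigma>) (bind_stop V KB G H) (Lam (Star Nat) t))"
  unfolding bind_stop_def by (rule Eq_Lam) (rule assms)

lemma subst_fm_lift_fm_Var [simp]: "subst_fm (lift_fm A (Suc k)) (Var k) k = A"
  by (induction A arbitrary: k) simp_all

lemma All_elim_Var: "HA E \<Gamma> (All T A) \<Longrightarrow> HA (T # E) (lift_fms \<Gamma>) A"
  using HA.AllE[OF HA_lift[of E \<Gamma> "All T A" T, simplified], of "Var 0"] by simp

text \<open>Bind for a family given by terms with a free number variable, which is how the
  translation presents it, instead of by functions of that number.\<close>

lemma regular_bind_Lam:
  assumes "HA E \<Gamma> (regular \<sigma> V B)" "HA (Nat # E) (lift_fms \<Gamma>) (regular \<sigma> v b)"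
    and ty: "infer E V = Some (Val_ty Nat)" "infer E B = Some (BR_ty Nat \<sigma>)"
      "infer (Nat # E) v = Some (Val_ty Nat)" "infer (Nat # E) b = Some (BR_ty Nat \<sigma>)"
  shows "HA E \<Gamma> (regular \<sigma> (bind_val V (Lam Nat v)) (bind_rec \<sigma> V B (Lam Nat b)))"
proof (rule regular_bind[OF assms(1) HA.AllI[OF regular_cong[OF assms(2)]]])
  have "HA (Nat # E) (lift_fms \<Gamma>) (Eq T t (lift (Lam Nat t) 0 \<cdot> Var 0))" if "infer (Nat # E) t = Some T" for t T
    using Eq_sym[OF Eq_beta[of Nat "Nat # E" "lift t (Suc 0)" T "Var 0" "lift_fms \<Gamma>"]] that by simp
  then show "HA (Nat # E) (lift_fms \<Gamma>) (Eq (Val_ty Nat) v (lift (Lam Nat v) 0 \<cdot> Var 0))"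
    "HA (Nat # E) (lift_fms \<Gamma>) (Eq (BR_ty Nat \<sigma>) b (lift (Lam Nat b) 0 \<cdot> Var 0))"
    using ty by blast+
qed (use ty in auto)

section \<open>Successor and the special variable\<close>

text \<open>Bind with the constant pairs of the numbers \<open>n + 1\<close>. Such a pair stops at
  once, so the stop function equals \<open>G\<close> pointwise, and by extensionality the composite
  recursor is that of \<open>u\<close>, as the clause for successor demands.\<close>

lemma rel_Succ:
  assumes r: "HA E \<Gamma> (rel \<sigma> a Nat u n)"
    and ty: "infer E u = Some (trN Nat \<sigma>)" "infer E n = Some Nat" "infer E a = Some (Nat \<rightarrow> Nat)"
  shows "HA E \<Gamma> (rel \<sigma> a Nat (tr_Succ Nat \<sigma> \<cdot> u) (Succ \<cdot> n))"
proof (rule rel_NatI)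
  let ?V = "Val Nat \<sigma> u" and ?B = "BR Nat \<sigma> u"
  let ?S = "Lam (Nat \<rightarrow> Nat) (Succ \<cdot> (lift ?V 0 \<cdot> Var 0))"
  let ?KV = "Lam Nat (Lam (Nat \<rightarrow> Nat) (Succ \<cdot> Var 1))"
  let ?KB = "Lam Nat (Lam (G_ty Nat \<sigma>) (Lam (H_ty Nat \<sigma>) (Var 1)))"
  show "HA E \<Gamma> (Eq (trN Nat \<sigma>) (tr_Succ Nat \<sigma> \<cdot> u) (mkN Nat \<sigma> ?S ?B))"
    using Eq_reds[of E "tr_Succ Nat \<sigma> \<cdot> u" "trN Nat \<sigma>" \<Gamma> "Suc 0"] ty by (simp add: tr_Succ_def)
  have "HA E \<Gamma> (Eq Nat (?S \<cdot> a) (Succ \<cdot> (?V \<cdot> a)))"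
    using Eq_beta[of "Nat \<rightarrow> Nat" E "Succ \<cdot> (lift ?V 0 \<cdot> Var 0)" Nat a \<Gamma>] ty by simp
  also have "HA E \<Gamma> (Eq Nat (Succ \<cdot> (?V \<cdot> a)) (Succ \<cdot> n))"
    by (rule Eq_arg[OF rel_NatE(2)[OF r]]) simp
  finally show "HA E \<Gamma> (Eq Nat (?S \<cdot> a) (Succ \<cdot> n))" .
  have "HA (Nat # E) (lift_fms \<Gamma>)
      (regular \<sigma> (Lam (Nat \<rightarrow> Nat) (Succ \<cdot> Var 1)) (Lam (G_ty Nat \<sigma>) (Lam (H_ty Nat \<sigma>) (Var 1))))"
    using regular_num[of "Nat # E" "Succ \<cdot> Var 0" "lift_fms \<Gamma>" \<sigma>] by simp
  then have reg: "HA E \<Gamma> (regular \<sigma> (bind_val ?V ?KV) (bind_rec \<sigma> ?V ?B ?KB))"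
    by (rule regular_bind_Lam[OF rel_NatE(1)[OF r]]) (use ty in auto)
  show "HA E \<Gamma> (regular \<sigma> ?S ?B)"
  proof (rule regular_cong[OF reg])
    show "HA E \<Gamma> (Eq (Val_ty Nat) (bind_val ?V ?KV) ?S)"
      unfolding bind_val_def
    proof (rule Eq_Lam)
      show "HA ((Nat \<rightarrow> Nat) # E) (lift_fms \<Gamma>) (Eq Nat (lift ?KV 0 \<cdot> (lift ?V 0 \<cdot> Var 0) \<cdot> Var 0) (Succ \<cdot> (lift ?V 0 \<cdot> Var 0)))"
        using Eq_reds[of "(Nat \<rightarrow> Nat) # E" "?KV \<cdot> (lift ?V 0 \<cdot> Var 0) \<cdot> Var 0" Nat "lift_fms \<Gamma>" "Suc (Suc 0)"] ty by simp
    qed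
    show "HA E \<Gamma> (Eq (BR_ty Nat \<sigma>) (bind_rec \<sigma> ?V ?B ?KB) ?B)"
    proof (rule BR_ext)
      let ?E = "Star Nat # H_ty Nat \<sigma> # G_ty Nat \<sigma> # E" and ?\<Gamma> = "lift_fms (lift_fms (lift_fms \<Gamma>))"
      let ?l = "\<lambda>t. lift (lift (lift t 0) 0) 0"
      have "HA ?E ?\<Gamma> (Eq \<sigma> (bind_rec \<sigma> (?l ?V) (?l ?B) ?KB \<cdot> Var 2 \<cdot> Var 1 \<cdot> Var 0)
         (?l ?B \<cdot> bind_stop (?l ?V) ?KB (Var 2) (Var 1) \<cdot> Var 1 \<cdot> Var 0))"
        by (rule bind_rec_eq) (use ty in auto)
      also have "HA ?E ?\<Gamma> (Eq \<sigma> (?l ?B \<cdot> bind_stop (?l ?V) ?KB (Var 2) (Var 1) \<cdot> Var 1 \<cdot> Var 0)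
        (?l ?B \<cdot> Var 2 \<cdot> Var 1 \<cdot> Var 0))"
      proof (rule Eq_fun[OF Eq_fun[OF Eq_arg[OF Eq_ext]]])
        let ?E' = "Star Nat # ?E" and ?\<Gamma>' = "lift_fms ?\<Gamma>"
        have "HA ?E' ?\<Gamma>' (Eq \<sigma> (bind_stop (lift (?l ?V) 0) ?KB (Var 3) (Var 2) \<cdot> Var 0)
          (?KB \<cdot> (lift (?l ?V) 0 \<cdot> (Hat Nat \<cdot> Var 0)) \<cdot> Var 3 \<cdot> Var 2 \<cdot> Var 0))"
          by (rule bind_stop_eq) (use ty in auto)
        also have "HA ?E' ?\<Gamma>' (Eq \<sigma> (?KB \<cdot> (lift (?l ?V) 0 \<cdot> (Hat Nat \<cdot> Var 0)) \<cdot> Var 3 \<cdot> Var 2 \<cdot> Var 0) (Var 3 \<cdot> Var 0))"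
          using Eq_reds[of ?E' "?KB \<cdot> (lift (?l ?V) 0 \<cdot> (Hat Nat \<cdot> Var 0)) \<cdot> Var 3 \<cdot> Var 2 \<cdot> Var 0" \<sigma> ?\<Gamma>' "Suc (Suc (Suc 0))"] ty
          by (simp add: eval_nat_numeral)
        finally show "HA ?E' ?\<Gamma>' (Eq \<sigma> (lift (bind_stop (?l ?V) ?KB (Var 2) (Var 1)) 0 \<cdot> Var 0) (lift (Var 2) 0 \<cdot> Var 0))"
          by (simp add: eval_nat_numeral)
      qed (use ty in \<open>simp_all add: infer_bind_stop[of _ _ _ \<sigma>]\<close>)
      finally show "HA ?E ?\<Gamma> (Eq \<sigma> (?l (bind_rec \<sigma> ?V ?B ?KB) \<cdot> Var 2 \<cdot> Var 1 \<cdot> Var 0) (?l ?B \<cdot> Var 2 \<cdot> Var 1 \<cdot> Var 0))"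
        by simp
    qed (use ty in auto)
  qed
qed (use ty in auto)

text \<open>Bind with the family of \<open>regular_Psi\<close>. The clause of the translation does
  not abstract over \<open>s\<close>, so it equals \<open>bind_rec\<close> only by
  extensionality.\<close>

lemma rel_alpha:
  assumes r: "HA E \<Gamma> (rel \<sigma> a Nat u n)"
    and ty: "infer E u = Some (trN Nat \<sigma>)" "infer E n = Some Nat" "infer E a = Some (Nat \<rightarrow> Nat)"
  shows "HA E \<Gamma> (rel \<sigma> a Nat (tr_alpha \<sigma> \<cdot> u) (a \<cdot> n))"
proof (rule rel_NatI)
  let ?V = "Val Nat \<sigma> u" and ?B = "BR Nat \<sigma> u"
  let ?W = "Lam (Nat \<rightarrow> Nat) (Var 0 \<cdot> (lift ?V 0 \<cdot> Var 0))"
  let ?C = "Lam (G_ty Nat \<sigma>) (Lam (H_ty Nat \<sigma>)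
    (lift (lift ?B 0) 0 \<cdot> bind_stop (lift (lift ?V 0) 0) (Psi Nat \<sigma>) (Var 1) (Var 0) \<cdot> Var 0))"
  let ?KV = "Lam Nat (Lam (Nat \<rightarrow> Nat) (Var 0 \<cdot> Var 1))"
  show "HA E \<Gamma> (Eq (trN Nat \<sigma>) (tr_alpha \<sigma> \<cdot> u) (mkN Nat \<sigma> ?W ?C))"
    using Eq_reds[of E "tr_alpha \<sigma> \<cdot> u" "trN Nat \<sigma>" \<Gamma> "Suc 0"] ty
    by (simp add: tr_alpha_def bind_stop_def eval_nat_numeral)
  have "HA E \<Gamma> (Eq Nat (?W \<cdot> a) (a \<cdot> (?V \<cdot> a)))"
    using Eq_beta[of "Nat \<rightarrow> Nat" E "Var 0 \<cdot> (lift ?V 0 \<cdot> Var 0)" Nat a \<Gamma>] ty by simp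
  also have "HA E \<Gamma> (Eq Nat (a \<cdot> (?V \<cdot> a)) (a \<cdot> n))"
    by (rule Eq_arg[OF rel_NatE(2)[OF r]]) (rule ty)
  finally show "HA E \<Gamma> (Eq Nat (?W \<cdot> a) (a \<cdot> n))" .
  have K: "HA E \<Gamma> (All Nat (regular \<sigma> (lift ?KV 0 \<cdot> Var 0) (lift (Psi Nat \<sigma>) 0 \<cdot> Var 0)))"
  proof (rule HA.AllI, rule regular_cong)
    let ?E = "Nat # E" and ?\<Gamma> = "lift_fms \<Gamma>"
    show "HA ?E ?\<Gamma> (regular \<sigma> (Lam (Nat \<rightarrow> Nat) (Var 0 \<cdot> lift (Var 0) 0)) (Psi Nat \<sigma> \<cdot> Var 0))"
      by (rule regular_Psi) simp
    show "HA ?E ?\<Gamma> (Eq (Val_ty Nat) (Lam (Nat \<rightarrow> Nat) (Var 0 \<cdot> lift (Var 0) 0)) (lift ?KV 0 \<cdot> Var 0))"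
      using Eq_sym[OF Eq_reds[of ?E "?KV \<cdot> Var 0" "Val_ty Nat" ?\<Gamma> "Suc 0"]] by simp
    show "HA ?E ?\<Gamma> (Eq (BR_ty Nat \<sigma>) (Psi Nat \<sigma> \<cdot> Var 0) (lift (Psi Nat \<sigma>) 0 \<cdot> Var 0))"
      by (simp add: Eq_refl)
  qed
  have C: "infer E ?C = Some (BR_ty Nat \<sigma>)"
    using ty by (simp add: infer_bind_stop[of _ _ _ \<sigma>])
  show "HA E \<Gamma> (regular \<sigma> ?W ?C)"
  proof (rule regular_cong[OF regular_bind[OF rel_NatE(1)[OF r] K]])
    show "HA E \<Gamma> (Eq (Val_ty Nat) (bind_val ?V ?KV) ?W)"
      unfolding bind_val_def
    proof (rule Eq_Lam)
      show "HA ((Nat \<rightarrow> Nat) # E) (lift_fms \<Gamma>) (Eq Nat (lift ?KV 0 \<cdot> (lift ?V 0 \<cdot> Var 0) \<cdot> Var 0) (Var 0 \<cdot> (lift ?V 0 \<cdot> Var 0)))"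
        using Eq_reds[of "(Nat \<rightarrow> Nat) # E" "?KV \<cdot> (lift ?V 0 \<cdot> Var 0) \<cdot> Var 0" Nat "lift_fms \<Gamma>" "Suc (Suc 0)"] ty by simp
    qed
    show "HA E \<Gamma> (Eq (BR_ty Nat \<sigma>) (bind_rec \<sigma> ?V ?B (Psi Nat \<sigma>)) ?C)"
    proof (rule BR_ext)
      let ?E = "Star Nat # H_ty Nat \<sigma> # G_ty Nat \<sigma> # E" and ?\<Gamma> = "lift_fms (lift_fms (lift_fms \<Gamma>))"
      let ?l = "\<lambda>t. lift (lift (lift t 0) 0) 0"
      let ?R = "?l ?B \<cdot> bind_stop (?l ?V) (Psi Nat \<sigma>) (Var 2) (Var 1) \<cdot> Var 1 \<cdot> Var 0"
      have "HA ?E ?\<Gamma> (Eq \<sigma> (bind_rec \<sigma> (?l ?V) (?l ?B) (Psi Nat \<sigma>) \<cdot> Var 2 \<cdot> Var 1 \<cdot> Var 0) ?R)"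
        by (rule bind_rec_eq) (use ty in auto)
      moreover have "HA ?E ?\<Gamma> (Eq \<sigma> (?l ?C \<cdot> Var 2 \<cdot> Var 1 \<cdot> Var 0) ?R)"
        using Eq_reds[of ?E "?l ?C \<cdot> Var 2 \<cdot> Var 1 \<cdot> Var 0" \<sigma> ?\<Gamma> "Suc (Suc 0)"] ty
        by (simp add: infer_bind_stop[of _ _ _ \<sigma>] eval_nat_numeral)
      ultimately have "HA ?E ?\<Gamma> (Eq \<sigma> (bind_rec \<sigma> (?l ?V) (?l ?B) (Psi Nat \<sigma>) \<cdot> Var 2 \<cdot> Var 1 \<cdot> Var 0)
        (?l ?C \<cdot> Var 2 \<cdot> Var 1 \<cdot> Var 0))"
        by (rule Eq_trans[OF _ Eq_sym])
      then show "HA ?E ?\<Gamma> (Eq \<sigma> (?l (bind_rec \<sigma> ?V ?B (Psi Nat \<sigma>)) \<cdot> Var 2 \<cdot> Var 1 \<cdot> Var 0) (?l ?C \<cdot> Var 2 \<cdot> Var 1 \<cdot> Var 0))"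
        by simp
    qed (use ty C in auto)
  qed (use ty in auto)
qed (use ty in \<open>auto simp: infer_bind_stop[of _ _ _ \<sigma>]\<close>)

section \<open>The translation of the recursors\<close>

text \<open>The number of argument binders in \<open>tr_Rec\<close> depends on the type, so single
  lifts do not suffice to move a term below all of them.\<close>

definition lifts :: "nat \<Rightarrow> tm \<Rightarrow> tm" where
  "lifts n t = ((\<lambda>t. lift t 0) ^^ n) t"

lemma lifts_0 [simp]: "lifts 0 t = t"
  by (simp add: lifts_def)

lemma lifts_Suc: "lifts (Suc n) t = lift (lifts n t) 0"
  by (simp add: lifts_def)

lemma lifts_4:
  "lifts (Suc (Suc (Suc (Suc 0)))) = (\<lambda>t. lift (lift (lift (lift t 0) 0) 0) 0)"
  by (simp add: fun_eq_iff lifts_Suc)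

lemma lifts_lift: "lifts n (lift t 0) = lift (lifts n t) 0"
  by (induction n) (simp_all add: lifts_Suc)

lemma lift_lifts: "lift (lifts n t) n = lifts n (lift t 0)"
  by (induction n) (simp_all add: lifts_Suc lifts_lift)

lemma subst_lifts: "subst (lifts (Suc n) t) s n = lifts n t"
  using subst_lift[of "lifts n t" n s] by (simp add: lift_lifts lifts_Suc lifts_lift)

lemma lift_lifts_le: "lift (lifts n t) (n + k) = lifts n (lift t k)"
  by (induction n) (simp_all add: lifts_Suc)

lemma subst_lifts_ge: "subst (lifts n t) (lifts n s) (n + k) = lifts n (subst t s k)"
  by (induction n) (simp_all add: lifts_Suc subst_lift_0)

lemma lifts_Var [simp]: "lifts n (Var i) = Var (n + i)"
  by (induction n) (simp_all add: lifts_Suc)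

lemma lifts_App [simp]: "lifts n (t \<cdot> u) = lifts n t \<cdot> lifts n u"
  by (induction n) (simp_all add: lifts_Suc)

lemma lifts_Con [simp]: "lifts n (Con c) = Con c"
  by (induction n) (simp_all add: lifts_Suc)

lemma infer_lifts [simp]: "length Ts = n \<Longrightarrow> infer (Ts @ E) (lifts n t) = infer E t"
  by (induction n arbitrary: Ts) (auto simp: lifts_Suc length_Suc_conv)

lemma Apps_Nil [simp]: "Apps t [] = t" by (simp add: Apps_def)

lemma Apps_Cons: "Apps t (u # us) = Apps (t \<cdot> u) us" by (simp add: Apps_def)

lemma Apps_snoc [simp]: "Apps t (us @ [u]) = Apps t us \<cdot> u" by (simp add: Apps_def)

lemma lift_Apps [simp]: "lift (Apps t us) k = Apps (lift t k) (map (\<lambda>u. lift u k) us)"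
  by (induction us rule: rev_induct) simp_all

lemma subst_Apps [simp]: "subst (Apps t us) s k = Apps (subst t s k) (map (\<lambda>u. subst u s k) us)"
  by (induction us rule: rev_induct) simp_all

lemma Lams_Nil [simp]: "Lams [] t = t" by (simp add: Lams_def)

lemma Lams_Cons [simp]: "Lams (T # Ts) t = Lam T (Lams Ts t)" by (simp add: Lams_def)

lemma lift_Lams [simp]: "lift (Lams Ts t) k = Lams Ts (lift t (length Ts + k))"
  by (induction Ts arbitrary: k) simp_all

lemma subst_Lams [simp]: "subst (Lams Ts t) s k = Lams Ts (subst t (lifts (length Ts) s) (length Ts + k))"
  by (induction Ts arbitrary: k s) (simp_all add: lifts_Suc lifts_lift)

lemma infer_Apps:
  "list_all2 (\<lambda>u T. infer E u = Some T) us Ts \<Longrightarrow> infer E t = Some (foldr (\<rightarrow>) Ts U) \<Longrightarrow>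
    infer E (Apps t us) = Some U"
  by (induction us Ts arbitrary: t rule: list_all2_induct) (simp_all add: Apps_Cons)

lemma infer_Lams:
  "infer (rev Ts @ E) t = Some U \<Longrightarrow> infer E (Lams Ts t) = Some (foldr (\<rightarrow>) Ts U)"
  by (induction Ts arbitrary: E) simp_all

text \<open>The pair in the body of \<open>tr_Rec\<close>, with arbitrary terms in place of the
  recursor, the number and the arguments. In this form it is stable under lifting and substitution,
  which act on the parameters only.\<close>

definition rec_core :: "ty \<Rightarrow> tm \<Rightarrow> tm \<Rightarrow> tm list \<Rightarrow> tm" where
  "rec_core \<sigma> q x ws = mkN Nat \<sigma>
    (Lam (Nat \<rightarrow> Nat)
      (Val Nat \<sigma> (Apps (lift q 0 \<cdot> (Val Nat \<sigma> (lift x 0) \<cdot> Var 0)) (map (\<lambda>w. lift w 0) ws)) \<cdot> Var 0))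
    (Lam (G_ty Nat \<sigma>) (Lam (H_ty Nat \<sigma>) (Lam (Star Nat)
      (BR Nat \<sigma> (lifts 3 x) \<cdot>
        Lam (Star Nat)
          (BR Nat \<sigma> (Apps (lifts 4 q \<cdot> (Val Nat \<sigma> (lifts 4 x) \<cdot> (Hat Nat \<cdot> Var 0))) (map (lifts 4) ws)) \<cdot>
            Var 3 \<cdot> Var 2 \<cdot> Var 0) \<cdot>
        Var 1 \<cdot> Var 0))))"

lemma lift_rec_core: "lift (rec_core \<sigma> q x ws) k = rec_core \<sigma> (lift q k) (lift x k) (map (\<lambda>w. lift w k) ws)"
  by (simp add: rec_core_def eval_nat_numeral lifts_Suc comp_def)

lemma subst_rec_core:
  "subst (rec_core \<sigma> q x ws) s k = rec_core \<sigma> (subst q s k) (subst x s k) (map (\<lambda>w. subst w s k) ws)"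
  by (simp add: rec_core_def eval_nat_numeral lifts_Suc comp_def subst_lift_0)

text \<open>
  The value of \<open>tr_Rec\<close> at \<open>a\<close>, \<open>F\<close>, \<open>x\<close> and the arguments \<open>vs\<close>, which still expects arguments of the
  types \<open>Ts\<close>; here \<open>q\<close> is \<open>Rec (a, \<lambda>k. F k\<degree>)\<close>.
\<close>

definition rec_fun :: "ty \<Rightarrow> ty list \<Rightarrow> tm \<Rightarrow> tm \<Rightarrow> tm list \<Rightarrow> tm" where
  "rec_fun \<sigma> Ts q x vs = (let n = length Ts in
    Lams (map (tr_ty Nat \<sigma>) Ts)
      (rec_core \<sigma> (lifts n q) (lifts n x) (map (lifts n) vs @ map Var (rev [0..<n]))))"

lemma lift_rec_fun: "lift (rec_fun \<sigma> Ts q x vs) k = rec_fun \<sigma> Ts (lift q k) (lift x k) (map (\<lambda>v. lift v k) vs)"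
  by (auto simp: rec_fun_def Let_def lift_rec_core lift_lifts_le comp_def
    intro!: arg_cong2[where f = Lams] arg_cong[where f = "rec_core _ _ _"] arg_cong2[where f = append])

lemma subst_rec_fun:
  "subst (rec_fun \<sigma> Ts q x vs) s k = rec_fun \<sigma> Ts (subst q s k) (subst x s k) (map (\<lambda>v. subst v s k) vs)"
  by (auto simp: rec_fun_def Let_def subst_rec_core subst_lifts_ge comp_def
    intro!: arg_cong2[where f = Lams] arg_cong[where f = "rec_core _ _ _"] arg_cong2[where f = append])

text \<open>An identity of terms, without appeal to the calculus: contracting the outermost
  abstraction turns the first expected argument into a given one. It drives the induction on the
  type in \<open>rel_rec_fun\<close>.\<close>

lemma red_rec_fun: "red (rec_fun \<sigma> (T # Ts) q x vs \<cdot> v) = rec_fun \<sigma> Ts q x (vs @ [v])"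
  by (auto simp: rec_fun_def Let_def subst_rec_core subst_lifts comp_def
    intro!: arg_cong2[where f = Lams] arg_cong[where f = "rec_core _ _ _"] arg_cong2[where f = append])

text \<open>Only the indices have to be matched. The two occurrences of \<open>Var 2\<close> differ:
  outside the inner abstraction it is the initial value \<open>a\<close>, inside it is the step
  function \<open>F\<close>.\<close>

lemma tr_Rec_rec_fun:
  "tr_Rec Nat \<sigma> \<eta> = Lam (tr_ty Nat \<sigma> \<eta>) (Lam (trN Nat \<sigma> \<rightarrow> tr_ty Nat \<sigma> \<eta> \<rightarrow> tr_ty Nat \<sigma> \<eta>) (Lam (trN Nat \<sigma>)
    (rec_fun \<sigma> (arg_tys \<eta>)
      (Rec (tr_ty Nat \<sigma> \<eta>) \<cdot> Var 2 \<cdot> Lam Nat (Var 2 \<cdot> tr_num Nat \<sigma> (Var 0))) (Var 0) [])))"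
proof -
  have L: "lifts m (Lam Nat (Var (Suc i) \<cdot> tr_num Nat \<sigma> (Var 0))) =
      Lam Nat (Var (Suc (m + i)) \<cdot> tr_num Nat \<sigma> (Var 0))" for m i
    by (induction m) (simp_all add: lifts_Suc)
  have L': "lifts m (Lam Nat (Var 2 \<cdot> tr_num Nat \<sigma> (Var 0))) =
      Lam Nat (Var (Suc (Suc m)) \<cdot> tr_num Nat \<sigma> (Var 0))" for m
    using L[of m "Suc 0"] by (simp add: eval_nat_numeral)
  have R: "map (lifts d) (map Var (rev [0..<n])) = map Var (rev [d..<n + d])" for d n
    using arg_cong[OF map_add_upt[of d n], of "map Var"] by (simp add: comp_def add.commute[of d] flip: rev_map)
  have R1: "map (\<lambda>w. lift w 0) (map Var (rev [0..<n])) = map Var (rev [1..<n + 1])" for n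
    using R[of 1] by (simp add: lifts_Suc comp_def)
  show ?thesis
    unfolding tr_Rec_def rec_fun_def rec_core_def Let_def list.map append.simps R R1
    by (simp add: L L' add.commute del: upt_Suc)
qed

lemma tr_ty_arg_tys:
  "arith_ty \<eta> \<Longrightarrow> tr_ty Nat \<sigma> \<eta> = foldr (\<rightarrow>) (map (tr_ty Nat \<sigma>) (arg_tys \<eta>)) (trN Nat \<sigma>)"
  by (induction \<eta>) simp_all

lemma infer_rec_core:
  assumes "infer E x = Some (trN Nat \<sigma>)" "infer E q = Some (Nat \<rightarrow> foldr (\<rightarrow>) Ws (trN Nat \<sigma>))"
    "list_all2 (\<lambda>w W. infer E w = Some W) ws Ws"
  shows "infer E (rec_core \<sigma> q x ws) = Some (trN Nat \<sigma>)"
proof -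
  have "infer ((Nat \<rightarrow> Nat) # E)
      (Apps (lift q 0 \<cdot> (Val Nat \<sigma> (lift x 0) \<cdot> Var 0)) (map (\<lambda>w. lift w 0) ws)) = Some (trN Nat \<sigma>)"
    by (rule infer_Apps[of _ _ Ws]) (use assms in \<open>simp_all add: list_all2_map1\<close>)
  moreover have "infer (Star Nat # Star Nat # H_ty Nat \<sigma> # G_ty Nat \<sigma> # E)
      (Apps (lifts 4 q \<cdot> (Val Nat \<sigma> (lifts 4 x) \<cdot> (Hat Nat \<cdot> Var 0))) (map (lifts 4) ws)) = Some (trN Nat \<sigma>)"
    by (rule infer_Apps[of _ _ Ws]) (use assms in \<open>simp_all add: list_all2_map1 eval_nat_numeral lifts_Suc\<close>)
  ultimately show ?thesis
    using assms by (simp add: rec_core_def eval_nat_numeral lifts_Suc)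
qed

lemma infer_rec_fun:
  assumes "infer E x = Some (trN Nat \<sigma>)" "infer E q = Some (Nat \<rightarrow> foldr (\<rightarrow>) Vs (tr_ty Nat \<sigma> \<eta>))"
    "list_all2 (\<lambda>v V. infer E v = Some V) vs Vs" "arith_ty \<eta>"
  shows "infer E (rec_fun \<sigma> (arg_tys \<eta>) q x vs) = Some (tr_ty Nat \<sigma> \<eta>)"
proof -
  let ?Ts = "map (tr_ty Nat \<sigma>) (arg_tys \<eta>)" and ?n = "length (arg_tys \<eta>)"
  have lift: "infer (rev ?Ts @ E) (lifts ?n t) = infer E t" for t
    by (rule infer_lifts) simp
  have "list_all2 (\<lambda>v V. infer (rev ?Ts @ E) v = Some V) (map (lifts ?n) vs) Vs"
    using assms(3) by (simp add: list_all2_map1 lift)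
  moreover have "list_all2 (\<lambda>v V. infer (rev ?Ts @ E) v = Some V) (map Var (rev [0..<?n])) ?Ts"
    by (auto simp: list_all2_conv_all_nth nth_append rev_nth)
  ultimately have "infer (rev ?Ts @ E) (rec_core \<sigma> (lifts ?n q) (lifts ?n x)
      (map (lifts ?n) vs @ map Var (rev [0..<?n]))) = Some (trN Nat \<sigma>)"
    using assms by (intro infer_rec_core[where Ws = "Vs @ ?Ts"] list_all2_appendI) (simp_all add: lift tr_ty_arg_tys)
  from infer_Lams[OF this] show ?thesis
    using assms(4) by (simp add: rec_fun_def Let_def tr_ty_arg_tys)
qed

lemma infer_pairD:
  assumes "infer E (pair T U a b) = Some V" shows "infer E a = Some T" "infer E b = Some U"
  using assms by (auto split: option.splits ty.splits if_splits)

text \<open>Bind once more, now with the family of pairs \<open>r[n]\<close>, regular by hypothesis.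
  The value at \<open>a\<close> is that of \<open>r[n]\<close> for \<open>n\<close> the value of
  \<open>x\<close>, and this \<open>n\<close> equals \<open>m\<close>.\<close>

lemma rel_rec_core:
  assumes x: "HA E \<Gamma> (rel \<sigma> a Nat x m)"
    and q: "HA E \<Gamma> (All Nat (rel \<sigma> (lift a 0) Nat (Apps (lift q 0 \<cdot> Var 0) (map (\<lambda>w. lift w 0) ws))
      (Apps (lift q' 0 \<cdot> Var 0) (map (\<lambda>w. lift w 0) ws'))))"
    and ty: "infer E x = Some (trN Nat \<sigma>)" "infer E m = Some Nat" "infer E a = Some (Nat \<rightarrow> Nat)"
      "infer E q = Some (Nat \<rightarrow> foldr (\<rightarrow>) Ws (trN Nat \<sigma>))"
      "list_all2 (\<lambda>w W. infer E w = Some W) ws Ws"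
      "infer E q' = Some (Nat \<rightarrow> foldr (\<rightarrow>) Ws' Nat)"
      "list_all2 (\<lambda>w W. infer E w = Some W) ws' Ws'"
  shows "HA E \<Gamma> (rel \<sigma> a Nat (rec_core \<sigma> q x ws) (Apps (q' \<cdot> m) ws'))"
proof (rule rel_NatI)
  let ?V = "Val Nat \<sigma> x" and ?B = "BR Nat \<sigma> x"
  let ?r = "\<lambda>m. Apps (q \<cdot> m) ws"
  let ?p = "Apps (lift q 0 \<cdot> Var 0) (map (\<lambda>w. lift w 0) ws)"
  let ?p' = "Apps (lift q' 0 \<cdot> Var 0) (map (\<lambda>w. lift w 0) ws')"
  let ?KV = "Lam Nat (Val Nat \<sigma> ?p)" and ?KB = "Lam Nat (BR Nat \<sigma> ?p)"
  let ?W = "Lam (Nat \<rightarrow> Nat) (Val Nat \<sigma> (Apps (lift q 0 \<cdot> (lift ?V 0 \<cdot> Var 0)) (map (\<lambda>w. lift w 0) ws)) \<cdot> Var 0)"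
  let ?C = "Lam (G_ty Nat \<sigma>) (Lam (H_ty Nat \<sigma>) (Lam (Star Nat)
      (lifts 3 ?B \<cdot>
        Lam (Star Nat)
          (BR Nat \<sigma> (Apps (lifts 4 q \<cdot> (lifts 4 ?V \<cdot> (Hat Nat \<cdot> Var 0))) (map (lifts 4) ws)) \<cdot>
            Var 3 \<cdot> Var 2 \<cdot> Var 0) \<cdot>
        Var 1 \<cdot> Var 0)))"
  have core: "rec_core \<sigma> q x ws = mkN Nat \<sigma> ?W ?C"
    by (simp add: rec_core_def)
  have tcore: "infer E (mkN Nat \<sigma> ?W ?C) = Some (trN Nat \<sigma>)"
    unfolding core[symmetric] by (rule infer_rec_core) (use ty in auto)
  then show "HA E \<Gamma> (Eq (trN Nat \<sigma>) (rec_core \<sigma> q x ws) (mkN Nat \<sigma> ?W ?C))"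
    unfolding core by (rule Eq_refl)
  from tcore have W: "infer E ?W = Some (Val_ty Nat)" and C: "infer E ?C = Some (BR_ty Nat \<sigma>)"
    by (blast dest: infer_pairD)+
  show "infer E ?W = Some (Val_ty Nat)" "infer E ?C = Some (BR_ty Nat \<sigma>)" by (rule W, rule C)
  have p: "infer (Nat # E) ?p = Some (trN Nat \<sigma>)"
    by (rule infer_Apps[of _ _ Ws]) (use ty in \<open>simp_all add: list_all2_map1\<close>)
  have p': "infer (Nat # E) ?p' = Some Nat"
    by (rule infer_Apps[of _ _ Ws']) (use ty in \<open>simp_all add: list_all2_map1\<close>)
  have r: "infer E (?r (?V \<cdot> a)) = Some (trN Nat \<sigma>)"
    by (rule infer_Apps[of _ _ Ws]) (use ty in simp_all)
  have "HA E \<Gamma> (Eq Nat (?W \<cdot> a) (Val Nat \<sigma> (?r (?V \<cdot> a)) \<cdot> a))"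
    using Eq_red[of E "?W \<cdot> a" Nat \<Gamma>] W ty by (simp add: comp_def)
  \<comment> \<open>The hypothesis on the family is used at the number \<open>V(a)\<close>; only the
    next equation replaces it by \<open>m\<close>.\<close>
  also have "HA E \<Gamma> (Eq Nat (Val Nat \<sigma> (?r (?V \<cdot> a)) \<cdot> a) (Apps (q' \<cdot> (?V \<cdot> a)) ws'))"
    using HA.AllE[OF q, of "?V \<cdot> a"] ty rel_NatE(2)[of E \<Gamma> \<sigma> a "?r (?V \<cdot> a)" "Apps (q' \<cdot> (?V \<cdot> a)) ws'"]
    by (simp add: comp_def)
  also have "HA E \<Gamma> (Eq Nat (Apps (q' \<cdot> (?V \<cdot> a)) ws') (Apps (q' \<cdot> m) ws'))"
    using Eq_subst[OF rel_NatE(2)[OF x] p'] by (simp add: comp_def)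
  finally show "HA E \<Gamma> (Eq Nat (?W \<cdot> a) (Apps (q' \<cdot> m) ws'))" .
  have "HA (Nat # E) (lift_fms \<Gamma>) (regular \<sigma> (Val Nat \<sigma> ?p) (BR Nat \<sigma> ?p))"
    by (rule rel_NatE(1)[OF All_elim_Var[OF q]])
  then have reg: "HA E \<Gamma> (regular \<sigma> (bind_val ?V ?KV) (bind_rec \<sigma> ?V ?B ?KB))"
    by (rule regular_bind_Lam[OF rel_NatE(1)[OF x]]) (use ty p in auto)
  show "HA E \<Gamma> (regular \<sigma> ?W ?C)"
  proof (rule regular_cong[OF reg])
    show "HA E \<Gamma> (Eq (Val_ty Nat) (bind_val ?V ?KV) ?W)"
      unfolding bind_val_def
    proof (rule Eq_Lam)
      let ?t = "lift ?KV 0 \<cdot> (lift ?V 0 \<cdot> Var 0) \<cdot> Var 0"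
      \<comment> \<open>The type of the lifted \<open>?KV\<close> is taken over from
        \<open>?KV\<close> by \<open>infer_lift_0\<close>, with the lift kept folded over the
        abstraction.\<close>
      have "infer E ?KV = Some (Nat \<rightarrow> Val_ty Nat)" using p by simp
      then have "infer ((Nat \<rightarrow> Nat) # E) (lift ?KV 0) = Some (Nat \<rightarrow> Val_ty Nat)"
        by (simp only: infer_lift_0)
      then have "infer ((Nat \<rightarrow> Nat) # E) ?t = Some Nat"
        using ty by (simp del: lift.simps(4))
      from Eq_red[OF this]
      show "HA ((Nat \<rightarrow> Nat) # E) (lift_fms \<Gamma>) (Eq Nat ?t
          (Val Nat \<sigma> (Apps (lift q 0 \<cdot> (lift ?V 0 \<cdot> Var 0)) (map (\<lambda>w. lift w 0) ws)) \<cdot> Var 0))"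
        by (simp add: comp_def)
    qed
    show "HA E \<Gamma> (Eq (BR_ty Nat \<sigma>) (bind_rec \<sigma> ?V ?B ?KB) ?C)"
    proof (rule BR_ext)
      let ?E = "Star Nat # H_ty Nat \<sigma> # G_ty Nat \<sigma> # E" and ?\<Gamma> = "lift_fms (lift_fms (lift_fms \<Gamma>))"
      let ?l = "\<lambda>t. lift (lift (lift t 0) 0) 0"
      let ?S = "Lam (Star Nat)
          (BR Nat \<sigma> (Apps (lifts 4 q \<cdot> (lifts 4 ?V \<cdot> (Hat Nat \<cdot> Var 0))) (map (lifts 4) ws)) \<cdot>
            Var 3 \<cdot> Var 2 \<cdot> Var 0)"
      have KB: "infer E ?KB = Some (Nat \<rightarrow> BR_ty Nat \<sigma>)" using p by simp
      have "HA ?E ?\<Gamma> (Eq \<sigma> (bind_rec \<sigma> (?l ?V) (?l ?B) (?l ?KB) \<cdot> Var 2 \<cdot> Var 1 \<cdot> Var 0)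
         (?l ?B \<cdot> bind_stop (?l ?V) (?l ?KB) (Var 2) (Var 1) \<cdot> Var 1 \<cdot> Var 0))"
        by (rule bind_rec_eq) (use ty KB in \<open>simp_all only: infer_lift_0\<close>, simp_all)
      also have "HA ?E ?\<Gamma> (Eq \<sigma> (?l ?B \<cdot> bind_stop (?l ?V) (?l ?KB) (Var 2) (Var 1) \<cdot> Var 1 \<cdot> Var 0)
         (?l ?B \<cdot> ?S \<cdot> Var 1 \<cdot> Var 0))"
      proof (rule Eq_fun[OF Eq_fun[OF Eq_arg[OF bind_stop_ext]]])
        let ?t = "lift (?l ?KB) 0 \<cdot> (lift (?l ?V) 0 \<cdot> (Hat Nat \<cdot> Var 0)) \<cdot> lift (Var 2) 0 \<cdot> lift (Var 1) 0 \<cdot> Var 0"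
        have "infer (Star Nat # ?E) (lift (?l ?KB) 0) = Some (Nat \<rightarrow> BR_ty Nat \<sigma>)"
          using KB by (simp only: infer_lift_0)
        then have "infer (Star Nat # ?E) ?t = Some \<sigma>"
          using ty by (simp del: lift.simps(4))
        from Eq_red[OF this]
        show "HA (Star Nat # ?E) (lift_fms ?\<Gamma>) (Eq \<sigma> ?t
          (BR Nat \<sigma> (Apps (lifts 4 q \<cdot> (lifts 4 ?V \<cdot> (Hat Nat \<cdot> Var 0))) (map (lifts 4) ws)) \<cdot>
            Var 3 \<cdot> Var 2 \<cdot> Var 0))"
          by (simp add: comp_def eval_nat_numeral lifts_Suc lifts_4)
      qed (use ty in auto)
      also have "HA ?E ?\<Gamma> (Eq \<sigma> (?l ?B \<cdot> ?S \<cdot> Var 1 \<cdot> Var 0) (?l ?C \<cdot> Var 2 \<cdot> Var 1 \<cdot> Var 0))"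
      proof (rule Eq_sym)
        have "infer ?E (?l ?C) = Some (BR_ty Nat \<sigma>)" using C by (simp only: infer_lift_0)
        then have "infer ?E (?l ?C \<cdot> Var 2 \<cdot> Var 1 \<cdot> Var 0) = Some \<sigma>"
          by (simp del: lift.simps(4))
        from Eq_reds[OF this, of ?\<Gamma> "Suc (Suc (Suc 0))"]
        show "HA ?E ?\<Gamma> (Eq \<sigma> (?l ?C \<cdot> Var 2 \<cdot> Var 1 \<cdot> Var 0) (?l ?B \<cdot> ?S \<cdot> Var 1 \<cdot> Var 0))"
          by (simp add: comp_def eval_nat_numeral lifts_Suc lifts_4)
      qed
      finally show "HA ?E ?\<Gamma> (Eq \<sigma> (?l (bind_rec \<sigma> ?V ?B ?KB) \<cdot> Var 2 \<cdot> Var 1 \<cdot> Var 0) (?l ?C \<cdot> Var 2 \<cdot> Var 1 \<cdot> Var 0))"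
        by (simp only: lift_bind_rec)
    qed (use ty p C in auto)
  qed
qed (use ty in auto)

text \<open>The clause for recursors consumes all arguments before it yields a pair, whereas the
  relation supplies related arguments one at a time. The induction on the type therefore collects
  them in \<open>vs\<close> and \<open>vs'\<close> until the base type is reached.\<close>

lemma rel_rec_fun:
  assumes "arith_ty \<eta>" "HA E \<Gamma> (rel \<sigma> a Nat x m)"
    "HA E \<Gamma> (All Nat (rel \<sigma> (lift a 0) \<eta> (Apps (lift q 0 \<cdot> Var 0) (map (\<lambda>w. lift w 0) vs))
      (Apps (lift q' 0 \<cdot> Var 0) (map (\<lambda>w. lift w 0) vs'))))"
    "infer E x = Some (trN Nat \<sigma>)" "infer E m = Some Nat" "infer E a = Some (Nat \<rightarrow> Nat)"
    "infer E q = Some (Nat \<rightarrow> foldr (\<rightarrow>) Vs (tr_ty Nat \<sigma> \<eta>))"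
    "list_all2 (\<lambda>v V. infer E v = Some V) vs Vs"
    "infer E q' = Some (Nat \<rightarrow> foldr (\<rightarrow>) Vs' \<eta>)"
    "list_all2 (\<lambda>v V. infer E v = Some V) vs' Vs'"
  shows "HA E \<Gamma> (rel \<sigma> a \<eta> (rec_fun \<sigma> (arg_tys \<eta>) q x vs) (Apps (q' \<cdot> m) vs'))"
  using assms
proof (induction \<eta> arbitrary: E \<Gamma> a x m q q' vs vs' Vs Vs')
  case Nat
  have "rec_fun \<sigma> (arg_tys Nat) q x vs = rec_core \<sigma> q x vs"
    by (simp add: rec_fun_def list.map_ident_strong)
  then show ?case using rel_rec_core[OF Nat(2-6) _ Nat(8) _ Nat(10)] Nat(7,9) by simp
next
  case (Fun T U)
  let ?l = "\<lambda>t. lift (lift t 0) 0"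
  let ?E = "T # tr_ty Nat \<sigma> T # E"
  let ?\<Gamma> = "rel \<sigma> (?l a) T (Var 1) (Var 0) # lift_fms (lift_fms \<Gamma>)"
  let ?vs = "map ?l vs" and ?vs' = "map ?l vs'"
  have ar: "arith_ty T" "arith_ty U" using Fun.prems(1) by auto
  have x: "HA ?E ?\<Gamma> (rel \<sigma> (?l a) Nat (?l x) (?l m))"
    using HA_weaken_Cons[OF HA_lift[OF HA_lift[OF Fun.prems(2)]]] by (simp only: lift_rel)
  have q: "HA ?E ?\<Gamma> (All Nat (rel \<sigma> (lift (?l a) 0) U
      (Apps (lift (?l q) 0 \<cdot> Var 0) (map (\<lambda>w. lift w 0) (?vs @ [Var 1])))
      (Apps (lift (?l q') 0 \<cdot> Var 0) (map (\<lambda>w. lift w 0) (?vs' @ [Var 0])))))"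
  proof (rule HA.AllI)
    let ?E' = "Nat # ?E" and ?\<Gamma>' = "lift_fms ?\<Gamma>"
    have "HA ?E' ?\<Gamma>' (rel \<sigma> (lift (?l a) 0) (T \<rightarrow> U) (Apps (lift (?l q) 0 \<cdot> Var 0) (map (\<lambda>w. lift w 0) ?vs))
        (Apps (lift (?l q') 0 \<cdot> Var 0) (map (\<lambda>w. lift w 0) ?vs')))"
      using All_elim_Var[OF HA_weaken_Cons[where B = "rel \<sigma> (?l a) T (Var 1) (Var 0)", OF HA_lift[OF HA_lift[OF Fun.prems(3)]], simplified lift_fm.simps lift_rel]]
      by (simp add: comp_def del: rel.simps)
    moreover have "HA ?E' ?\<Gamma>' (rel \<sigma> (lift (?l a) 0) T (Var 2) (Var 1))"
      by (rule HA.Hyp) (use Fun.prems(6) ar in \<open>auto simp: eval_nat_numeral intro!: wf_rel\<close>)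
    ultimately show "HA ?E' ?\<Gamma>' (rel \<sigma> (lift (?l a) 0) U
      (Apps (lift (?l q) 0 \<cdot> Var 0) (map (\<lambda>w. lift w 0) (?vs @ [Var 1])))
      (Apps (lift (?l q') 0 \<cdot> Var 0) (map (\<lambda>w. lift w 0) (?vs' @ [Var 0]))))"
      using rel_FunE[of ?E' ?\<Gamma>' \<sigma> "lift (?l a) 0" T U _ _ "Var 2" "Var 1"]
      by (simp add: eval_nat_numeral del: rel.simps)
  qed
  have IH: "HA ?E ?\<Gamma> (rel \<sigma> (?l a) U (rec_fun \<sigma> (arg_tys U) (?l q) (?l x) (?vs @ [Var 1]))
      (Apps (?l q' \<cdot> ?l m) (?vs' @ [Var 0])))"
    \<comment> \<open>The new pair of variables becomes the last argument on each side, so the lists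
      of argument types grow by the translated type and by \<open>T\<close>.\<close>
    by (rule Fun.IH(2)[OF ar(2) x q, where Vs = "Vs @ [tr_ty Nat \<sigma> T]" and Vs' = "Vs' @ [T]"])
      (use Fun.prems(4-) in \<open>auto simp: list_all2_map1 intro!: list_all2_appendI\<close>)
  show ?case
  proof (rule rel_FunI)
    have t: "infer E (rec_fun \<sigma> (arg_tys (T \<rightarrow> U)) q x vs) = Some (tr_ty Nat \<sigma> (T \<rightarrow> U))"
      by (rule infer_rec_fun[OF Fun.prems(4,7,8,1)])
    then have "infer ?E (?l (rec_fun \<sigma> (arg_tys (T \<rightarrow> U)) q x vs) \<cdot> Var 1) = Some (tr_ty Nat \<sigma> U)"
      by simp
    from Eq_red[OF this, of ?\<Gamma>]
    have e: "HA ?E ?\<Gamma> (Eq (tr_ty Nat \<sigma> U) (?l (rec_fun \<sigma> (arg_tys (T \<rightarrow> U)) q x vs) \<cdot> Var 1)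
        (rec_fun \<sigma> (arg_tys U) (?l q) (?l x) (?vs @ [Var 1])))"
      by (simp only: lift_rec_fun arg_tys.simps red_rec_fun) (simp add: comp_def)
    have "infer ?E (Apps (?l q' \<cdot> ?l m) (?vs' @ [Var 0])) = Some U"
      by (rule infer_Apps[where Ts = "Vs' @ [T]"])
        (use Fun.prems(4-) in \<open>auto simp: list_all2_map1 intro!: list_all2_appendI\<close>)
    from rel_cong[OF IH Eq_sym[OF e] Eq_refl[OF this] ar(2)] Fun.prems(6)
    show "HA ?E ?\<Gamma> (rel \<sigma> (?l a) U (?l (rec_fun \<sigma> (arg_tys (T \<rightarrow> U)) q x vs) \<cdot> Var 1)
      (?l (Apps (q' \<cdot> m) vs') \<cdot> Var 0))"
      by (simp add: comp_def)
  qed (use ar Fun.prems in auto)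
qed simp_all

section \<open>The recursor constant\<close>

lemma infer_tr_Rec:
  assumes "arith_ty \<eta>"
  shows "infer [] (tr_Rec Nat \<sigma> \<eta>) = Some (tr_ty Nat \<sigma> (con_ty (RecC \<eta>)))"
proof -
  let ?q = "Rec (tr_ty Nat \<sigma> \<eta>) \<cdot> Var 2 \<cdot> Lam Nat (Var 2 \<cdot> tr_num Nat \<sigma> (Var 0))"
  let ?E = "[trN Nat \<sigma>, trN Nat \<sigma> \<rightarrow> tr_ty Nat \<sigma> \<eta> \<rightarrow> tr_ty Nat \<sigma> \<eta>, tr_ty Nat \<sigma> \<eta>]"
  have "infer ?E (rec_fun \<sigma> (arg_tys \<eta>) ?q (Var 0) []) = Some (tr_ty Nat \<sigma> \<eta>)"
    by (rule infer_rec_fun[where Vs = "[]"]) (use assms in \<open>auto simp: eval_nat_numeral\<close>)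
  then show ?thesis by (simp add: tr_Rec_rec_fun)
qed

text \<open>Two stages. Induction inside the calculus relates the two recursors at every number
  \<open>n\<close>, where the translated one receives \<open>n\<close> in the form of its constant
  pair. Then \<open>rel_rec_fun\<close> passes from numbers to an arbitrary \<open>x\<close> related
  to \<open>m\<close>.\<close>

lemma rel_tr_Rec:
  assumes ar: "arith_ty \<eta>"
    and b: "HA E \<Gamma> (rel \<sigma> a \<eta> b b')"
    and F: "HA E \<Gamma> (rel \<sigma> a (Nat \<rightarrow> \<eta> \<rightarrow> \<eta>) F F')"
    and x: "HA E \<Gamma> (rel \<sigma> a Nat x m)"
    and ty: "infer E b = Some (tr_ty Nat \<sigma> \<eta>)" "infer E b' = Some \<eta>"
      "infer E F = Some (tr_ty Nat \<sigma> (Nat \<rightarrow> \<eta> \<rightarrow> \<eta>))" "infer E F' = Some (Nat \<rightarrow> \<eta> \<rightarrow> \<eta>)"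
      "infer E x = Some (trN Nat \<sigma>)" "infer E m = Some Nat" "infer E a = Some (Nat \<rightarrow> Nat)"
  shows "HA E \<Gamma> (rel \<sigma> a \<eta> (tr_Rec Nat \<sigma> \<eta> \<cdot> b \<cdot> F \<cdot> x) (Rec \<eta> \<cdot> b' \<cdot> F' \<cdot> m))"
proof -
  let ?T = "tr_ty Nat \<sigma> \<eta>"
  let ?f = "\<lambda>F. Lam Nat (lift F 0 \<cdot> tr_num Nat \<sigma> (Var 0))"
  let ?q = "Rec ?T \<cdot> b \<cdot> ?f F" and ?q' = "Rec \<eta> \<cdot> b' \<cdot> F'"
  let ?A = "rel \<sigma> (lift a 0) \<eta> (lift ?q 0 \<cdot> Var 0) (lift ?q' 0 \<cdot> Var 0)"
  have tf: "infer E (?f F) = Some (Nat \<rightarrow> ?T \<rightarrow> ?T)" using ty by simp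
  have 0: "HA E \<Gamma> (rel \<sigma> a \<eta> (?q \<cdot> Zero) (?q' \<cdot> Zero))"
    by (rule rel_cong[OF b Eq_sym[OF Rec_Zero] Eq_sym[OF Rec_Zero] ar]) (use ty tf in auto)
  let ?E = "Nat # E" and ?\<Gamma> = "?A # lift_fms \<Gamma>"
  let ?r = "lift ?q 0 \<cdot> Var 0" and ?r' = "lift ?q' 0 \<cdot> Var 0"
  have r: "infer ?E ?r = Some ?T" "infer ?E ?r' = Some \<eta>" using ty by auto
  have 1: "HA ?E ?\<Gamma> (rel \<sigma> (lift a 0) \<eta> (lift ?q 0 \<cdot> (Succ \<cdot> Var 0)) (lift ?q' 0 \<cdot> (Succ \<cdot> Var 0)))"
  proof (rule rel_cong[OF _ _ _ ar])
    have A: "HA ?E ?\<Gamma> ?A" by (rule Hyp0) (rule wf_rel, use ar ty r in auto)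
    have "HA ?E ?\<Gamma> (rel \<sigma> (lift a 0) (Nat \<rightarrow> \<eta> \<rightarrow> \<eta>) (lift F 0) (lift F' 0))"
      using HA_lift_Cons[OF F] by (simp only: lift_rel)
    moreover have "HA ?E ?\<Gamma> (rel \<sigma> (lift a 0) Nat (tr_num Nat \<sigma> (Var 0)) (Var 0))"
      by (rule rel_num) (use ty in auto)
    ultimately have "HA ?E ?\<Gamma> (rel \<sigma> (lift a 0) (\<eta> \<rightarrow> \<eta>) (lift F 0 \<cdot> tr_num Nat \<sigma> (Var 0)) (lift F' 0 \<cdot> Var 0))"
      by (rule rel_FunE) auto
    from rel_FunE[OF this A] r
    show "HA ?E ?\<Gamma> (rel \<sigma> (lift a 0) \<eta> (lift F 0 \<cdot> tr_num Nat \<sigma> (Var 0) \<cdot> ?r) (lift F' 0 \<cdot> Var 0 \<cdot> ?r'))"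
      by blast
    have "HA ?E ?\<Gamma> (Eq ?T (lift ?q 0 \<cdot> (Succ \<cdot> Var 0)) (lift (?f F) 0 \<cdot> Var 0 \<cdot> ?r))"
      unfolding lift.simps(2,3) by (rule Rec_Succ) (use ty tf in auto)
    also have "HA ?E ?\<Gamma> (Eq ?T (lift (?f F) 0 \<cdot> Var 0 \<cdot> ?r) (lift F 0 \<cdot> tr_num Nat \<sigma> (Var 0) \<cdot> ?r))"
      using Eq_red[of ?E "lift (?f F) 0 \<cdot> Var 0 \<cdot> ?r" ?T ?\<Gamma>] ty by simp
    finally show "HA ?E ?\<Gamma> (Eq ?T (lift F 0 \<cdot> tr_num Nat \<sigma> (Var 0) \<cdot> ?r) (lift ?q 0 \<cdot> (Succ \<cdot> Var 0)))"
      by (rule Eq_sym)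
    show "HA ?E ?\<Gamma> (Eq \<eta> (lift F' 0 \<cdot> Var 0 \<cdot> ?r') (lift ?q' 0 \<cdot> (Succ \<cdot> Var 0)))"
      unfolding lift.simps(2,3) by (rule Eq_sym[OF Rec_Succ]) (use ty in auto)
  qed (use ty in auto)
  \<comment> \<open>Here the relation must be a formula: it is itself the induction formula.\<close>
  have all: "HA E \<Gamma> (All Nat ?A)"
  proof (rule HA.NatInd)
    show "HA E \<Gamma> (subst_fm ?A Zero 0)" using 0 by simp
    show "HA (Nat # E) ?\<Gamma> (subst_fm (lift_fm ?A 1) (Succ \<cdot> Var 0) 0)" using 1 by simp
    show "wf_fm (Nat # E) ?A" by (rule wf_rel) (use ar ty r in auto)
  qed
  have "infer E (tr_Rec Nat \<sigma> \<eta> \<cdot> b \<cdot> F \<cdot> x) = Some ?T"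
    using ty closed_term(3)[OF infer_tr_Rec[OF ar]] by simp
  from Eq_reds[OF this, of \<Gamma> "Suc (Suc (Suc 0))"]
  have e: "HA E \<Gamma> (Eq ?T (tr_Rec Nat \<sigma> \<eta> \<cdot> b \<cdot> F \<cdot> x) (rec_fun \<sigma> (arg_tys \<eta>) ?q x []))"
    by (simp add: tr_Rec_rec_fun subst_rec_fun eval_nat_numeral)
  have "HA E \<Gamma> (rel \<sigma> a \<eta> (rec_fun \<sigma> (arg_tys \<eta>) ?q x []) (Apps (?q' \<cdot> m) []))"
    by (rule rel_rec_fun[OF ar x, where Vs = "[]" and Vs' = "[]"]) (use all ty in \<open>simp_all\<close>)
  then have "HA E \<Gamma> (rel \<sigma> a \<eta> (rec_fun \<sigma> (arg_tys \<eta>) ?q x []) (?q' \<cdot> m))"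
    by simp
  then show ?thesis
    by (rule rel_cong[OF _ Eq_sym[OF e] Eq_refl ar]) (use ty in simp_all)
qed

section \<open>The fundamental theorem of the logical relation\<close>

definition up :: "(nat \<Rightarrow> tm) \<Rightarrow> nat \<Rightarrow> tm" where
  "up \<theta> = case_nat (Var 0) (\<lambda>i. lift (\<theta> i) 0)"

text \<open>The fundamental theorem puts related terms for all free variables at once, and the two
  sides receive different environments; hence simultaneous substitution.\<close>

primrec psubst :: "(nat \<Rightarrow> tm) \<Rightarrow> tm \<Rightarrow> tm" where
  "psubst \<theta> (Var i) = \<theta> i"
| "psubst \<theta> (Con c) = Con c"
| "psubst \<theta> (t \<cdot> u) = psubst \<theta> t \<cdot> psubst \<theta> u"
| "psubst \<theta> (Lam T t) = Lam T (psubst (up \<theta>) t)"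

lemma lift_psubst: "lift (psubst \<theta> t) k = psubst (\<lambda>i. lift (\<theta> i) k) t"
proof (induction t arbitrary: \<theta> k)
  case (Lam T t)
  have "(\<lambda>i. lift (up \<theta> i) (Suc k)) = up (\<lambda>i. lift (\<theta> i) k)"
    by (auto simp: up_def split: nat.split)
  then show ?case using Lam by simp
qed simp_all

lemma subst_psubst: "subst (psubst \<theta> t) s k = psubst (\<lambda>i. subst (\<theta> i) s k) t"
proof (induction t arbitrary: \<theta> s k)
  case (Lam T t)
  have "(\<lambda>i. subst (up \<theta> i) (lift s 0) (Suc k)) = up (\<lambda>i. subst (\<theta> i) s k)"
    by (auto simp: up_def subst_lift_0 split: nat.split)
  then show ?case using Lam by simp
qed simp_all

lemma subst_psubst_up: "subst (psubst (up \<theta>) t) s 0 = psubst (case_nat s \<theta>) t"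
proof -
  have "(\<lambda>i. subst (up \<theta> i) s 0) = case_nat s \<theta>"
    by (auto simp: up_def split: nat.split)
  then show ?thesis by (simp add: subst_psubst)
qed

lemma infer_psubst:
  "infer E t = Some T \<Longrightarrow> (\<And>i. i < length E \<Longrightarrow> infer F (\<theta> i) = Some (E ! i)) \<Longrightarrow>
    infer F (psubst \<theta> t) = Some T"
proof (induction t arbitrary: E F T \<theta>)
  case (App t u)
  from App.prems(1) obtain S where S: "infer E t = Some (S \<rightarrow> T)" "infer E u = Some S"
    unfolding infer_App by blast
  show ?case using App.IH(1)[OF S(1) App.prems(2)] App.IH(2)[OF S(2) App.prems(2)] by simp
next
  case (Lam S t)
  from Lam.prems(1) obtain U where U: "T = S \<rightarrow> U" "infer (S # E) t = Some U"
    unfolding infer_Lam by blast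
  have "infer (S # F) (psubst (up \<theta>) t) = Some U"
    by (rule Lam.IH[OF U(2)]) (use Lam.prems(2) in \<open>auto simp: up_def split: nat.split\<close>)
  then show ?case using U by simp
qed (auto split: if_splits)

lemma psubst_id: "infer E t = Some T \<Longrightarrow> (\<And>i. i < length E \<Longrightarrow> \<theta> i = Var i) \<Longrightarrow> psubst \<theta> t = t"
proof (induction t arbitrary: E T \<theta>)
  case (App t u)
  from App.prems(1) obtain S where S: "infer E t = Some (S \<rightarrow> T)" "infer E u = Some S"
    unfolding infer_App by blast
  show ?case using App.IH(1)[OF S(1) App.prems(2)] App.IH(2)[OF S(2) App.prems(2)] by simp
next
  case (Lam S t)
  from Lam.prems(1) obtain U where U: "T = S \<rightarrow> U" "infer (S # E) t = Some U"
    unfolding infer_Lam by blast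
  have "psubst (up \<theta>) t = t"
    by (rule Lam.IH[OF U(2)]) (use Lam.prems(2) in \<open>auto simp: up_def split: nat.split\<close>)
  then show ?case by simp
qed (auto split: if_splits)

lemma psubst_closed: "infer [] t = Some T \<Longrightarrow> psubst \<theta> t = t"
  by (rule psubst_id) auto

section \<open>Typing of the translation and the main induction\<close>

lemma infer_tr_con: "arith_ty (con_ty c) \<Longrightarrow> infer [] (tr_con \<sigma> c) = Some (tr_ty Nat \<sigma> (con_ty c))"
  using infer_tr_Succ infer_tr_Rec by (cases c) auto

text \<open>The special variable is the last entry of the source context. It has no counterpart in
  the translated context, as its translation is a closed term.\<close>

lemma infer_tr:
  "infer (E @ [Nat \<rightarrow> Nat]) t = Some T \<Longrightarrow> \<forall>S \<in> set E. arith_ty S \<Longrightarrow> arith_tm t \<Longrightarrow>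
    arith_ty T \<and> infer (map (tr_ty Nat \<sigma>) E) (tr \<sigma> (length E) t) = Some (tr_ty Nat \<sigma> T)"
proof (induction t arbitrary: E T)
  case (Var i)
  then show ?case by (auto simp: nth_append split: if_splits)
next
  case (Con c)
  then show ?case using closed_term(3)[OF infer_tr_con] by auto
next
  case (App t u)
  from App.prems(1) obtain S where S: "infer (E @ [Nat \<rightarrow> Nat]) t = Some (S \<rightarrow> T)"
    "infer (E @ [Nat \<rightarrow> Nat]) u = Some S"
    unfolding infer_App by blast
  show ?case using App.IH(1)[OF S(1)] App.IH(2)[OF S(2)] App.prems by simp
next
  case (Lam S t)
  from Lam.prems(1) obtain U where U: "T = S \<rightarrow> U" "infer ((S # E) @ [Nat \<rightarrow> Nat]) t = Some U"
    unfolding infer_Lam by auto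
  show ?case using Lam.IH[OF U(2)] Lam.prems U by simp
qed

lemma rel_tr_con:
  assumes "arith_ty (con_ty c)" "infer E a = Some (Nat \<rightarrow> Nat)"
  shows "HA E \<Gamma> (rel \<sigma> a (con_ty c) (tr_con \<sigma> c) (Con c))"
proof -
  have Zero: "HA E \<Gamma> (rel \<sigma> a Nat (tr_num Nat \<sigma> Zero) Zero)"
    by (rule rel_num) (use assms in auto)
  let ?l = "\<lambda>t. lift (lift t 0) 0"
  have Succ: "HA E \<Gamma> (rel \<sigma> a (Nat \<rightarrow> Nat) (tr_Succ Nat \<sigma>) Succ)"
  proof (rule rel_FunI)
    let ?E = "Nat # trN Nat \<sigma> # E" and ?\<Gamma> = "rel \<sigma> (?l a) Nat (Var 1) (Var 0) # lift_fms (lift_fms \<Gamma>)"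
    have "HA ?E ?\<Gamma> (rel \<sigma> (?l a) Nat (Var 1) (Var 0))"
      by (rule Hyp0) (rule wf_rel, use assms(2) in auto)
    from rel_Succ[OF this] assms(2)
    show "HA (Nat # tr_ty Nat \<sigma> Nat # E) ?\<Gamma> (rel \<sigma> (?l a) Nat (?l (tr_Succ Nat \<sigma>) \<cdot> Var 1) (?l Succ \<cdot> Var 0))"
      by (simp del: rel.simps)
  qed (use assms in auto)
  have Rec: "HA E \<Gamma> (rel \<sigma> a (\<eta> \<rightarrow> (Nat \<rightarrow> \<eta> \<rightarrow> \<eta>) \<rightarrow> Nat \<rightarrow> \<eta>) (tr_Rec Nat \<sigma> \<eta>) (Rec \<eta>))"
    if ar: "arith_ty \<eta>" for \<eta>
  proof (rule rel_FunI, rule rel_FunI, rule rel_FunI)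
    let ?c = "tr_ty Nat \<sigma>" and ?F = "Nat \<rightarrow> \<eta> \<rightarrow> \<eta>"
    let ?E = "Nat # ?c Nat # ?F # ?c ?F # \<eta> # ?c \<eta> # E"
    let ?b = "?l (?l (?l a))"
    let ?\<Gamma> = "rel \<sigma> ?b Nat (Var 1) (Var 0) # lift_fms (lift_fms
        (rel \<sigma> (?l (?l a)) ?F (Var 1) (Var 0) # lift_fms (lift_fms
          (rel \<sigma> (?l a) \<eta> (Var 1) (Var 0) # lift_fms (lift_fms \<Gamma>)))))"
    have "HA ?E ?\<Gamma> (rel \<sigma> ?b \<eta> (tr_Rec Nat \<sigma> \<eta> \<cdot> Var 5 \<cdot> Var 3 \<cdot> Var 1) (Rec \<eta> \<cdot> Var 4 \<cdot> Var 2 \<cdot> Var 0))"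
    proof (rule rel_tr_Rec[OF ar])
      show "HA ?E ?\<Gamma> (rel \<sigma> ?b \<eta> (Var 5) (Var 4))"
        by (rule HA.Hyp) (use ar assms(2) in \<open>auto intro!: wf_rel simp: eval_nat_numeral simp del: rel.simps\<close>)
      show "HA ?E ?\<Gamma> (rel \<sigma> ?b ?F (Var 3) (Var 2))"
        by (rule HA.Hyp) (use ar assms(2) in \<open>auto intro!: wf_rel simp: eval_nat_numeral simp del: rel.simps\<close>)
      show "HA ?E ?\<Gamma> (rel \<sigma> ?b Nat (Var 1) (Var 0))"
        by (rule HA.Hyp) (use ar assms(2) in \<open>auto intro!: wf_rel simp: eval_nat_numeral simp del: rel.simps\<close>)
    qed (use assms(2) in \<open>auto simp: eval_nat_numeral\<close>)
    then show "HA ?E ?\<Gamma> (rel \<sigma> ?b \<eta> (?l (?l (?l (tr_Rec Nat \<sigma> \<eta>) \<cdot> Var 1) \<cdot> Var 1) \<cdot> Var 1)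
       (?l (?l (?l (Rec \<eta>) \<cdot> Var 0) \<cdot> Var 0) \<cdot> Var 0))"
      by (simp add: eval_nat_numeral closed_term[OF infer_tr_Rec[OF ar]] del: rel.simps)
  qed (use ar assms(2) in auto)
  show ?thesis using Zero Succ Rec assms(1) by (cases c) auto
qed

text \<open>The ordinary variables are replaced by related terms. On the source side the special
  variable becomes \<open>a\<close>; on the translated side nothing is left to replace, as
  \<open>tr_alpha\<close> is closed.\<close>

lemma rel_tr:
  assumes "infer (E1 @ [Nat \<rightarrow> Nat]) t = Some T" "\<forall>S \<in> set E1. arith_ty S" "arith_tm t"
    "\<And>i. i < length E1 \<Longrightarrow> infer E (\<theta> i) = Some (tr_ty Nat \<sigma> (E1 ! i)) \<and> infer E (\<theta>' i) = Some (E1 ! i) \<and>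
      HA E \<Gamma> (rel \<sigma> a (E1 ! i) (\<theta> i) (\<theta>' i))"
    "\<theta>' (length E1) = a" "infer E a = Some (Nat \<rightarrow> Nat)"
  shows "HA E \<Gamma> (rel \<sigma> a T (psubst \<theta> (tr \<sigma> (length E1) t)) (psubst \<theta>' t))"
  using assms
proof (induction t arbitrary: E1 T E \<Gamma> a \<theta> \<theta>')
  case (Var i)
  let ?l = "\<lambda>t. lift (lift t 0) 0"
  \<comment> \<open>This settles the special variable; every other index is covered by the
    environment.\<close>
  have "HA E \<Gamma> (rel \<sigma> a (Nat \<rightarrow> Nat) (tr_alpha \<sigma>) a)"
  proof (rule rel_FunI)
    let ?E = "Nat # trN Nat \<sigma> # E" and ?\<Gamma> = "rel \<sigma> (?l a) Nat (Var 1) (Var 0) # lift_fms (lift_fms \<Gamma>)"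
    have "HA ?E ?\<Gamma> (rel \<sigma> (?l a) Nat (Var 1) (Var 0))"
      by (rule Hyp0) (rule wf_rel, use Var.prems(6) in auto)
    from rel_alpha[OF this] Var.prems(6)
    show "HA (Nat # tr_ty Nat \<sigma> Nat # E) ?\<Gamma> (rel \<sigma> (?l a) Nat (?l (tr_alpha \<sigma>) \<cdot> Var 1) (?l a \<cdot> Var 0))"
      by (simp del: rel.simps)
  qed (use Var.prems in auto)
  then show ?case
    using Var.prems by (auto simp: nth_append psubst_closed[OF infer_tr_alpha] simp del: rel.simps split: if_splits)
next
  case (Con c)
  then show ?case using rel_tr_con by (auto simp: psubst_closed[OF infer_tr_con] simp del: rel.simps)
next
  case (App t u)
  let ?E = "E1 @ [Nat \<rightarrow> Nat]"
  from App.prems(1) obtain S where S: "infer ?E t = Some (S \<rightarrow> T)" "infer ?E u = Some S"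
    unfolding infer_App by blast
  have ar: "arith_tm t" "arith_tm u" using App.prems(3) by auto
  have "infer E (psubst \<theta> (tr \<sigma> (length E1) u)) = Some (tr_ty Nat \<sigma> S)"
    by (rule infer_psubst) (use infer_tr[OF S(2) App.prems(2) ar(2)] App.prems(4) in auto)
  moreover have "infer E (psubst \<theta>' u) = Some S"
    by (rule infer_psubst[OF S(2)]) (use App.prems(4-6) in \<open>auto simp: nth_append less_Suc_eq\<close>)
  ultimately show ?case
    using rel_FunE[OF App.IH(1)[OF S(1) App.prems(2) ar(1) App.prems(4-6)]
      App.IH(2)[OF S(2) App.prems(2) ar(2) App.prems(4-6)]] by simp
next
  case (Lam S t)
  let ?l = "\<lambda>t. lift (lift t 0) 0" and ?r = "tr \<sigma> (length (S # E1)) t"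
  let ?E = "S # tr_ty Nat \<sigma> S # E" and ?\<Gamma> = "rel \<sigma> (?l a) S (Var 1) (Var 0) # lift_fms (lift_fms \<Gamma>)"
  \<comment> \<open>The bound variable goes to the two fresh variables introduced by
    \<open>rel_FunI\<close>, and the old entries are lifted past both.\<close>
  let ?\<theta> = "case_nat (Var 1) (\<lambda>i. ?l (\<theta> i))" and ?\<theta>' = "case_nat (Var 0) (\<lambda>i. ?l (\<theta>' i))"
  from Lam.prems(1) obtain U where U: "T = S \<rightarrow> U" "infer ((S # E1) @ [Nat \<rightarrow> Nat]) t = Some U"
    unfolding infer_Lam by auto
  have ar: "\<forall>S \<in> set (S # E1). arith_ty S" "arith_tm t" "arith_ty S" using Lam.prems(2,3) by auto
  have arU: "arith_ty U" and r: "infer (map (tr_ty Nat \<sigma>) (S # E1)) ?r = Some (tr_ty Nat \<sigma> U)"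
    using infer_tr[OF U(2) ar(1,2)] by blast+
  have env: "infer ?E (?\<theta> i) = Some (tr_ty Nat \<sigma> ((S # E1) ! i)) \<and> infer ?E (?\<theta>' i) = Some ((S # E1) ! i) \<and>
      HA ?E ?\<Gamma> (rel \<sigma> (?l a) ((S # E1) ! i) (?\<theta> i) (?\<theta>' i))" if i: "i < length (S # E1)" for i
  proof (cases i)
    case 0
    have "HA ?E ?\<Gamma> (rel \<sigma> (?l a) S (Var 1) (Var 0))"
      by (rule Hyp0) (rule wf_rel, use ar Lam.prems(6) in auto)
    then show ?thesis using 0 by simp
  next
    case (Suc j)
    with i have j: "infer E (\<theta> j) = Some (tr_ty Nat \<sigma> (E1 ! j))" "infer E (\<theta>' j) = Some (E1 ! j)"
      "HA E \<Gamma> (rel \<sigma> a (E1 ! j) (\<theta> j) (\<theta>' j))" using Lam.prems(4) by simp_all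
    have "HA ?E ?\<Gamma> (rel \<sigma> (?l a) (E1 ! j) (?l (\<theta> j)) (?l (\<theta>' j)))"
      using HA_weaken_Cons[OF HA_lift[OF HA_lift[OF j(3)]]] by (simp only: lift_rel)
    then show ?thesis using j(1,2) Suc by simp
  qed
  have IH: "HA ?E ?\<Gamma> (rel \<sigma> (?l a) U (psubst ?\<theta> ?r) (psubst ?\<theta>' t))"
    by (rule Lam.IH[OF U(2) ar(1,2) env]) (use Lam.prems in auto)
  have t1: "infer ?E (psubst (\<lambda>i. ?l (\<theta> i)) (Lam (tr_ty Nat \<sigma> S) ?r)) = Some (tr_ty Nat \<sigma> (S \<rightarrow> U))"
    by (rule infer_psubst[where E = "map (tr_ty Nat \<sigma>) E1"]) (use r Lam.prems(4) in auto)
  have t2: "infer ?E (psubst (\<lambda>i. ?l (\<theta>' i)) (Lam S t)) = Some (S \<rightarrow> U)"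
    by (rule infer_psubst[where E = "E1 @ [Nat \<rightarrow> Nat]"])
      (use U(2) Lam.prems(4-6) in \<open>auto simp: nth_append less_Suc_eq\<close>)
  have e1: "HA ?E ?\<Gamma> (Eq (tr_ty Nat \<sigma> U)
      (psubst (\<lambda>i. ?l (\<theta> i)) (Lam (tr_ty Nat \<sigma> S) ?r) \<cdot> Var 1) (psubst ?\<theta> ?r))"
    using Eq_red[of ?E "psubst (\<lambda>i. ?l (\<theta> i)) (Lam (tr_ty Nat \<sigma> S) ?r) \<cdot> Var 1" "tr_ty Nat \<sigma> U" ?\<Gamma>] t1
    by (simp add: subst_psubst_up del: infer.simps(4))
  have e2: "HA ?E ?\<Gamma> (Eq U (psubst (\<lambda>i. ?l (\<theta>' i)) (Lam S t) \<cdot> Var 0) (psubst ?\<theta>' t))"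
    using Eq_red[of ?E "psubst (\<lambda>i. ?l (\<theta>' i)) (Lam S t) \<cdot> Var 0" U ?\<Gamma>] t2
    by (simp add: subst_psubst_up del: infer.simps(4))
  show ?case
    unfolding U(1)
  proof (rule rel_FunI)
    from rel_cong[OF IH Eq_sym[OF e1] Eq_sym[OF e2] arU] Lam.prems(6)
    show "HA ?E ?\<Gamma> (rel \<sigma> (?l a) U (?l (psubst \<theta> (tr \<sigma> (length E1) (Lam S t))) \<cdot> Var 1) (?l (psubst \<theta>' (Lam S t)) \<cdot> Var 0))"
      by (simp only: lift_psubst tr.simps) (simp del: psubst.simps)
  qed (use ar Lam.prems in auto)
qed


section \<open>Levels of the recursors\<close>

lemma rec_level_le_lift [simp]: "rec_level_le i (lift t k) \<longleftrightarrow> rec_level_le i t"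
  by (induction t arbitrary: k) auto

lemma rec_level_le_Apps [simp]: "rec_level_le i (Apps t us) \<longleftrightarrow> rec_level_le i t \<and> (\<forall>u \<in> set us. rec_level_le i u)"
  by (induction us rule: rev_induct) auto

lemma rec_level_le_Lams [simp]: "rec_level_le i (Lams Ts t) \<longleftrightarrow> rec_level_le i t"
  by (induction Ts) auto

lemma rec_level_le_mono: "rec_level_le i t \<Longrightarrow> i \<le> j \<Longrightarrow> rec_level_le j t"
  by (induction t) (auto split: con.splits)

lemma rec_level_le_arith [simp]: "rec_level_le i Pred" "rec_level_le i Monus"
  by (simp_all add: Pred_def Monus_def)

lemma rec_level_le_IfLess [simp]: "rec_level_le i (IfLess T) \<longleftrightarrow> level T \<le> i"
  by (simp add: IfLess_def)

lemma rec_level_le_Psi [simp]: "rec_level_le i (Psi \<tau> \<sigma>) \<longleftrightarrow> max (level \<tau> + 1) (level \<sigma>) \<le> i"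
  by (auto simp: Psi_def phi_def)

lemma rec_level_le_tr_num [simp]: "rec_level_le i (tr_num \<tau> \<sigma> k) \<longleftrightarrow> rec_level_le i k"
  by (simp add: tr_num_def)

text \<open>The base case gives the constant: \<open>H\<close> has level
  \<open>1 + max 1 (level \<sigma>)\<close>, so a bar recursor has level
  \<open>2 + max 1 (level \<sigma>)\<close>, and the value component has only level 2. An arrow adds
  to both sides alike.\<close>

lemma level_tr_ty:
  "arith_ty T \<Longrightarrow> level (tr_ty Nat \<sigma> T) \<le> 2 + max 1 (level \<sigma>) + level T"
  by (induction T) auto

lemma rec_level_le_tr:
  "arith_tm t \<Longrightarrow> rec_level_le i t \<Longrightarrow> rec_level_le (2 + max 1 (level \<sigma>) + i) (tr \<sigma> d t)"
proof (induction t arbitrary: d)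
  case (Var n)
  then show ?case by (auto simp: tr_alpha_def)
next
  case (Con c)
  then show ?case
  proof (cases c)
    case (RecC \<eta>)
    then have "level (tr_ty Nat \<sigma> \<eta>) \<le> 2 + max 1 (level \<sigma>) + i"
      using level_tr_ty[of \<eta> \<sigma>] Con by auto
    then show ?thesis using RecC by (simp add: tr_Rec_def Let_def)
  qed (simp_all add: tr_Succ_def)
qed simp_all

text \<open>Besides those in \<open>Y\<close>, the critical recursors are the one of
  \<open>phi\<close>, at functions from sequences to \<open>\<sigma>\<close>, and that of the case
  distinction at \<open>\<sigma>\<close>.\<close>

lemma rec_level_le_Phi:
  assumes "rec_level_le i Y" "max 1 (level \<sigma>) \<le> i"
  shows "rec_level_le i (Phi Nat \<sigma> Y)"
  using assms by (simp add: Phi_def HY_def)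

theorem corollary3p5:
  fixes \<sigma> :: ty and t :: tm
  assumes "[Nat \<rightarrow> Nat] \<turnstile> t \<triangleright> Nat" and "arith_tm t"
  shows "let Y = Lam (Nat \<rightarrow> Nat) t;
             \<xi> = Phi Nat \<sigma> Y \<cdot> BR Nat \<sigma> (tr \<sigma> 0 t)
         in HA [] [] (Spector_bar_recursor Nat \<sigma> Y \<xi>) \<and>
            (\<forall>i. in_T i [Nat \<rightarrow> Nat] t Nat \<longrightarrow>
                 in_T (2 + max 1 (level \<sigma>) + i) [] \<xi> (BR_ty Nat \<sigma>))"
proof -
  let ?A = "Nat \<rightarrow> Nat"
  let ?Y = "Lam ?A t" and ?u = "tr \<sigma> 0 t"
  have t: "infer [?A] t = Some Nat" using assms(1) by simp
  then have Y: "infer [] ?Y = Some (Val_ty Nat)" by simp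
  have u: "infer [] ?u = Some (trN Nat \<sigma>)"
    using infer_tr[of "[]" t Nat \<sigma>] t assms(2) by simp
  then have B: "infer [] (BR Nat \<sigma> ?u) = Some (BR_ty Nat \<sigma>)" by simp
  note closed = closed_term[OF u]
  \<comment> \<open>The value chosen for the special variable is that variable itself, so the
    substitution leaves \<open>t\<close> unchanged.\<close>
  have "HA [?A] [] (rel \<sigma> (Var 0) Nat (psubst Var ?u) (psubst Var t))"
    using rel_tr[of "[]" t Nat "[?A]" Var \<sigma> Var "[]" "Var 0"] t assms(2) by (simp del: rel.simps)
  then have r: "HA [?A] [] (rel \<sigma> (Var 0) Nat ?u t)"
    using psubst_id[OF t] psubst_closed[OF u] by (simp del: rel.simps)
  have e: "HA [?A] [] (Eq Nat (lift ?Y 0 \<cdot> Var 0) t)"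
    using Eq_beta[of ?A "[?A]" "lift t (Suc 0)" Nat "Var 0" "[]"] t by simp
  have "HA [?A] [] (Eq Nat (lift (Val Nat \<sigma> ?u) 0 \<cdot> Var 0) t)"
    using rel_NatE(2)[OF r] by (simp add: closed)
  \<comment> \<open>Both functionals, applied to the free variable, equal \<open>t\<close>;
    extensionality removes the variable.\<close>
  from Eq_trans[OF this Eq_sym[OF e]]
  have V: "HA [] [] (Eq (Val_ty Nat) (Val Nat \<sigma> ?u) ?Y)"
    using u t by (intro Eq_ext) simp_all
  have "HA [] [] (All ?A (regular \<sigma> (Val Nat \<sigma> ?u) (BR Nat \<sigma> ?u)))"
    using rel_NatE(1)[OF r] by (intro HA.AllI) simp
  \<comment> \<open>Both components are closed, so the quantified function does not occur in the
    formula. The zero function serves as a closed instance that removes the quantifier.\<close>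
  from HA.AllE[OF this, of "zero_obj ?A"] have "HA [] [] (regular \<sigma> (Val Nat \<sigma> ?u) (BR Nat \<sigma> ?u))"
    by (simp add: closed)
  from regular_cong[OF this V Eq_refl[OF B]]
  have "HA [] [] (Spector_bar_recursor Nat \<sigma> ?Y (Phi Nat \<sigma> ?Y \<cdot> BR Nat \<sigma> ?u))"
    by (rule Phi_Spector_bar_recursor[OF Y B])
  moreover have "in_T (2 + max 1 (level \<sigma>) + i) [] (Phi Nat \<sigma> ?Y \<cdot> BR Nat \<sigma> ?u) (BR_ty Nat \<sigma>)"
    if "in_T i [?A] t Nat" for i
  proof -
    have i: "rec_level_le i t" using that by (simp add: in_T_def)
    then have "rec_level_le (2 + max 1 (level \<sigma>) + i) (Phi Nat \<sigma> ?Y)"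
      by (intro rec_level_le_Phi) (auto intro: rec_level_le_mono)
    moreover have "rec_level_le (2 + max 1 (level \<sigma>) + i) ?u"
      by (rule rec_level_le_tr[OF assms(2) i])
    ultimately show ?thesis using infer_Phi[OF Y, of \<sigma>] B by (simp add: in_T_def)
  qed
  ultimately show ?thesis by simp
qed

end
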